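(* Let $K$ be a scattered compact line and let $M(K)$ be the set of all internal points of $K$ of uncountable character. (1) The following assertions are equivalent: (i) $K$ has a retractional skeleton. (ii) $C(K)$ has a $1$-projectional skeleton. (iii) $C(K)$ has the continuous $k$-SCP for some $k<2$. (iv) $M(K)=\emptyset$. (2) If $M(K)$ is finite, then $C(K)$ has a $4$-projectional skeleton. (3) If $M(K)$ is countable, then $C(K)$ has the continuous $3$-SCP.
   Context: A compact line is a linearly ordered space that is compact in its order topology. A point $x$ of a compact line is external if it is isolated in $[x,\to)$ or in $(\leftarrow,x]$; otherwise it is internal. A point has uncountable character if it has no countable neighborhood base. For a Banach space $E$, $\operatorname{Sep}(E)$ is the set of closed separable linear subspaces ordered by inclusion; sequences $(S_n)$ have supremum $\overline{\operatorname{span}\bigcup_n S_n}$. A subset $\mathcal F\subseteq\operatorname{Sep}(E)$ is closed cofinal if every $S\in\operatorname{Sep}(E)$ is contained in some $F\in\mathcal F$, and whenever $F_1\subseteq F_2\subseteq\cdots$ are from $\mathcal F$ their supremum belongs to $\mathcal F$. $E$ has the continuous $k$-SCP ($k\ge1$) if there is a closed cofinal $\mathcal F\subseteq\operatorname{Sep}(E)$ each element of which is the range of a bounded linear projection on $E$ of norm at most $k$. A projectional skeleton on $E$ is a closed cofinal $\mathcal F\subseteq\operatorname{Sep}(E)$ together with bounded linear projections $P_S$ of $E$ onto $S$, $S\in\mathcal F$, such that $P_S\circ P_T=P_S$ whenever $S\subseteq T$; it is a $k$-projectional skeleton if $\|P_S\|\le k$ for all $S\in\mathcal F$. A retractional skeleton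 on a compact space $K$ is a family of continuous retractions $r_s:K\to K$ indexed by an up-directed partially ordered set $\Sigma$ such that: each $r_s[K]$ is metrizable; $r_s\circ r_t=r_t\circ r_s=r_s$ whenever $s\le t$; every sequence $s_1\le s_2\le\cdots$ in $\Sigma$ has a supremum $t\in\Sigma$ and $r_t(x)=\lim_n r_{s_n}(x)$ for every $x\in K$; and $x=\lim_{s\in\Sigma}r_s(x)$ for every $x\in K$. *)

theory Defs
  imports "HOL-Analysis.Analysis"
begin

text \<open>
  A compact line is a type of class \<^class>\<open>linorder_topology\<close> (a linearly ordered set with its
  order topology) such that \<^term>\<open>UNIV\<close> is compact. For compact \<open>K\<close> the type of bounded
  continuous functions from \<open>K\<close> to the reals, with its supremum norm, is the Banach space \<open>C(K)\<close>.
  The library makes this type an instance of \<^class>\<open>banach\<close> only for metric \<open>K\<close>, so the notions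
  for a Banach space below are typed over \<^class>\<open>real_normed_vector\<close>; completeness for arbitrary
  \<open>K\<close> is the following lemma.
\<close>

lemma Cauchy_bcontfun_convergent:
  fixes f :: "nat \<Rightarrow> 'a::topological_space \<Rightarrow>\<^sub>C 'b::complete_space"
  assumes "Cauchy f"
  shows "convergent f"
proof -
  obtain g where "uniform_limit UNIV f g sequentially"
    using assms uniformly_convergent_eq_cauchy[of "\<lambda>_. True" f]
    unfolding Cauchy_def uniform_limit_sequentially_iff
    by (metis dist_fun_lt_imp_dist_val_lt)
  from uniform_limit_bcontfunE[OF this sequentially_bot]
  obtain l where "f \<longlonglongrightarrow> l" by metis
  then show ?thesis by (rule convergentI)
qed

section \<open>Compact lines\<close>

definition scattered_space :: "'a::topological_space itself \<Rightarrow> bool" where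
  "scattered_space _ \<longleftrightarrow> (\<forall>A::'a set. A \<noteq> {} \<longrightarrow> (\<exists>x. x isolated_in A))"

definition external_point :: "'a::linorder_topology \<Rightarrow> bool" where
  "external_point x \<longleftrightarrow> x isolated_in {x..} \<or> x isolated_in {..x}"

abbreviation internal_point :: "'a::linorder_topology \<Rightarrow> bool" where
  "internal_point x \<equiv> \<not> external_point x"

definition nbhd_base :: "'a::topological_space \<Rightarrow> 'a set set \<Rightarrow> bool" where
  "nbhd_base x \<B> \<longleftrightarrow>
     (\<forall>N\<in>\<B>. x \<in> interior N) \<and> (\<forall>U. open U \<and> x \<in> U \<longrightarrow> (\<exists>N\<in>\<B>. N \<subseteq> U))"

definition uncountable_character :: "'a::topological_space \<Rightarrow> bool" where
  "uncountable_character x \<longleftrightarrow> \<not> (\<exists>\<B>. countable \<B> \<and> nbhd_base x \<B>)"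

definition M_points :: "'a::linorder_topology set" where
  "M_points = {x. internal_point x \<and> uncountable_character x}"

section \<open>Separable subspaces and projections of a Banach space\<close>

definition Sep :: "'e::real_normed_vector set set" where
  "Sep = {S. closed S \<and> subspace S \<and> separable_space (top_of_set S)}"

definition closed_cofinal :: "'e::real_normed_vector set set \<Rightarrow> bool" where
  "closed_cofinal \<F> \<longleftrightarrow>
     \<F> \<subseteq> Sep \<and>
     (\<forall>S\<in>Sep. \<exists>F\<in>\<F>. S \<subseteq> F) \<and>
     (\<forall>F :: nat \<Rightarrow> 'e set. incseq F \<and> range F \<subseteq> \<F> \<longrightarrow> closure (span (\<Union>n. F n)) \<in> \<F>)"

definition bounded_projection_onto :: "'e::real_normed_vector set \<Rightarrow> ('e \<Rightarrow> 'e) \<Rightarrow> bool" where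
  "bounded_projection_onto S P \<longleftrightarrow> bounded_linear P \<and> P \<circ> P = P \<and> range P = S"

definition continuous_SCP :: "'e::real_normed_vector itself \<Rightarrow> real \<Rightarrow> bool" where
  "continuous_SCP _ k \<longleftrightarrow>
     (\<exists>\<F> :: 'e set set. closed_cofinal \<F> \<and>
        (\<forall>S\<in>\<F>. \<exists>P. bounded_projection_onto S P \<and> onorm P \<le> k))"

definition projectional_skeleton :: "'e::real_normed_vector set set \<Rightarrow> ('e set \<Rightarrow> 'e \<Rightarrow> 'e) \<Rightarrow> bool" where
  "projectional_skeleton \<F> P \<longleftrightarrow>
     closed_cofinal \<F> \<and>
     (\<forall>S\<in>\<F>. bounded_projection_onto S (P S)) \<and>
     (\<forall>S\<in>\<F>. \<forall>T\<in>\<F>. S \<subseteq> T \<longrightarrow> P S \<circ> P T = P S)"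

definition has_projectional_skeleton :: "'e::real_normed_vector itself \<Rightarrow> real \<Rightarrow> bool" where
  "has_projectional_skeleton _ k \<longleftrightarrow>
     (\<exists>(\<F> :: 'e set set) P. projectional_skeleton \<F> P \<and> (\<forall>S\<in>\<F>. onorm (P S) \<le> k))"

section \<open>Retractional skeletons\<close>

definition up_directed_on :: "'i set \<Rightarrow> ('i \<times> 'i) set \<Rightarrow> bool" where
  "up_directed_on \<Sigma> R \<longleftrightarrow>
     \<Sigma> \<noteq> {} \<and> (\<forall>s\<in>\<Sigma>. \<forall>t\<in>\<Sigma>. \<exists>u\<in>\<Sigma>. (s, u) \<in> R \<and> (t, u) \<in> R)"

definition is_supremum_in :: "'i set \<Rightarrow> ('i \<times> 'i) set \<Rightarrow> 'i set \<Rightarrow> 'i \<Rightarrow> bool" where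
  "is_supremum_in \<Sigma> R A t \<longleftrightarrow>
     t \<in> \<Sigma> \<and> (\<forall>s\<in>A. (s, t) \<in> R) \<and>
     (\<forall>u\<in>\<Sigma>. (\<forall>s\<in>A. (s, u) \<in> R) \<longrightarrow> (t, u) \<in> R)"

text \<open>For a nonempty up-directed set this is the filter generated by the tails, so that
  convergence along it is convergence of nets indexed by \<open>\<Sigma>\<close>.\<close>

definition tails_filter :: "'i set \<Rightarrow> ('i \<times> 'i) set \<Rightarrow> 'i filter" where
  "tails_filter \<Sigma> R = (INF s\<in>\<Sigma>. principal {t\<in>\<Sigma>. (s, t) \<in> R})"

definition retractional_skeleton ::
    "'i set \<Rightarrow> ('i \<times> 'i) set \<Rightarrow> ('i \<Rightarrow> 'a::topological_space \<Rightarrow> 'a) \<Rightarrow> bool" where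
  "retractional_skeleton \<Sigma> R r \<longleftrightarrow>
     partial_order_on \<Sigma> R \<and> up_directed_on \<Sigma> R \<and>
     (\<forall>s\<in>\<Sigma>. retraction UNIV (range (r s)) (r s)) \<and>
     (\<forall>s\<in>\<Sigma>. metrizable_space (top_of_set (range (r s)))) \<and>
     (\<forall>s\<in>\<Sigma>. \<forall>t\<in>\<Sigma>. (s, t) \<in> R \<longrightarrow> r s \<circ> r t = r s \<and> r t \<circ> r s = r s) \<and>
     (\<forall>\<sigma> :: nat \<Rightarrow> 'i. range \<sigma> \<subseteq> \<Sigma> \<and> (\<forall>n. (\<sigma> n, \<sigma> (Suc n)) \<in> R) \<longrightarrow>
        (\<exists>t. is_supremum_in \<Sigma> R (range \<sigma>) t \<and> (\<forall>x. (\<lambda>n. r (\<sigma> n) x) \<longlonglongrightarrow> r t x))) \<and>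
     (\<forall>x. ((\<lambda>s. r s x) \<longlongrightarrow> x) (tails_filter \<Sigma> R))"

text \<open>
  HOL cannot quantify existentially over the type of indices, so it is a parameter here. For a
  compact line of type \<open>'a\<close> the index type \<open>'a set\<close> is large enough: if \<open>K\<close> is infinite, every
  retractional skeleton restricts to one whose index set has at most \<open>|K|^\<aleph>\<^sub>0 \<le> 2^|K|\<close>
  elements (choose an index for each point and basic neighbourhood of it, and close the set of these
  under upper bounds of pairs and suprema of increasing sequences), and if \<open>K\<close> is finite, the
  identity alone is a retractional skeleton.
\<close>

definition has_retractional_skeleton :: "'i itself \<Rightarrow> 'a::topological_space itself \<Rightarrow> bool" where
  "has_retractional_skeleton _ _ \<longleftrightarrow>
     (\<exists>(\<Sigma> :: 'i set) R (r :: 'i \<Rightarrow> 'a \<Rightarrow> 'a). retractional_skeleton \<Sigma> R r)"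

end

theory Submission
  imports Defs
begin

text \<open>
  \<open>K\<close> is zero-dimensional, so \<open>C(K)\<close> is the closed span of the indicators \<open>chi D\<close> of clopen initial
  segments. A countable family \<open>A\<close> of them splits \<open>K\<close> into closed intervals, its classes, and the closed
  span \<open>gen A\<close> of its indicators consists of the functions constant on them. Evaluation at
  representatives of the classes is a projection onto \<open>gen A\<close> if a class approached by \<open>A\<close> from
  the left (right) is represented by its left (right) end. To reconcile the two demands, take a well-ordering of \<open>K\<close>
  with open initial segments: compact sets have a largest element in it, which passing to smaller sets
  can lower only finitely often. Hence, if \<open>A\<close> is closed under suitable countable operations, a nontrivial class
  approached from both sides contains a point \<open>p\<close> of \<open>M(K)\<close>. This \<open>p\<close> then represents the class, and on a
  one-sided clopen zone at \<open>p\<close> one adds \<open>f(p) - f(a)\<close>, where \<open>a\<close> is the end of the class on that side; for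
  countable \<open>M(K)\<close> the zones can be made disjoint, so the norm is at most \<open>3\<close>.

  Conversely, if \<open>p\<close> is in \<open>M(K)\<close>, every closed cofinal family contains a subspace whose elements cannot
  jump between two sequences of cuts surrounding \<open>p\<close>, although \<open>K\<close> has a cut there; a step function with values \<open>1\<close> and
  \<open>-1\<close> shows that projections onto it have norm at least \<open>2\<close>. A retractional skeleton would
  fix a suitable increasing sequence of isolated points below \<open>p\<close> one after the other, while earlier retractions
  already send its limit to \<open>p\<close> or beyond.
\<close>

section \<open>Clopen initial segments\<close>

text \<open>Every operator is handled through its values on indicators: the projection of a family
  \<open>A\<close> sends \<open>chi D\<close> to \<open>chi (tau U V A D)\<close>, so its range, its
  idempotence and the law P_S P_T = P_S become statements about a map on clopen initial segments.
  The obstacle is a class that contains a point p of M(K) and is cut by \<open>D\<close>. Evaluation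
  at p turns \<open>chi D\<close> into the indicator of the union of the members of \<open>A\<close>
  inside \<open>D\<close>, or of the intersection of those around it, and this set is not clopen.
  The correction replaces it by a clopen set \<open>U p\<close> or \<open>V p\<close>. These sets
  are chosen once for all families, which is what makes the projections of nested families
  compatible. Uncountable cofinality leaves room for them between p and the points of M(K) on the
  same side, and countability of M(K) allows every \<open>A\<close> to contain all of them. The
  result is a 3-projectional skeleton for countable M(K), from which both (2) and (3) follow. If
  M(K) is empty, no correction occurs and the representatives themselves form retractions.\<close>

definition cutsets :: "'a::linorder_topology set set" where
  "cutsets = {D. open D \<and> closed D \<and> (\<forall>x\<in>D. \<forall>y\<le>x. y \<in> D)}"

lemma cutsets_empty [simp]: "{} \<in> cutsets"
  and cutsets_UNIV [simp]: "UNIV \<in> cutsets"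
  by (auto simp: cutsets_def)

lemma cutsets_downward: "D \<in> cutsets \<Longrightarrow> x \<in> D \<Longrightarrow> y \<le> x \<Longrightarrow> y \<in> D"
  by (auto simp: cutsets_def)

lemma cutsets_less: "D \<in> cutsets \<Longrightarrow> x \<in> D \<Longrightarrow> y \<notin> D \<Longrightarrow> x < y"
  by (metis cutsets_downward not_less)

lemma cutsets_linear: "D \<in> cutsets \<Longrightarrow> E \<in> cutsets \<Longrightarrow> D \<subseteq> E \<or> E \<subseteq> D"
  by (metis cutsets_downward linear subsetI)

lemma cutsets_atMost: "open {..x} \<Longrightarrow> {..x} \<in> cutsets"
  and cutsets_lessThan: "open {x..} \<Longrightarrow> {..<x} \<in> cutsets"
proof -
  show "open {..x} \<Longrightarrow> {..x} \<in> cutsets"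
    by (auto simp: cutsets_def)
  assume "open {x..}"
  then have "closed (- {x..})" by (simp only: closed_Compl)
  moreover have "- {x..} = {..<x}" by auto
  ultimately show "{..<x} \<in> cutsets"
    by (auto simp: cutsets_def)
qed

lemma cutsets_Int: "D \<in> cutsets \<Longrightarrow> E \<in> cutsets \<Longrightarrow> D \<inter> E \<in> cutsets"
  by (metis cutsets_linear inf.absorb1 inf.absorb2)

definition chi :: "'a::topological_space set \<Rightarrow> ('a \<Rightarrow>\<^sub>C real)" where
  "chi D = Bcontfun (indicator D)"

lemma chi_apply:
  assumes "open D" "closed D"
  shows "apply_bcontfun (chi D) x = indicator D x"
proof -
  have "continuous_on (D \<union> - D) (\<lambda>x. if x \<in> D then 1 else 0 :: real)"
    using assms by (intro continuous_on_cases) auto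
  then have "continuous_on UNIV (indicator D :: 'a \<Rightarrow> real)"
    by (simp add: indicator_def of_bool_def)
  then have "(indicator D :: 'a \<Rightarrow> real) \<in> bcontfun"
    by (rule bcontfun_normI[where b = 1]) (auto simp: indicator_def)
  then show ?thesis
    unfolding chi_def by (simp add: Bcontfun_inverse)
qed

lemma chi_cutset_apply: "D \<in> cutsets \<Longrightarrow> apply_bcontfun (chi D) x = indicator D x"
  by (rule chi_apply) (auto simp: cutsets_def)

lemma dist_bcontfun_le:
  fixes f g :: "'a::topological_space \<Rightarrow>\<^sub>C real"
  shows "(\<And>x. \<bar>apply_bcontfun f x - apply_bcontfun g x\<bar> \<le> e) \<Longrightarrow> dist f g \<le> e"
  by (rule dist_bound) (simp add: dist_real_def)

text \<open>Lists of pairs of a rational coefficient and a vector code the finite rational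
  combinations of \<open>C\<close>; these form the countable dense set.\<close>

lemma countable_span_separable:
  fixes C :: "'e::real_normed_vector set"
  assumes "countable C"
  shows "\<exists>Q. countable Q \<and> Q \<subseteq> span C \<and> span C \<subseteq> closure Q"
proof -
  define comb :: "(rat \<times> 'e) list \<Rightarrow> 'e" where
    "comb l = sum_list (map (\<lambda>(q, c). of_rat q *\<^sub>R c) l)" for l
  define Q where "Q = comb ` lists (UNIV \<times> C)"
  have Q0: "0 \<in> Q"
    unfolding Q_def by (rule image_eqI[of _ _ "[]"]) (auto simp: comb_def)
  have Qstep: "of_rat q *\<^sub>R c + u \<in> Q" if c: "c \<in> C" and u: "u \<in> Q" for q c u
  proof -
    obtain l where "l \<in> lists (UNIV \<times> C)" "u = comb l"
      using u unfolding Q_def by blast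
    then show ?thesis
      unfolding Q_def using c by (intro image_eqI[of _ _ "(q, c) # l"]) (auto simp: comb_def)
  qed
  have "countable Q"
    unfolding Q_def using assms by (intro countable_image countable_lists) auto
  moreover have "Q \<subseteq> span C"
  proof -
    have "comb l \<in> span C" if "l \<in> lists (UNIV \<times> C)" for l
      using that by (induction l) (auto simp: comb_def span_zero intro!: span_add[OF span_scale[OF span_base]])
    then show ?thesis unfolding Q_def by blast
  qed
  moreover have "x \<in> closure Q" if "x \<in> span C" for x
    using that
  proof (induction rule: span_induct_alt)
    case base
    then show ?case using Q0 closure_subset by auto
  next
    case (step c x y)
    have "of_rat q *\<^sub>R x + y \<in> closure Q" for q
    proof -
      have "(\<lambda>u. of_rat q *\<^sub>R x + u) ` closure Q \<subseteq> closure Q"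
      proof (rule image_closure_subset)
        show "(\<lambda>u. of_rat q *\<^sub>R x + u) ` Q \<subseteq> closure Q"
          using Qstep[OF step(1)] closure_subset[of Q] by blast
      qed (auto intro: continuous_intros)
      then show ?thesis using step(2) by blast
    qed
    \<comment> \<open>For fixed \<open>x\<close> and \<open>y\<close> the admissible coefficients
      form a closed set of reals that contains the rationals, hence all reals.\<close>
    then have "\<rat> \<subseteq> (\<lambda>c. c *\<^sub>R x + y) -` closure Q" by (auto simp: Rats_def)
    moreover have "closed ((\<lambda>c. c *\<^sub>R x + y) -` closure Q)"
      by (intro closed_vimage closed_closure continuous_intros)
    ultimately have "closure \<rat> \<subseteq> (\<lambda>c. c *\<^sub>R x + y) -` closure Q"
      by (rule closure_minimal)
    then show ?case unfolding Rats_closure_real by blast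
  qed
  ultimately show ?thesis by blast
qed

lemma subspace_closure:
  fixes S :: "'e::real_normed_vector set"
  assumes "subspace S"
  shows "subspace (closure S)"
  unfolding subspace_def
proof (intro conjI allI impI ballI)
  show "0 \<in> closure S"
    using assms closure_subset by (auto simp: subspace_def)
next
  fix x y assume "x \<in> closure S" "y \<in> closure S"
  then obtain f g where fg: "\<forall>n. f n \<in> S" "f \<longlonglongrightarrow> x" "\<forall>n. g n \<in> S" "g \<longlonglongrightarrow> y"
    unfolding closure_sequential by blast
  then have "\<forall>n. f n + g n \<in> S" "(\<lambda>n. f n + g n) \<longlonglongrightarrow> x + y"
    using assms by (auto intro: subspace_add tendsto_add)
  then show "x + y \<in> closure S"
    unfolding closure_sequential by (intro exI[of _ "\<lambda>n. f n + g n"] conjI)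
next
  fix c x assume "x \<in> closure S"
  then obtain f where f: "\<forall>n. f n \<in> S" "f \<longlonglongrightarrow> x"
    unfolding closure_sequential by blast
  then have "\<forall>n. c *\<^sub>R f n \<in> S" "(\<lambda>n. c *\<^sub>R f n) \<longlonglongrightarrow> c *\<^sub>R x"
    using assms by (auto intro: subspace_scale tendsto_scaleR)
  then show "c *\<^sub>R x \<in> closure S"
    unfolding closure_sequential by (intro exI[of _ "\<lambda>n. c *\<^sub>R f n"] conjI)
qed

lemma Sep_closure_span:
  assumes "countable C"
  shows "closure (span C) \<in> Sep"
proof -
  obtain Q where Q: "countable Q" "Q \<subseteq> span C" "span C \<subseteq> closure Q"
    using countable_span_separable[OF assms] by blast
  have "Q \<subseteq> closure (span C)" using Q(2) closure_subset by blast
  moreover have "closure (span C) \<subseteq> closure Q"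
    using closure_mono[OF Q(3)] by simp
  ultimately have "separable_space (top_of_set (closure (span C)))"
    unfolding separable_space_def using Q(1)
    by (intro exI[of _ Q]) (auto simp: closure_of_subtopology Int_absorb1)
  then show ?thesis
    by (auto simp: Sep_def intro: subspace_span subspace_closure)
qed

lemma Sep_dense:
  assumes "S \<in> Sep"
  obtains C where "countable C" "C \<subseteq> S" "S = closure C"
proof -
  obtain C where C: "countable C" "C \<subseteq> S" "top_of_set S closure_of C = S" "closed S"
    using assms by (auto simp: Sep_def separable_space_def)
  have "S \<subseteq> closure C"
    using C(2,3) by (auto simp: closure_of_subtopology Int_absorb1)
  moreover have "closure C \<subseteq> S"
    using C by (simp add: closure_minimal)
  ultimately show ?thesis using C that by blast
qed

section \<open>Separation by clopen initial segments in a scattered compact line\<close>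

locale scattered_compact_line =
  fixes K :: "'a::linorder_topology itself"
  assumes compact_K: "compact (UNIV :: 'a set)" and scattered_K: "scattered_space TYPE('a)"
begin

lemma ex_isolated:
  fixes U :: "'a set"
  assumes "open U" "U \<noteq> {}"
  obtains z where "z \<in> U" "open {z}"
proof -
  obtain z where "z isolated_in U"
    using scattered_K assms by (auto simp: scattered_space_def)
  then obtain T where "z \<in> U" "open T" "T \<inter> U = {z}"
    by (auto simp: isolated_in_def)
  then show ?thesis using that assms by (metis open_Int)
qed

text \<open>Either \<open>x\<close> and \<open>y\<close> form a jump, so that \<open>{..x}\<close>
  is itself open, or the interval between them contains an isolated point \<open>z\<close> of the
  whole space and \<open>{..z}\<close> is clopen. This is where scatteredness gives
  zero-dimensionality.\<close>

lemma cut_between: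
  fixes x y :: 'a
  assumes "x < y"
  obtains D where "D \<in> cutsets" "x \<in> D" "y \<notin> D"
proof (cases "{x<..<y} = {}")
  case True
  then have "z \<le> x \<longleftrightarrow> z < y" for z
    using assms by (metis empty_iff greaterThanLessThan_iff not_less order_le_less_trans)
  then have "{..x} = {..<y}" by auto
  then have "{..x} \<in> cutsets" by (intro cutsets_atMost) simp
  then show ?thesis using that[of "{..x}"] assms by simp
next
  case False
  obtain z where z: "z \<in> {x<..<y}" "open {z}"
    using ex_isolated[OF _ False] by auto
  have "{..z} = {..<z} \<union> {z}" by auto
  then have "{..z} \<in> cutsets" using z by (metis cutsets_atMost open_Un open_lessThan)
  then show ?thesis using that[of "{..z}"] z by auto
qed

lemma compact_closed: "closed (C :: 'a set) \<Longrightarrow> compact C"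
  using compact_Int_closed[OF compact_K] by simp

lemma closed_has_max:
  assumes "closed (C :: 'a set)" "C \<noteq> {}"
  obtains m where "m \<in> C" "\<And>x. x \<in> C \<Longrightarrow> x \<le> m"
  using compact_attains_sup[OF compact_closed[OF assms(1)] assms(2)] by blast

lemma closed_has_min:
  assumes "closed (C :: 'a set)" "C \<noteq> {}"
  obtains m where "m \<in> C" "\<And>x. x \<in> C \<Longrightarrow> m \<le> x"
  using compact_attains_inf[OF compact_closed[OF assms(1)] assms(2)] by blast

lemma cutset_eq_atMost:
  assumes "(D :: 'a set) \<in> cutsets" "D \<noteq> {}"
  obtains m where "D = {..m}"
proof -
  obtain m where "m \<in> D" "\<And>x. x \<in> D \<Longrightarrow> x \<le> m"
    using closed_has_max[of D] assms by (auto simp: cutsets_def)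
  then have "D = {..m}" using assms cutsets_downward by blast
  then show ?thesis by (rule that)
qed

lemma cutset_eq_lessThan:
  assumes "(D :: 'a set) \<in> cutsets" "D \<noteq> UNIV"
  obtains m where "D = {..<m}"
proof -
  have "closed (- D)" "- D \<noteq> {}" using assms by (auto simp: cutsets_def)
  then obtain m where m: "m \<in> - D" "\<And>x. x \<in> - D \<Longrightarrow> m \<le> x"
    using closed_has_min by blast
  have "x \<in> D \<longleftrightarrow> x < m" for x
    using m cutsets_downward[OF assms(1)] by (metis ComplD ComplI leD not_le_imp_less)
  then have "D = {..<m}" by auto
  then show ?thesis by (rule that)
qed

text \<open>Some cutset separates any two points, so limits can be tested on cutsets alone;
  continuity and convergence of retractions thereby become statements about membership.\<close>

lemma tendsto_cutsetsI:
  fixes l :: 'a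
  assumes "\<And>D. D \<in> cutsets \<Longrightarrow> eventually (\<lambda>s. f s \<in> D \<longleftrightarrow> l \<in> D) F"
  shows "(f \<longlongrightarrow> l) F"
proof (rule order_tendstoI)
  fix a assume "a < l"
  then obtain D where D: "D \<in> cutsets" "a \<in> D" "l \<notin> D" by (rule cut_between)
  show "eventually (\<lambda>s. a < f s) F"
    using assms[OF D(1)] by eventually_elim (use D cutsets_less in blast)
next
  fix a assume "l < a"
  then obtain D where D: "D \<in> cutsets" "l \<in> D" "a \<notin> D" by (rule cut_between)
  show "eventually (\<lambda>s. f s < a) F"
    using assms[OF D(1)] by eventually_elim (use D cutsets_less in blast)
qed

lemma continuous_cutsetsI:
  fixes f :: "'a \<Rightarrow> 'a"
  assumes "\<And>D. D \<in> cutsets \<Longrightarrow> f -` D \<in> cutsets"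
  shows "continuous_on UNIV f"
proof -
  have "(f \<longlongrightarrow> f x) (at x)" for x
  proof (rule tendsto_cutsetsI)
    fix D :: "'a set" assume "D \<in> cutsets"
    then have *: "open (f -` D)" "open (- (f -` D))" using assms by (auto simp: cutsets_def)
    show "eventually (\<lambda>s. f s \<in> D \<longleftrightarrow> f x \<in> D) (at x)"
    proof (cases "f x \<in> D")
      case True
      then show ?thesis using topological_tendstoD[OF tendsto_ident_at *(1), of x] by simp
    next
      case False
      then show ?thesis using topological_tendstoD[OF tendsto_ident_at *(2), of x] by simp
    qed
  qed
  then show ?thesis by (simp add: continuous_on_def)
qed

end

section \<open>Subspaces generated by clopen initial segments\<close>

definition gen :: "'a::linorder_topology set set \<Rightarrow> ('a \<Rightarrow>\<^sub>C real) set" where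
  "gen A = closure (span (chi ` A))"

lemma subspace_gen: "subspace (gen A)"
  unfolding gen_def by (intro subspace_closure subspace_span)

lemma closed_gen: "closed (gen A)"
  by (simp add: gen_def)

lemma chi_in_gen: "D \<in> A \<Longrightarrow> chi D \<in> gen A"
  unfolding gen_def by (rule subsetD[OF closure_subset]) (auto intro: span_base)

lemma gen_minimal: "closed S \<Longrightarrow> subspace S \<Longrightarrow> chi ` A \<subseteq> S \<Longrightarrow> gen A \<subseteq> S"
  unfolding gen_def by (rule closure_minimal[OF span_minimal])

lemma gen_mono: "A \<subseteq> B \<Longrightarrow> gen A \<subseteq> gen B"
  unfolding gen_def by (rule closure_mono[OF span_mono[OF image_mono]])

lemma gen_Sep: "countable A \<Longrightarrow> gen A \<in> Sep"
  unfolding gen_def by (intro Sep_closure_span) auto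

text \<open>Suprema of subspaces correspond to unions of families, so closedness of a set of
  subspaces reduces to closure under unions of increasing sequences of families.\<close>

lemma gen_UNION:
  fixes A :: "nat \<Rightarrow> 'a::linorder_topology set set"
  shows "closure (span (\<Union>n. gen (A n))) = gen (\<Union>n. A n)"
proof
  have "(\<Union>n. gen (A n)) \<subseteq> gen (\<Union>n. A n)"
    by (rule UN_least, rule gen_mono) auto
  then show "closure (span (\<Union>n. gen (A n))) \<subseteq> gen (\<Union>n. A n)"
    by (rule closure_minimal[OF span_minimal[OF _ subspace_gen] closed_gen])
  have "chi ` (\<Union>n. A n) \<subseteq> closure (span (\<Union>n. gen (A n)))"
    by (intro image_subsetI subsetD[OF closure_subset] span_base) (auto intro: chi_in_gen)
  then show "gen (\<Union>n. A n) \<subseteq> closure (span (\<Union>n. gen (A n)))"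
    by (rule gen_minimal[OF closed_closure subspace_closure[OF subspace_span]])
qed

lemma closed_eq_at:
  fixes x y :: "'a::topological_space"
  shows "closed {f :: 'a \<Rightarrow>\<^sub>C real. apply_bcontfun f x = apply_bcontfun f y}"
proof -
  have "continuous_on UNIV (\<lambda>f :: 'a \<Rightarrow>\<^sub>C real. apply_bcontfun f z)" for z
    by (rule bounded_linear.continuous_on[OF bounded_linear_intro[where K = 1] continuous_on_id])
      (use norm_bounded[of _ z] in \<open>auto simp: real_norm_def[symmetric] simp del: real_norm_def\<close>)
  then show ?thesis by (intro closed_Collect_eq)
qed

text \<open>The functions with equal values at \<open>x\<close> and \<open>y\<close> form a closed
  subspace, so only the generators need to be inspected.\<close>

lemma gen_eq_at:
  assumes "A \<subseteq> cutsets" "\<And>E. E \<in> A \<Longrightarrow> x \<in> E \<longleftrightarrow> y \<in> E" "f \<in> gen A"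
  shows "apply_bcontfun f x = apply_bcontfun f y"
proof -
  have "gen A \<subseteq> {f. apply_bcontfun f x = apply_bcontfun f y}"
  proof (rule gen_minimal[OF closed_eq_at])
    show "subspace {f. apply_bcontfun f x = apply_bcontfun f y}"
      by (auto simp: subspace_def)
    show "chi ` A \<subseteq> {f. apply_bcontfun f x = apply_bcontfun f y}"
      using assms(1,2) by (auto simp: chi_cutset_apply subset_iff indicator_def)
  qed
  then show ?thesis using assms(3) by blast
qed

text \<open>The counterpart of \<open>closed_cofinal\<close> for families of cutsets. Since
  \<open>chi {}\<close> is 0 and lies in every \<open>gen A\<close>, the set \<open>{}\<close> must
  be in \<open>A\<close> if \<open>gen A\<close> is to determine \<open>A\<close>;
  \<open>UNIV\<close> puts the constants into \<open>gen A\<close>.\<close>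

definition sigma_cofinal :: "'a::linorder_topology set set set \<Rightarrow> bool" where
  "sigma_cofinal \<Sigma> \<longleftrightarrow>
     (\<forall>A\<in>\<Sigma>. countable A \<and> A \<subseteq> cutsets \<and> {} \<in> A \<and> UNIV \<in> A) \<and>
     (\<forall>A. countable A \<and> A \<subseteq> cutsets \<longrightarrow> (\<exists>B\<in>\<Sigma>. A \<subseteq> B)) \<and>
     (\<forall>A :: nat \<Rightarrow> 'a set set. incseq A \<and> range A \<subseteq> \<Sigma> \<longrightarrow> (\<Union>n. A n) \<in> \<Sigma>)"

lemma sigma_cofinalD:
  assumes "sigma_cofinal \<Sigma>"
  shows "A \<in> \<Sigma> \<Longrightarrow> countable A" "A \<in> \<Sigma> \<Longrightarrow> A \<subseteq> cutsets" "A \<in> \<Sigma> \<Longrightarrow> {} \<in> A" "A \<in> \<Sigma> \<Longrightarrow> UNIV \<in> A"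
    and "countable A \<Longrightarrow> A \<subseteq> cutsets \<Longrightarrow> \<exists>B\<in>\<Sigma>. A \<subseteq> B"
    and "incseq X \<Longrightarrow> range X \<subseteq> \<Sigma> \<Longrightarrow> (\<Union>n. X n) \<in> \<Sigma>"
  using assms unfolding sigma_cofinal_def by simp_all

context scattered_compact_line
begin

lemma gen_cutsets: "gen cutsets = (UNIV :: ('a \<Rightarrow>\<^sub>C real) set)"
proof -
  let ?V = "span (chi ` cutsets) :: ('a \<Rightarrow>\<^sub>C real) set"
  let ?R = "apply_bcontfun ` ?V"
  \<comment> \<open>The span is closed under products because \<open>chi D\<close> times
    \<open>chi E\<close> is \<open>chi (D \<inter> E)\<close>; two nested span inductions extend
    this bilinearly. The rest is the Stone-Weierstrass theorem.\<close>
  have prod: "\<exists>k\<in>?V. \<forall>x. apply_bcontfun k x = apply_bcontfun g x * apply_bcontfun h x"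
    if g: "g \<in> ?V" and h: "h \<in> ?V" for g h
    using g
  proof (induction rule: span_induct_alt)
    case base
    then show ?case by (intro bexI[of _ 0]) (auto simp: span_zero)
  next
    case (step c x y)
    obtain D where D: "x = chi D" "D \<in> cutsets" using step(1) by blast
    have "\<exists>k\<in>?V. \<forall>z. apply_bcontfun k z = apply_bcontfun x z * apply_bcontfun h z"
      using h
    proof (induction rule: span_induct_alt)
      case base
      then show ?case by (intro bexI[of _ 0]) (auto simp: span_zero)
    next
      case (step c' x' y')
      obtain E where E: "x' = chi E" "E \<in> cutsets" using step(1) by blast
      obtain k where k: "k \<in> ?V" "\<forall>z. apply_bcontfun k z = apply_bcontfun x z * apply_bcontfun y' z"
        using step by blast
      have "c' *\<^sub>R chi (D \<inter> E) + k \<in> ?V"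
        using D E k by (intro span_add[OF span_scale[OF span_base]] imageI cutsets_Int)
      then show ?case
        using D E k by (intro bexI[of _ "c' *\<^sub>R chi (D \<inter> E) + k"])
          (auto simp: chi_cutset_apply cutsets_Int indicator_inter_arith algebra_simps)
    qed
    then obtain k where k: "k \<in> ?V" "\<forall>z. apply_bcontfun k z = apply_bcontfun x z * apply_bcontfun h z"
      by blast
    obtain l where l: "l \<in> ?V" "\<forall>z. apply_bcontfun l z = apply_bcontfun y z * apply_bcontfun h z"
      using step by blast
    show ?case
      using k l by (intro bexI[of _ "c *\<^sub>R k + l"]) (auto simp: algebra_simps intro!: span_add span_scale)
  qed
  interpret function_ring_on ?R "UNIV :: 'a set"
  proof
    show "compact (UNIV :: 'a set)" by (rule compact_K)
  next
    fix f assume "f \<in> ?R" then show "continuous_on UNIV f" by auto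
  next
    fix f g assume "f \<in> ?R" "g \<in> ?R"
    then obtain u v where uv: "u \<in> ?V" "v \<in> ?V" "f = apply_bcontfun u" "g = apply_bcontfun v" by blast
    show "(\<lambda>x. f x + g x) \<in> ?R"
      using uv by (intro image_eqI[of _ _ "u + v"]) (auto intro: span_add)
    obtain k where "k \<in> ?V" "\<forall>x. apply_bcontfun k x = f x * g x"
      using prod uv by blast
    then show "(\<lambda>x. f x * g x) \<in> ?R"
      by (intro image_eqI[of _ _ k]) auto
  next
    fix c :: real
    show "(\<lambda>_ :: 'a. c) \<in> ?R"
      by (intro image_eqI[of _ _ "c *\<^sub>R chi UNIV"])
        (auto simp: chi_cutset_apply intro!: span_scale[OF span_base])
  next
    fix x y :: 'a assume "x \<noteq> y"
    then obtain D where D: "D \<in> cutsets" "x \<in> D \<longleftrightarrow> y \<notin> D"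
      by (metis cut_between neqE)
    then have "apply_bcontfun (chi D) x \<noteq> apply_bcontfun (chi D) y"
      by (auto simp: chi_cutset_apply indicator_def)
    moreover have "apply_bcontfun (chi D) \<in> ?R"
      using D by (auto intro: span_base)
    ultimately show "\<exists>f\<in>?R. f x \<noteq> f y" by blast
  qed
  have "f \<in> closure ?V" for f :: "'a \<Rightarrow>\<^sub>C real"
    unfolding closure_approachable
  proof (intro allI impI)
    fix e :: real assume "e > 0"
    then obtain g where g: "g \<in> ?V" "\<forall>x. \<bar>apply_bcontfun f x - apply_bcontfun g x\<bar> < e/2"
      using Stone_Weierstrass_basic[of "apply_bcontfun f" "e/2"] by auto
    then have "dist g f \<le> e/2"
      by (subst dist_commute) (intro dist_bcontfun_le less_imp_le, blast)
    then show "\<exists>g\<in>?V. dist g f < e" using g \<open>e > 0\<close> by (intro bexI[of _ g]) auto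
  qed
  then show ?thesis by (auto simp: gen_def)
qed

text \<open>An approximating sequence from the span involves only countably many generators.\<close>

lemma in_gen_countable:
  fixes f :: "'a \<Rightarrow>\<^sub>C real"
  shows "\<exists>A. countable A \<and> A \<subseteq> cutsets \<and> f \<in> gen A"
proof -
  have span: "\<exists>A. countable A \<and> A \<subseteq> cutsets \<and> g \<in> gen A" if "g \<in> span (chi ` cutsets)" for g :: "'a \<Rightarrow>\<^sub>C real"
    using that
  proof (induction rule: span_induct_alt)
    case base
    then show ?case by (intro exI[of _ "{}"]) (auto simp: subspace_gen subspace_0)
  next
    case (step c x y)
    then obtain D A where DA: "x = chi D" "D \<in> cutsets" "countable A" "A \<subseteq> cutsets" "y \<in> gen A"
      by blast
    have "y \<in> gen (insert D A)" using DA gen_mono by blast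
    moreover have "x \<in> gen (insert D A)" using DA chi_in_gen by blast
    ultimately have "c *\<^sub>R x + y \<in> gen (insert D A)"
      by (auto intro: subspace_add subspace_scale subspace_gen)
    then show ?case using DA by (intro exI[of _ "insert D A"]) auto
  qed
  have "f \<in> closure (span (chi ` cutsets))"
    using gen_cutsets by (auto simp: gen_def)
  then obtain g where g: "\<forall>n. g n \<in> span (chi ` cutsets)" "g \<longlonglongrightarrow> f"
    unfolding closure_sequential by blast
  obtain A where A: "\<And>n. countable (A n)" "\<And>n. A n \<subseteq> cutsets" "\<And>n. g n \<in> gen (A n)"
    using span[OF g(1)[rule_format]] by metis
  have "\<forall>n. g n \<in> gen (\<Union>n. A n)" using A(3) gen_mono by blast
  then have "f \<in> gen (\<Union>n. A n)"
    using g(2) closed_gen closed_sequentially by blast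
  then show ?thesis using A by (intro exI[of _ "\<Union>n. A n"]) auto
qed

lemma Sep_subset_gen:
  fixes S :: "('a \<Rightarrow>\<^sub>C real) set"
  assumes "S \<in> Sep"
  shows "\<exists>A. countable A \<and> A \<subseteq> cutsets \<and> S \<subseteq> gen A"
proof -
  obtain C where C: "countable C" "S = closure C" using Sep_dense[OF assms] by metis
  obtain A where A: "\<And>f :: 'a \<Rightarrow>\<^sub>C real. countable (A f)" "\<And>f. A f \<subseteq> cutsets" "\<And>f. f \<in> gen (A f)"
    using in_gen_countable by metis
  have "C \<subseteq> gen (\<Union>f\<in>C. A f)"
    using A(3) gen_mono by blast
  then have "S \<subseteq> gen (\<Union>f\<in>C. A f)"
    unfolding C(2) by (intro closure_minimal closed_gen)
  then show ?thesis using A C by (intro exI[of _ "\<Union>f\<in>C. A f"]) auto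
qed

text \<open>A cutset other than \<open>{}\<close> and \<open>UNIV\<close> has a last point
  \<open>x\<close>, and its complement has a first point \<open>y\<close>. If \<open>D\<close> is
  missing from \<open>A\<close>, no member of \<open>A\<close> separates this jump, so all functions
  in \<open>gen A\<close> agree at \<open>x\<close> and \<open>y\<close>, while \<open>chi D\<close>
  does not. Hence \<open>gen\<close> reflects inclusion.\<close>

lemma chi_in_gen_iff:
  fixes A :: "'a set set"
  assumes "A \<subseteq> cutsets" "{} \<in> A" "UNIV \<in> A" "D \<in> cutsets"
  shows "chi D \<in> gen A \<longleftrightarrow> D \<in> A"
proof
  assume "chi D \<in> gen A"
  show "D \<in> A"
  proof (rule ccontr)
    assume "D \<notin> A"
    then have "D \<noteq> {}" "D \<noteq> UNIV" using assms by auto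
    obtain x where x: "D = {..x}" using cutset_eq_atMost[OF assms(4) \<open>D \<noteq> {}\<close>] by blast
    obtain y where y: "D = {..<y}" using cutset_eq_lessThan[OF assms(4) \<open>D \<noteq> UNIV\<close>] by blast
    note xy = x y
    have "x \<in> E \<longleftrightarrow> y \<in> E" if "E \<in> A" for E
    proof -
      have E: "E \<in> cutsets" "E \<noteq> D" using that assms \<open>D \<notin> A\<close> by auto
      consider "E \<subset> D" | "D \<subset> E" using cutsets_linear[OF E(1) assms(4)] E(2) by blast
      then show ?thesis
      proof cases
        case 1
        then have "x \<notin> E" using cutsets_downward[OF E(1)] xy(1) by auto
        moreover have "y \<notin> E" using 1 xy(2) by auto
        ultimately show ?thesis by simp
      next
        case 2
        then have "x \<in> E" using xy by auto
        moreover obtain z where "z \<in> E" "z \<notin> D" using 2 by blast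
        then have "y \<in> E" using xy(2) cutsets_downward[OF E(1)] by auto
        ultimately show ?thesis by simp
      qed
    qed
    then have "apply_bcontfun (chi D) x = apply_bcontfun (chi D) y"
      using gen_eq_at[OF assms(1)] \<open>chi D \<in> gen A\<close> by blast
    moreover have "x \<in> D" "y \<notin> D" using xy by auto
    ultimately show False using assms(4) by (auto simp: chi_cutset_apply indicator_def)
  qed
qed (rule chi_in_gen)

lemma gen_subset_iff:
  fixes A :: "'a set set"
  assumes "A \<subseteq> cutsets" "B \<subseteq> cutsets" "{} \<in> B" "UNIV \<in> B"
  shows "gen A \<subseteq> gen B \<longleftrightarrow> A \<subseteq> B"
proof
  assume "gen A \<subseteq> gen B"
  then have "chi D \<in> gen B" if "D \<in> A" for D using that chi_in_gen by blast
  then show "A \<subseteq> B" using chi_in_gen_iff[OF assms(2-4)] assms(1) by blast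
qed (rule gen_mono)

lemma closed_cofinal_gen:
  fixes \<Sigma> :: "'a set set set"
  assumes "sigma_cofinal \<Sigma>"
  shows "closed_cofinal (gen ` \<Sigma>)"
  unfolding closed_cofinal_def
proof (intro conjI allI impI ballI)
  show "gen ` \<Sigma> \<subseteq> Sep"
    using sigma_cofinalD(1)[OF assms] gen_Sep by blast
next
  fix S :: "('a \<Rightarrow>\<^sub>C real) set" assume "S \<in> Sep"
  then obtain A where "countable A" "A \<subseteq> cutsets" "S \<subseteq> gen A" using Sep_subset_gen by blast
  moreover then obtain B where "B \<in> \<Sigma>" "A \<subseteq> B" using sigma_cofinalD(5)[OF assms] by blast
  ultimately show "\<exists>F\<in>gen ` \<Sigma>. S \<subseteq> F"
    using gen_mono[of A B] by (intro bexI[of _ "gen B"]) auto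
next
  fix F :: "nat \<Rightarrow> ('a \<Rightarrow>\<^sub>C real) set"
  assume F: "incseq F \<and> range F \<subseteq> gen ` \<Sigma>"
  then have "\<forall>n. \<exists>A\<in>\<Sigma>. F n = gen A" by blast
  then obtain A where A: "\<And>n. A n \<in> \<Sigma>" "\<And>n. F n = gen (A n)" by metis
  have \<Sigma>: "A n \<subseteq> cutsets" "{} \<in> A n" "UNIV \<in> A n" for n
    using sigma_cofinalD(2-4)[OF assms A(1)[of n]] .
  \<comment> \<open>As \<open>gen\<close> reflects inclusion, an increasing sequence of subspaces
    comes from an increasing sequence of families.\<close>
  have "incseq A"
  proof (rule incseq_SucI)
    fix n
    have "gen (A n) \<subseteq> gen (A (Suc n))" using F incseq_SucD[of F n] by (simp add: A(2))
    then show "A n \<subseteq> A (Suc n)"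
      using gen_subset_iff[OF \<Sigma>(1) \<Sigma>] by simp
  qed
  then have "(\<Union>n. A n) \<in> \<Sigma>" using A(1) sigma_cofinalD(6)[OF assms] by blast
  then show "closure (span (\<Union>n. F n)) \<in> gen ` \<Sigma>"
    unfolding A(2) gen_UNION by blast
qed

end

section \<open>Well-orderings of scattered spaces and cofinality\<close>

text \<open>Points are removed one at a time by transfinite recursion, always one that is isolated
  in what remains. Adding to an open set a point isolated in its complement gives an open set again,
  so initial segments stay open.\<close>

lemma scattered_well_ordering:
  assumes "scattered_space TYPE('a::topological_space)"
  obtains r :: "('a::topological_space \<times> 'a) set"
  where "wf r" "trans r" "total r" "\<And>x. open {y. y = x \<or> (y, x) \<in> r}"
proof -
  \<comment> \<open>The stages are indexed by subsets of the space: by Cantor's theorem there are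
    too many for an injective enumeration, so the points must run out.\<close>
  obtain w :: "('a set \<times> 'a set) set" where "Well_order w \<and> Field w = UNIV"
    using well_ordering by (rule exE)
  then have w: "Well_order w" "Field w = UNIV" by (rule conjunct1, rule conjunct2)
  define l where "l = w - Id"
  have wf: "wf l" using w by (simp add: l_def well_order_on_def)
  have tot: "(a, b) \<in> l \<or> (b, a) \<in> l" if "a \<noteq> b" for a b
    using w that unfolding l_def well_order_on_def linear_order_on_def total_on_def by simp
  have trl: "trans l"
  proof -
    have "trans w" "antisym w"
      using w by (simp_all add: well_order_on_def linear_order_on_def partial_order_on_def preorder_on_def)
    then show ?thesis unfolding l_def by (rule trans_diff_Id)
  qed
  define step where "step f a = (SOME x. x isolated_in - (f ` {b. (b, a) \<in> l}))"
    for f :: "'a set \<Rightarrow> 'a" and a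
  define f where "f = wfrec l step"
  define S where "S a = f ` {b. (b, a) \<in> l}" for a
  have f: "f a = step f a" for a
  proof -
    have "cut f l a ` {b. (b, a) \<in> l} = f ` {b. (b, a) \<in> l}"
      by (intro image_cong) (auto simp: cut_apply)
    moreover have "f a = step (cut f l a) a"
      unfolding f_def by (rule wfrec[OF wf])
    ultimately show ?thesis unfolding step_def by (simp only:)
  qed
  have iso: "f a isolated_in - S a" if "S a \<noteq> UNIV" for a
  proof -
    have "- S a \<noteq> {}" using that by blast
    then have "\<exists>x. x isolated_in - S a" using assms unfolding scattered_space_def by simp
    then have "(SOME x. x isolated_in - S a) isolated_in - S a" by (rule someI_ex)
    then show ?thesis using f[of a] by (simp only: step_def S_def)
  qed
  have neq: "f b \<noteq> f a" if "(b, a) \<in> l" "S a \<noteq> UNIV" for a b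
  proof -
    have "f b \<in> S a" using that(1) by (simp add: S_def)
    moreover have "f a \<notin> S a" using iso[OF that(2)] by (simp add: isolated_in_def)
    ultimately show ?thesis by metis
  qed
  have "\<exists>a. S a = UNIV"
  proof (rule ccontr)
    assume "\<not> ?thesis"
    then have "f a \<noteq> f b" if "a \<noteq> b" for a b
      using neq[of a b] neq[of b a] tot[OF that] by auto
    then have "inj f" by (auto intro: injI)
    then have "surj (inv f)" by (rule inj_imp_surj_inv)
    then show False using Cantors_theorem[of "UNIV :: 'a set"] by (metis Pow_UNIV)
  qed
  then obtain a0 where "a0 \<in> {a. S a = UNIV}" by blast
  \<comment> \<open>\<open>m\<close> is the first stage at which all points are used up; below
    \<open>m\<close> the choice in \<open>step\<close> is meaningful and \<open>f\<close> is
    injective.\<close>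
  then obtain m where m0: "m \<in> {a. S a = UNIV}" "\<And>b. (b, m) \<in> l \<Longrightarrow> b \<notin> {a. S a = UNIV}"
    using wfE_min[OF wf] by metis
  then have m: "S m = UNIV" "\<And>b. (b, m) \<in> l \<Longrightarrow> S b \<noteq> UNIV" by simp_all
  have sub: "S b \<subseteq> S a" if "(b, a) \<in> l" for a b
  proof -
    have "{c. (c, b) \<in> l} \<subseteq> {c. (c, a) \<in> l}" using transD[OF trl _ that] by blast
    then show ?thesis unfolding S_def by (rule image_mono)
  qed
  have step_open: "open (insert (f b) (S b))" if ob: "open (S b)" and bm: "(b, m) \<in> l" for b
  proof -
    obtain T where T: "open T" "T \<inter> - S b = {f b}"
      using iso[OF m(2)[OF bm]] by (auto simp: isolated_in_def)
    then have "insert (f b) (S b) = S b \<union> T" by blast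
    then show ?thesis using T ob by auto
  qed
  have S_open: "(a, m) \<in> l \<Longrightarrow> open (S a)" for a
  proof (induction a rule: wf_induct_rule[OF wf])
    case (1 a)
    have "S a = (\<Union>b\<in>{b. (b, a) \<in> l}. insert (f b) (S b))"
    proof
      show "S a \<subseteq> (\<Union>b\<in>{b. (b, a) \<in> l}. insert (f b) (S b))" by (auto simp: S_def)
      have "f b \<in> S a" if "(b, a) \<in> l" for b using that by (simp add: S_def)
      then show "(\<Union>b\<in>{b. (b, a) \<in> l}. insert (f b) (S b)) \<subseteq> S a" using sub by blast
    qed
    moreover have "open (insert (f b) (S b))" if "(b, a) \<in> l" for b
    proof -
      have "(b, m) \<in> l" by (rule transD[OF trl that 1(2)])
      then show ?thesis using 1(1)[OF that] step_open by blast
    qed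
    ultimately show ?case by auto
  qed
  have "\<exists>a. (a, m) \<in> l \<and> f a = x" for x
  proof -
    have "x \<in> S m" using m(1) by simp
    then show ?thesis unfolding S_def by blast
  qed
  then obtain g where g: "\<And>x. (g x, m) \<in> l" "\<And>x. f (g x) = x" by metis
  have gf: "g (f b) = b" if "(b, m) \<in> l" for b
    using neq[of b "g (f b)"] neq[of "g (f b)" b] m(2)[OF that] m(2)[OF g(1)[of "f b"]]
      tot[of b "g (f b)"] g(2)[of "f b"] by metis
  show ?thesis
  proof (rule that)
    show "wf (inv_image l g)" using wf by simp
    show "trans (inv_image l g)" using trl by (rule trans_inv_image)
    show "total (inv_image l g)"
      unfolding total_on_def in_inv_image
    proof (intro ballI impI)
      fix x y :: 'a assume "x \<noteq> y"
      then have "g x \<noteq> g y" using g(2)[of x] g(2)[of y] by auto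
      then show "(g x, g y) \<in> l \<or> (g y, g x) \<in> l" by (rule tot)
    qed
    fix x
    have "{y. y = x \<or> (y, x) \<in> inv_image l g} = insert (f (g x)) (S (g x))"
    proof (intro set_eqI iffI)
      fix y assume "y \<in> insert (f (g x)) (S (g x))"
      then consider "y = x" | b where "(b, g x) \<in> l" "y = f b" using g by (auto simp: S_def)
      then show "y \<in> {y. y = x \<or> (y, x) \<in> inv_image l g}"
      proof cases
        case 2
        then have "(b, m) \<in> l" using transD[OF trl _ g(1)] by blast
        then show ?thesis using 2 gf by simp
      qed simp
    next
      fix y assume "y \<in> {y. y = x \<or> (y, x) \<in> inv_image l g}"
      then show "y \<in> insert (f (g x)) (S (g x))"
        using g(2)[of x] g(2)[of y] unfolding S_def in_inv_image by (auto intro: image_eqI[of _ _ "g y"])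
    qed
    then show "open {y. y = x \<or> (y, x) \<in> inv_image l g}"
      using S_open[OF g(1)] step_open g(1) by simp
  qed
qed

text \<open>In a well-ordering of a scattered space with open initial segments, compact sets have a
  largest element; passing to smaller compact sets can lower it only finitely often.\<close>

definition rtop :: "('a \<times> 'a) set \<Rightarrow> 'a set \<Rightarrow> 'a" where
  "rtop r C = (SOME z. z \<in> C \<and> (\<forall>y\<in>C. y = z \<or> (y, z) \<in> r))"

text \<open>The open initial segments at the points of \<open>C\<close> cover it. The largest centre
  in a finite subcover is the largest element, and it belongs to \<open>C\<close>.\<close>

lemma rtop:
  fixes C :: "'a::topological_space set"
  assumes r: "trans r" "total r" "\<And>x. open {y. y = x \<or> (y, x) \<in> r}"
    and C: "compact C" "C \<noteq> {}"
  shows "rtop r C \<in> C" "y \<in> C \<Longrightarrow> y = rtop r C \<or> (y, rtop r C) \<in> r"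
proof -
  have fin: "\<exists>z\<in>F. \<forall>y\<in>F. y = z \<or> (y, z) \<in> r" if "finite F" "F \<noteq> {}" for F
    using that
  proof (induction F rule: finite_ne_induct)
    case (insert x F)
    then obtain z where z: "z \<in> F" "\<forall>y\<in>F. y = z \<or> (y, z) \<in> r" by blast
    consider "x = z" | "(x, z) \<in> r" | "(z, x) \<in> r" using r(2) by (auto simp: total_on_def)
    then show ?case
    proof cases
      case 3
      then show ?thesis using z transD[OF r(1), of _ z x] by (intro bexI[of _ x]) auto
    qed (use z in auto)
  qed auto
  obtain F where F: "F \<subseteq> C" "finite F" "C \<subseteq> (\<Union>x\<in>F. {y. y = x \<or> (y, x) \<in> r})"
    by (rule compactE_image[OF C(1), of C "\<lambda>x. {y. y = x \<or> (y, x) \<in> r}"]) (use r(3) in auto)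
  then have "F \<noteq> {}" using C by auto
  then obtain z where z: "z \<in> F" "\<forall>y\<in>F. y = z \<or> (y, z) \<in> r" using fin[OF F(2)] by blast
  have "y = z \<or> (y, z) \<in> r" if y: "y \<in> C" for y
  proof -
    obtain x where "x \<in> F" "y = x \<or> (y, x) \<in> r" using F(3) y by blast
    then show ?thesis using z transD[OF r(1), of y x z] by auto
  qed
  then have "z \<in> C \<and> (\<forall>y\<in>C. y = z \<or> (y, z) \<in> r)" using z F by blast
  then have "rtop r C \<in> C \<and> (\<forall>y\<in>C. y = rtop r C \<or> (y, rtop r C) \<in> r)"
    unfolding rtop_def by (rule someI)
  then show "rtop r C \<in> C" "y \<in> C \<Longrightarrow> y = rtop r C \<or> (y, rtop r C) \<in> r" by auto
qed

text \<open>Uncountable cofinality of the points below \<open>p\<close>. Taking \<open>C\<close>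
  empty or a singleton shows that \<open>p\<close> is then also a limit from the left.\<close>

definition left_unc :: "'a::linorder \<Rightarrow> bool" where
  "left_unc p \<longleftrightarrow> (\<forall>C. countable C \<and> C \<subseteq> {..<p} \<longrightarrow> (\<exists>z<p. \<forall>c\<in>C. c < z))"

definition right_unc :: "'a::linorder \<Rightarrow> bool" where
  "right_unc p \<longleftrightarrow> (\<forall>C. countable C \<and> C \<subseteq> {p<..} \<longrightarrow> (\<exists>z>p. \<forall>c\<in>C. z < c))"

lemma left_uncD: "left_unc p \<Longrightarrow> countable C \<Longrightarrow> C \<subseteq> {..<p} \<Longrightarrow> \<exists>z<p. \<forall>c\<in>C. c < z"
  by (auto simp: left_unc_def)

lemma right_uncD: "right_unc p \<Longrightarrow> countable C \<Longrightarrow> C \<subseteq> {p<..} \<Longrightarrow> \<exists>z>p. \<forall>c\<in>C. z < c"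
  by (auto simp: right_unc_def)

lemma external_point_iff:
  fixes p :: "'a::linorder_topology"
  shows "external_point p \<longleftrightarrow> open {p..} \<or> open {..p}"
proof -
  have "p isolated_in {p..} \<longleftrightarrow> open {..p}"
  proof
    assume "p isolated_in {p..}"
    then obtain T where T: "open T" "T \<inter> {p..} = {p}" by (auto simp: isolated_in_def)
    have "x \<in> T \<inter> {p..} \<longleftrightarrow> x \<in> {p}" for x using T(2) by simp
    then have *: "x \<in> T \<longleftrightarrow> x = p" if "p \<le> x" for x using that by blast
    have "x \<in> {..<p} \<union> T \<longleftrightarrow> x \<le> p" for x using *[of x] by (cases "x < p") auto
    then have "{..p} = {..<p} \<union> T" by blast
    then show "open {..p}" using T by auto
  qed (auto simp: isolated_in_def intro!: exI[of _ "{..p}"])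
  moreover have "p isolated_in {..p} \<longleftrightarrow> open {p..}"
  proof
    assume "p isolated_in {..p}"
    then obtain T where T: "open T" "T \<inter> {..p} = {p}" by (auto simp: isolated_in_def)
    have "x \<in> T \<inter> {..p} \<longleftrightarrow> x \<in> {p}" for x using T(2) by simp
    then have *: "x \<in> T \<longleftrightarrow> x = p" if "x \<le> p" for x using that by blast
    have "x \<in> {p<..} \<union> T \<longleftrightarrow> p \<le> x" for x using *[of x] by (cases "p < x") auto
    then have "{p..} = {p<..} \<union> T" by blast
    then show "open {p..}" using T by auto
  qed (auto simp: isolated_in_def intro!: exI[of _ "{p..}"])
  ultimately show ?thesis by (auto simp: external_point_def)
qed

lemma internal_pointD:
  fixes p :: "'a::linorder_topology"
  assumes "internal_point p"
  shows "\<exists>c. c < p" "\<exists>d. p < d"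
proof -
  have "{p..} \<noteq> UNIV" "{..p} \<noteq> UNIV" using assms open_UNIV unfolding external_point_iff by metis+
  then show "\<exists>c. c < p" "\<exists>d. p < d" by (auto simp: set_eq_iff not_le)
qed

text \<open>If cofinality were countable on both sides, the intervals between two countable sets of
  endpoints would be a countable base at \<open>p\<close>.\<close>

lemma M_pointsD:
  fixes p :: "'a::linorder_topology"
  assumes "p \<in> M_points"
  shows "\<not> open {p..}" "\<not> open {..p}" "left_unc p \<or> right_unc p"
proof -
  show *: "\<not> open {p..}" "\<not> open {..p}"
    using assms by (auto simp: M_points_def external_point_iff)
  show "left_unc p \<or> right_unc p"
  proof (rule ccontr)
    assume "\<not> ?thesis"
    then obtain C D where C: "countable C" "C \<subseteq> {..<p}" "\<And>z. z < p \<Longrightarrow> \<exists>c\<in>C. z \<le> c"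
      and D: "countable D" "D \<subseteq> {p<..}" "\<And>z. p < z \<Longrightarrow> \<exists>d\<in>D. d \<le> z"
      unfolding left_unc_def right_unc_def by (metis not_less)
    have "nbhd_base p ((\<lambda>(c, d). {c<..<d}) ` (C \<times> D))"
      unfolding nbhd_base_def
    proof (intro conjI ballI allI impI)
      fix N assume "N \<in> (\<lambda>(c, d). {c<..<d}) ` (C \<times> D)"
      then show "p \<in> interior N" using C(2) D(2) by (auto simp: interior_open)
    next
      fix U assume U: "open U \<and> p \<in> U"
      obtain a b where ab: "a < p" "p < b"
        using internal_pointD[of p] assms by (auto simp: M_points_def)
      obtain a' where a': "a' < p" "{a'<..p} \<subseteq> U" using U open_left[of U p a] ab by auto
      obtain b' where b': "p < b'" "{p..<b'} \<subseteq> U" using U open_right[of U p b] ab by auto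
      obtain c d where cd: "c \<in> C" "a' \<le> c" "d \<in> D" "d \<le> b'" using C(3) D(3) a' b' by metis
      have "{c<..<d} \<subseteq> U"
      proof
        fix x assume "x \<in> {c<..<d}"
        then have "x \<in> {a'<..p} \<or> x \<in> {p..<b'}" using cd by (cases "x \<le> p") auto
        then show "x \<in> U" using a' b' by auto
      qed
      then show "\<exists>N\<in>(\<lambda>(c, d). {c<..<d}) ` (C \<times> D). N \<subseteq> U" using cd by auto
    qed
    moreover have "countable ((\<lambda>(c, d). {c<..<d}) ` (C \<times> D))" using C D by blast
    ultimately show False using assms by (auto simp: M_points_def uncountable_character_def)
  qed
qed

text \<open>Each member of a countable base contains an interval on either side of \<open>p\<close>.
  Uncountable cofinality would supply a point closer to \<open>p\<close> than all their endpoints,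
  and the open half-line from it towards \<open>p\<close> would contain no member of the
  base.\<close>

lemma countable_character_not_unc:
  fixes p :: "'a::linorder_topology"
  assumes "internal_point p" "p \<notin> M_points"
  shows "\<not> left_unc p" "\<not> right_unc p"
proof -
  obtain \<B> where \<B>: "countable \<B>" "nbhd_base p \<B>"
    using assms by (auto simp: M_points_def uncountable_character_def)
  obtain a b where ab: "a < p" "p < b" using internal_pointD[OF assms(1)] by blast
  have N: "\<exists>c d. c < p \<and> p < d \<and> {c<..p} \<subseteq> N \<and> {p..<d} \<subseteq> N" if "N \<in> \<B>" for N
  proof -
    have *: "open (interior N)" "p \<in> interior N" using \<B> that by (auto simp: nbhd_base_def)
    show ?thesis using open_left[OF * ab(1)] open_right[OF * ab(2)] interior_subset[of N] by blast
  qed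
  then obtain c d where cd: "\<And>N. N \<in> \<B> \<Longrightarrow> c N < p \<and> p < d N \<and> {c N<..p} \<subseteq> N \<and> {p..<d N} \<subseteq> N"
    by metis
  show "\<not> left_unc p"
  proof
    assume "left_unc p"
    then obtain z where z: "z < p" "\<And>N. N \<in> \<B> \<Longrightarrow> c N < z"
      using left_uncD[of p "c ` \<B>"] \<B>(1) cd by (metis (no_types, lifting) countable_image image_eqI image_subsetI lessThan_iff)
    obtain N where "N \<in> \<B>" "N \<subseteq> {z<..}"
      using \<B>(2) z(1) unfolding nbhd_base_def by (metis greaterThan_iff open_greaterThan)
    moreover from this have "z \<in> {c N<..p}" using z(1) z(2)[of N] by simp
    ultimately show False using cd[of N] by blast
  qed
  show "\<not> right_unc p"
  proof
    assume "right_unc p"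
    then obtain z where z: "p < z" "\<And>N. N \<in> \<B> \<Longrightarrow> z < d N"
      using right_uncD[of p "d ` \<B>"] \<B>(1) cd by (metis (no_types, lifting) countable_image image_eqI image_subsetI greaterThan_iff)
    obtain N where "N \<in> \<B>" "N \<subseteq> {..<z}"
      using \<B>(2) z(1) unfolding nbhd_base_def by (metis lessThan_iff open_lessThan)
    moreover from this have "z \<in> {p..<d N}" using z(1) z(2)[of N] by simp
    ultimately show False using cd[of N] by blast
  qed
qed

section \<open>Families of clopen initial segments closed under refinement\<close>

text \<open>\<open>U p\<close> and \<open>V p\<close> are the outer borders of the zones at
  \<open>p\<close>. The conditions with a second point \<open>q\<close> make zones of different
  points disjoint. No family \<open>A\<close> enters, which later gives compatibility of the
  projections.\<close>

locale separators =
  fixes U V :: "'a::linorder_topology \<Rightarrow> 'a set"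
  assumes U: "p \<in> M_points \<Longrightarrow> left_unc p \<Longrightarrow> U p \<in> cutsets" "p \<in> M_points \<Longrightarrow> left_unc p \<Longrightarrow> p \<notin> U p"
      "p \<in> M_points \<Longrightarrow> left_unc p \<Longrightarrow> q \<in> M_points \<Longrightarrow> q < p \<Longrightarrow> q \<in> U p"
    and V: "p \<in> M_points \<Longrightarrow> right_unc p \<Longrightarrow> V p \<in> cutsets" "p \<in> M_points \<Longrightarrow> right_unc p \<Longrightarrow> p \<in> V p"
      "p \<in> M_points \<Longrightarrow> right_unc p \<Longrightarrow> q \<in> M_points \<Longrightarrow> p < q \<Longrightarrow> q \<notin> V p"
      "p \<in> M_points \<Longrightarrow> right_unc p \<Longrightarrow> q \<in> M_points \<Longrightarrow> p < q \<Longrightarrow> left_unc q \<Longrightarrow> V p \<subseteq> U q"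

lemmas separatorsD = separators.U separators.V

text \<open>\<open>low\<close> and \<open>upp\<close> approximate \<open>D\<close> by members of
  \<open>A\<close> from inside and outside. For the families considered and a cutset
  \<open>D\<close> outside \<open>A\<close>, the \<open>gap\<close> is the class of \<open>A\<close>
  that \<open>D\<close> cuts in two.\<close>

definition low :: "'a set set \<Rightarrow> 'a set \<Rightarrow> 'a set" where
  "low A D = \<Union>{E\<in>A. E \<subseteq> D}"

definition upp :: "'a set set \<Rightarrow> 'a set \<Rightarrow> 'a set" where
  "upp A D = \<Inter>{E\<in>A. D \<subseteq> E}"

abbreviation gap :: "'a set set \<Rightarrow> 'a set \<Rightarrow> 'a set" where
  "gap A D \<equiv> upp A D - low A D"

lemma low_subset: "low A D \<subseteq> D" and subset_upp: "D \<subseteq> upp A D"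
  by (auto simp: low_def upp_def)

lemma low_greatest: "E \<in> A \<Longrightarrow> E \<subseteq> D \<Longrightarrow> E \<subseteq> low A D"
  and upp_least: "E \<in> A \<Longrightarrow> D \<subseteq> E \<Longrightarrow> upp A D \<subseteq> E"
  by (auto simp: low_def upp_def)

lemma same_gap:
  assumes "A \<subseteq> cutsets" "D \<in> cutsets" "E \<in> A" "x \<in> gap A D" "y \<in> gap A D"
  shows "x \<in> E \<longleftrightarrow> y \<in> E"
proof -
  have "E \<subseteq> D \<or> D \<subseteq> E" using assms cutsets_linear by blast
  then show ?thesis using assms(3-5) low_greatest[of E A D] upp_least[of E A D] by blast
qed

text \<open>\<open>low A D\<close> outside \<open>A\<close> means that members of \<open>A\<close>
  accumulate at the gap from the left, \<open>upp A D\<close> outside \<open>A\<close> that they do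
  so from the right. Without a point of M(K) in the gap exactly one of these happens, which decides
  the end that represents the class. With such a point \<open>p\<close>, members of \<open>A\<close>
  accumulate on the side of \<open>p\<close> on which \<open>D\<close> cuts the class.\<close>

locale good =
  fixes U V :: "'a::linorder_topology \<Rightarrow> 'a set" and A :: "'a set set"
  assumes basic: "A \<subseteq> cutsets" "{} \<in> A" "UNIV \<in> A"
    and left: "p \<in> M_points \<Longrightarrow> left_unc p \<Longrightarrow> U p \<in> A"
      "p \<in> M_points \<Longrightarrow> \<not> left_unc p \<Longrightarrow> z < p \<Longrightarrow> \<exists>E\<in>A. z \<in> E \<and> p \<notin> E"
    and right: "p \<in> M_points \<Longrightarrow> right_unc p \<Longrightarrow> V p \<in> A"
      "p \<in> M_points \<Longrightarrow> \<not> right_unc p \<Longrightarrow> p < z \<Longrightarrow> \<exists>E\<in>A. p \<in> E \<and> z \<notin> E"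
    and gaps: "D \<in> cutsets \<Longrightarrow> D \<notin> A \<Longrightarrow> M_points \<inter> gap A D = {} \<Longrightarrow> low A D \<in> A \<longleftrightarrow> upp A D \<notin> A"
      "D \<in> cutsets \<Longrightarrow> D \<notin> A \<Longrightarrow> p \<in> M_points \<Longrightarrow> p \<in> gap A D \<Longrightarrow> p \<notin> D \<Longrightarrow> low A D \<notin> A"
      "D \<in> cutsets \<Longrightarrow> D \<notin> A \<Longrightarrow> p \<in> M_points \<Longrightarrow> p \<in> gap A D \<Longrightarrow> p \<in> D \<Longrightarrow> upp A D \<notin> A"

lemmas goodD = good.basic good.left good.right good.gaps

text \<open>Witnesses to be added for the region \<open>F - E\<close>: \<open>split\<close> forbids
  gaps with both borders in \<open>A\<close>, \<open>M\<close> makes \<open>A\<close> accumulate at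
  gaps that meet M(K), and \<open>top\<close> treats the largest point of the region in the
  well-ordering, which will rule out gaps with neither border in \<open>A\<close>.\<close>

locale refinement =
  fixes r :: "('a::linorder_topology \<times> 'a) set" and E F :: "'a set" and \<Phi> :: "'a set set"
  assumes basic: "countable \<Phi>" "\<Phi> \<subseteq> cutsets"
    and split: "\<exists>x\<in>F-E. \<exists>y\<in>F-E. x < y \<Longrightarrow> \<exists>G\<in>\<Phi>. E \<subset> G \<and> G \<subset> F"
    and M: "p \<in> M_points \<Longrightarrow> p \<notin> E \<Longrightarrow> left_unc p \<Longrightarrow> \<exists>G\<in>\<Phi>. E \<subset> G \<and> p \<notin> G"
      "p \<in> M_points \<Longrightarrow> p \<in> F \<Longrightarrow> right_unc p \<Longrightarrow> \<exists>G\<in>\<Phi>. G \<subset> F \<and> p \<in> G"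
    and top: "z = rtop r (F - E) \<Longrightarrow> open {..z} \<Longrightarrow> {..z} \<in> \<Phi>"
      "z = rtop r (F - E) \<Longrightarrow> open {z..} \<Longrightarrow> {..<z} \<in> \<Phi>"
      "z = rtop r (F - E) \<Longrightarrow> internal_point z \<Longrightarrow> z \<notin> M_points \<Longrightarrow> y < z \<Longrightarrow> \<exists>G\<in>\<Phi>. y \<in> G \<and> z \<notin> G"
      "z = rtop r (F - E) \<Longrightarrow> internal_point z \<Longrightarrow> z \<notin> M_points \<Longrightarrow> z < y \<Longrightarrow> \<exists>G\<in>\<Phi>. z \<in> G \<and> y \<notin> G"

lemmas refinementD = refinement.basic refinement.split refinement.M refinement.top

context scattered_compact_line
begin

lemma cutsets_below:
  fixes p :: 'a
  assumes "\<not> left_unc p"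
  shows "\<exists>L. countable L \<and> L \<subseteq> cutsets \<and> (\<forall>z<p. \<exists>E\<in>L. z \<in> E \<and> p \<notin> E)"
proof -
  obtain C where C: "countable C" "C \<subseteq> {..<p}" "\<And>z. z < p \<Longrightarrow> \<exists>c\<in>C. z \<le> c"
    using assms unfolding left_unc_def by (metis not_less)
  have "\<forall>c\<in>C. \<exists>E\<in>cutsets. c \<in> E \<and> p \<notin> E"
    using C(2) cut_between by (metis lessThan_iff subsetD)
  then obtain e where e: "\<And>c. c \<in> C \<Longrightarrow> e c \<in> cutsets \<and> c \<in> e c \<and> p \<notin> e c" by metis
  have "\<exists>E\<in>e ` C. z \<in> E \<and> p \<notin> E" if "z < p" for z
    using C(3)[OF that] e cutsets_downward by (metis imageI)
  then show ?thesis using C(1) e by (intro exI[of _ "e ` C"]) auto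
qed

lemma cutsets_above:
  fixes p :: 'a
  assumes "\<not> right_unc p"
  shows "\<exists>L. countable L \<and> L \<subseteq> cutsets \<and> (\<forall>z>p. \<exists>E\<in>L. p \<in> E \<and> z \<notin> E)"
proof -
  obtain C where C: "countable C" "C \<subseteq> {p<..}" "\<And>z. p < z \<Longrightarrow> \<exists>c\<in>C. c \<le> z"
    using assms unfolding right_unc_def by (metis not_less)
  have "\<forall>c\<in>C. \<exists>E\<in>cutsets. p \<in> E \<and> c \<notin> E"
    using C(2) cut_between by (metis greaterThan_iff subsetD)
  then obtain e where e: "\<And>c. c \<in> C \<Longrightarrow> e c \<in> cutsets \<and> p \<in> e c \<and> c \<notin> e c" by metis
  have "\<exists>E\<in>e ` C. p \<in> E \<and> z \<notin> E" if "p < z" for z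
    using C(3)[OF that] e cutsets_downward by (metis imageI)
  then show ?thesis using C(1) e by (intro exI[of _ "e ` C"]) auto
qed

text \<open>Countably many points of M(K) on a side of uncountable cofinality leave room for a cut.
  For \<open>V p\<close> the bound must also stay below the last points \<open>m q\<close> of the
  sets \<open>U q\<close>, which keeps the two zones apart.\<close>

lemma ex_separators:
  assumes "countable (M_points :: 'a set)"
  obtains U V :: "'a \<Rightarrow> 'a set" where "separators U V"
proof -
  have "\<exists>D\<in>cutsets. p \<notin> D \<and> (\<forall>q\<in>M_points. q < p \<longrightarrow> q \<in> D)" if lu: "left_unc p" for p :: 'a
  proof -
    have "countable {q\<in>M_points. q < p}" using assms by (rule countable_subset[rotated]) auto
    then obtain z where z: "z < p" "\<forall>c\<in>{q\<in>M_points. q < p}. c < z"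
      using left_uncD[OF lu, of "{q\<in>M_points. q < p}"] by auto
    obtain D where "D \<in> cutsets" "z \<in> D" "p \<notin> D" using cut_between[OF z(1)] by blast
    then show ?thesis using z(2) by (intro bexI[of _ D]) (auto intro: cutsets_downward less_imp_le)
  qed
  then obtain U where U: "\<And>p :: 'a. left_unc p \<Longrightarrow> U p \<in> cutsets \<and> p \<notin> U p \<and> (\<forall>q\<in>M_points. q < p \<longrightarrow> q \<in> U p)"
    by metis
  have "\<exists>D\<in>cutsets. p \<in> D \<and> (\<forall>q\<in>M_points. p < q \<longrightarrow> q \<notin> D \<and> (left_unc q \<longrightarrow> D \<subseteq> U q))"
    if p: "p \<in> M_points" and ru: "right_unc p" for p :: 'a
  proof -
    define N where "N = {q\<in>M_points. p < q}"
    have N: "countable N" using assms unfolding N_def by (rule countable_subset[rotated]) auto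
    have "\<exists>m. U q = {..m}" if "q \<in> N" "left_unc q" for q
    proof -
      have "p \<in> U q" using U[OF that(2)] that(1) p by (auto simp: N_def)
      then show ?thesis using cutset_eq_atMost U[OF that(2)] by (metis empty_iff)
    qed
    then obtain m where m: "\<And>q. q \<in> N \<Longrightarrow> left_unc q \<Longrightarrow> U q = {..m q}" by metis
    \<comment> \<open>\<open>p = m q\<close> would make \<open>{..p}\<close> equal to
      \<open>U q\<close> and hence open.\<close>
    have pm: "p < m q" if "q \<in> N" "left_unc q" for q
    proof -
      have "p \<in> U q" using U[OF that(2)] that(1) p by (auto simp: N_def)
      moreover have "open (U q)" using U[OF that(2)] by (auto simp: cutsets_def)
      ultimately show ?thesis using m[OF that] M_pointsD(2)[OF p] by (auto simp: order_le_less)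
    qed
    let ?C = "N \<union> m ` {q\<in>N. left_unc q}"
    have "countable ?C" using N by auto
    moreover have "?C \<subseteq> {p<..}" using pm by (auto simp: N_def)
    ultimately obtain z where z: "p < z" "\<forall>c\<in>?C. z < c" using right_uncD[OF ru] by metis
    obtain D where D: "D \<in> cutsets" "p \<in> D" "z \<notin> D" using cut_between[OF z(1)] by blast
    have Dz: "x < z" if "x \<in> D" for x using cutsets_less[OF D(1) that D(3)] .
    show ?thesis
    proof (intro bexI[of _ D] conjI ballI impI)
      fix q :: 'a assume q: "q \<in> M_points" "p < q"
      then have "z < q" using z(2) by (auto simp: N_def)
      then show "q \<notin> D" using Dz less_asym by blast
      assume lq: "left_unc q"
      have qN: "q \<in> N" using q by (simp add: N_def)
      then have "z < m q" using z(2) lq by auto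
      then show "D \<subseteq> U q"
        using Dz unfolding m[OF qN lq] by (meson atMost_iff less_imp_le less_trans subsetI)
    qed (use D in auto)
  qed
  then obtain V where V: "\<And>p :: 'a. p \<in> M_points \<Longrightarrow> right_unc p \<Longrightarrow> V p \<in> cutsets \<and> p \<in> V p \<and>
      (\<forall>q\<in>M_points. p < q \<longrightarrow> q \<notin> V p \<and> (left_unc q \<longrightarrow> V p \<subseteq> U q))"
    by metis
  have "separators U V"
    by (rule separators.intro) (use U V in blast)+
  then show ?thesis by (rule that)
qed

text \<open>Countably many witnesses suffice: M(K) is countable, and an internal point outside it
  has countable cofinality on both sides.\<close>

lemma ex_refinement:
  assumes M: "countable (M_points :: 'a set)" and EF: "E \<in> cutsets" "F \<in> cutsets"
  shows "\<exists>\<Phi> :: 'a set set. refinement r E F \<Phi>"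
proof -
  have "\<exists>\<Phi>\<subseteq>cutsets. countable \<Phi> \<and> (\<forall>x\<in>F-E. \<forall>y\<in>F-E. x < y \<longrightarrow> (\<exists>G\<in>\<Phi>. E \<subset> G \<and> G \<subset> F))"
  proof (cases "\<exists>x\<in>F-E. \<exists>y\<in>F-E. x < y")
    case True
    then obtain x y where xy: "x \<in> F - E" "y \<in> F - E" "x < y" by blast
    obtain G where G: "G \<in> cutsets" "x \<in> G" "y \<notin> G" using cut_between[OF xy(3)] by blast
    have "E \<subseteq> G" using cutsets_linear[OF EF(1) G(1)] G(2) xy(1) by blast
    moreover have "G \<subseteq> F" using cutsets_linear[OF EF(2) G(1)] G(3) xy(2) by blast
    ultimately have "E \<subset> G \<and> G \<subset> F" using xy G by blast
    then show ?thesis using G by (intro exI[of _ "{G}"]) auto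
  next
    case False
    then show ?thesis by (intro exI[of _ "{}"]) blast
  qed
  then obtain A1 where A1: "A1 \<subseteq> cutsets" "countable A1"
    "\<And>x y. x \<in> F - E \<Longrightarrow> y \<in> F - E \<Longrightarrow> x < y \<Longrightarrow> \<exists>G\<in>A1. E \<subset> G \<and> G \<subset> F" by metis
  have "\<exists>G\<in>cutsets. p \<notin> E \<longrightarrow> left_unc p \<longrightarrow> E \<subset> G \<and> p \<notin> G" for p
  proof (cases "p \<notin> E \<and> left_unc p")
    case True
    have "\<exists>z<p. z \<notin> E"
    proof (cases "E = {}")
      case True
      then show ?thesis using left_uncD[of p "{}"] \<open>p \<notin> E \<and> left_unc p\<close> by auto
    next
      case False
      then obtain m where m: "E = {..m}" using cutset_eq_atMost[OF EF(1)] by blast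
      then have "\<exists>z<p. \<forall>c\<in>{m}. c < z" using True left_uncD[of p "{m}"] by auto
      then show ?thesis using m by auto
    qed
    then obtain z where z: "z < p" "z \<notin> E" by blast
    obtain G where G: "G \<in> cutsets" "z \<in> G" "p \<notin> G" using cut_between[OF z(1)] by blast
    have "E \<subset> G" using cutsets_linear[OF EF(1) G(1)] G(2) z(2) by blast
    then show ?thesis using G by blast
  next
    case False
    then show ?thesis by (intro bexI[of _ "{}"]) auto
  qed
  then obtain g2 where g2: "\<And>p. g2 p \<in> cutsets" "\<And>p. p \<notin> E \<Longrightarrow> left_unc p \<Longrightarrow> E \<subset> g2 p \<and> p \<notin> g2 p"
    by metis
  have "\<exists>G\<in>cutsets. p \<in> F \<longrightarrow> right_unc p \<longrightarrow> G \<subset> F \<and> p \<in> G" for p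
  proof (cases "p \<in> F \<and> right_unc p")
    case True
    have "\<exists>z>p. z \<in> F"
    proof (cases "F = UNIV")
      case True
      then show ?thesis using right_uncD[of p "{}"] \<open>p \<in> F \<and> right_unc p\<close> by auto
    next
      case False
      then obtain m where m: "F = {..<m}" using cutset_eq_lessThan[OF EF(2)] by blast
      then have "\<exists>z>p. \<forall>c\<in>{m}. z < c" using True right_uncD[of p "{m}"] by auto
      then show ?thesis using m by auto
    qed
    then obtain z where z: "p < z" "z \<in> F" by blast
    obtain G where G: "G \<in> cutsets" "p \<in> G" "z \<notin> G" using cut_between[OF z(1)] by blast
    have "G \<subset> F" using cutsets_linear[OF EF(2) G(1)] G(3) z(2) by blast
    then show ?thesis using G by blast
  next
    case False
    then show ?thesis by (intro bexI[of _ "{}"]) auto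
  qed
  then obtain g3 where g3: "\<And>p. g3 p \<in> cutsets" "\<And>p. p \<in> F \<Longrightarrow> right_unc p \<Longrightarrow> g3 p \<subset> F \<and> p \<in> g3 p"
    by metis
  define z where "z = rtop r (F - E)"
  have "\<exists>\<Phi>\<subseteq>cutsets. countable \<Phi> \<and> (internal_point z \<and> z \<notin> M_points \<longrightarrow>
      (\<forall>y<z. \<exists>G\<in>\<Phi>. y \<in> G \<and> z \<notin> G) \<and> (\<forall>y>z. \<exists>G\<in>\<Phi>. z \<in> G \<and> y \<notin> G))"
  proof (cases "internal_point z \<and> z \<notin> M_points")
    case True
    obtain L R where L: "countable L" "L \<subseteq> cutsets" "\<forall>y<z. \<exists>G\<in>L. y \<in> G \<and> z \<notin> G"
      and R: "countable R" "R \<subseteq> cutsets" "\<forall>y>z. \<exists>G\<in>R. z \<in> G \<and> y \<notin> G"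
      using cutsets_below cutsets_above countable_character_not_unc True by metis
    have "countable (L \<union> R)" "L \<union> R \<subseteq> cutsets" using L R by auto
    moreover have "\<forall>y<z. \<exists>G\<in>L\<union>R. y \<in> G \<and> z \<notin> G" using L(3) by blast
    moreover have "\<forall>y>z. \<exists>G\<in>L\<union>R. z \<in> G \<and> y \<notin> G" using R(3) by blast
    ultimately show ?thesis by blast
  next
    case False
    then show ?thesis by blast
  qed
  then obtain A4 where A4: "A4 \<subseteq> cutsets" "countable A4"
    "internal_point z \<and> z \<notin> M_points \<longrightarrow>
      (\<forall>y<z. \<exists>G\<in>A4. y \<in> G \<and> z \<notin> G) \<and> (\<forall>y>z. \<exists>G\<in>A4. z \<in> G \<and> y \<notin> G)" by blast
  define A5 where "A5 = {G\<in>{{..z}, {..<z}}. G \<in> cutsets}"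
  define \<Phi> where "\<Phi> = A1 \<union> g2 ` M_points \<union> g3 ` M_points \<union> A4 \<union> A5"
  have sub: "A1 \<subseteq> \<Phi>" "A4 \<subseteq> \<Phi>" "A5 \<subseteq> \<Phi>" "\<And>p. p \<in> M_points \<Longrightarrow> g2 p \<in> \<Phi> \<and> g3 p \<in> \<Phi>"
    by (auto simp: \<Phi>_def)
  have "refinement r E F \<Phi>"
  proof (rule refinement.intro)
    have "finite A5" unfolding A5_def by (rule finite_subset[of _ "{{..z}, {..<z}}"]) auto
    then have "countable A5" by (rule countable_finite)
    then show "countable \<Phi>" unfolding \<Phi>_def using M A1(2) A4(2) by simp
    show "\<Phi> \<subseteq> cutsets" unfolding \<Phi>_def A5_def using g2(1) g3(1) A1 A4 by auto
    show "\<exists>G\<in>\<Phi>. E \<subset> G \<and> G \<subset> F" if "\<exists>x\<in>F-E. \<exists>y\<in>F-E. x < y"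
      using that A1(3) sub(1) by (meson subsetD)
    fix p :: 'a assume p: "p \<in> M_points"
    show "\<exists>G\<in>\<Phi>. E \<subset> G \<and> p \<notin> G" if "p \<notin> E" "left_unc p"
      using g2(2)[OF that] sub(4)[OF p] by blast
    show "\<exists>G\<in>\<Phi>. G \<subset> F \<and> p \<in> G" if "p \<in> F" "right_unc p"
      using g3(2)[OF that] sub(4)[OF p] by blast
  next
    fix z' assume "z' = rtop r (F - E)"
    then have z': "z' = z" by (simp add: z_def)
    show "open {..z'} \<Longrightarrow> {..z'} \<in> \<Phi>" "open {z'..} \<Longrightarrow> {..<z'} \<in> \<Phi>"
      using sub(3) cutsets_atMost[of z] cutsets_lessThan[of z] unfolding z' by (auto simp: A5_def)
    fix y assume "internal_point z'" "z' \<notin> M_points"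
    then show "y < z' \<Longrightarrow> \<exists>G\<in>\<Phi>. y \<in> G \<and> z' \<notin> G" "z' < y \<Longrightarrow> \<exists>G\<in>\<Phi>. z' \<in> G \<and> y \<notin> G"
      using A4(3) sub(2) unfolding z' by (meson subsetD)+
  qed
  then show ?thesis by blast
qed

end

text \<open>A Loewenheim-Skolem argument: countably many rounds of adding witnesses are enough, as
  any two members appear in a common round.\<close>

lemma countable_closure:
  assumes "countable B" "B \<subseteq> X" "\<And>E F. E \<in> X \<Longrightarrow> F \<in> X \<Longrightarrow> countable (\<Phi> E F) \<and> \<Phi> E F \<subseteq> X"
  shows "\<exists>A. B \<subseteq> A \<and> countable A \<and> A \<subseteq> X \<and> (\<forall>E\<in>A. \<forall>F\<in>A. \<Phi> E F \<subseteq> A)"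
proof -
  define st where "st C = C \<union> (\<Union>E\<in>C. \<Union>F\<in>C. \<Phi> E F)" for C
  define T where "T n = (st ^^ n) B" for n
  have T0: "T 0 = B" and TS: "T (Suc n) = st (T n)" for n by (simp_all add: T_def)
  have st: "countable (st C) \<and> st C \<subseteq> X" if "countable C \<and> C \<subseteq> X" for C
  proof
    have "countable (\<Phi> E F)" if "E \<in> C" "F \<in> C" for E F
      using assms(3) that \<open>countable C \<and> C \<subseteq> X\<close> by blast
    then show "countable (st C)" unfolding st_def using that by (intro countable_Un countable_UN) auto
    show "st C \<subseteq> X" unfolding st_def using assms(3) that by blast
  qed
  have T: "countable (T n) \<and> T n \<subseteq> X" for n
    by (induction n) (use st assms T0 TS in auto)
  have inc: "incseq T"
    by (rule incseq_SucI) (auto simp: TS st_def)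
  have "\<Phi> E F \<subseteq> (\<Union>n. T n)" if EF: "E \<in> (\<Union>n. T n)" "F \<in> (\<Union>n. T n)" for E F
  proof -
    obtain i j where "E \<in> T i" "F \<in> T j" using EF by blast
    then have "E \<in> T (max i j)" "F \<in> T (max i j)"
      using inc by (meson incseqD max.cobounded1 max.cobounded2 subsetD)+
    then have "\<Phi> E F \<subseteq> T (Suc (max i j))" unfolding TS st_def by blast
    then show ?thesis by blast
  qed
  moreover have "B \<subseteq> (\<Union>n. T n)" using T0 by blast
  moreover have "countable (\<Union>n. T n)" "(\<Union>n. T n) \<subseteq> X" using T by auto
  ultimately show ?thesis by blast
qed

section \<open>Families closed under refinement are good\<close>

context scattered_compact_line
begin

text \<open>\<open>D\<close> has a last point; if it lay in \<open>low A D\<close>, a member of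
  \<open>A\<close> inside \<open>D\<close> would contain all of \<open>D\<close>. The other half
  uses the first point of the complement.\<close>

lemma gap_nontrivial:
  assumes A: "A \<subseteq> cutsets" "{} \<in> A" "UNIV \<in> A" and D: "D \<in> cutsets" "(D :: 'a set) \<notin> A"
  shows "D - low A D \<noteq> {}" "upp A D - D \<noteq> {}"
proof -
  have "D \<noteq> {}" "D \<noteq> UNIV" using D(2) A by auto
  show "D - low A D \<noteq> {}"
  proof
    assume "D - low A D = {}"
    obtain m where m: "D = {..m}" using cutset_eq_atMost[OF D(1) \<open>D \<noteq> {}\<close>] by blast
    then have "m \<in> low A D" using \<open>D - low A D = {}\<close> by auto
    then obtain E where E: "E \<in> A" "E \<subseteq> D" "m \<in> E" unfolding low_def by blast
    then have "{..m} \<subseteq> E" using A(1) cutsets_downward by blast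
    then have "E = D" using m E by simp
    then show False using E D by simp
  qed
  show "upp A D - D \<noteq> {}"
  proof
    assume "upp A D - D = {}"
    obtain m where m: "D = {..<m}" using cutset_eq_lessThan[OF D(1) \<open>D \<noteq> UNIV\<close>] by blast
    then have "m \<notin> upp A D" using \<open>upp A D - D = {}\<close> by auto
    then obtain E where E: "E \<in> A" "D \<subseteq> E" "m \<notin> E" unfolding upp_def by blast
    then have "x \<in> {..<m}" if "x \<in> E" for x
      using cutsets_less[of E x m] A(1) that by auto
    then have "E = D" using m E by auto
    then show False using E D by simp
  qed
qed

text \<open>Each clause of \<open>refinement\<close> is played against the fact \<open>AD\<close>: a
  member of \<open>A\<close> lies inside \<open>low A D\<close> or contains \<open>upp A D\<close>,
  so none has its border strictly within the gap.\<close>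

lemma good_of_closed:
  fixes A :: "'a set set"
  assumes r: "wf r" "trans r" "total r" "\<And>x :: 'a. open {y. y = x \<or> (y, x) \<in> r}"
    and A: "A \<subseteq> cutsets" "{} \<in> A" "UNIV \<in> A"
    and U: "\<And>p. p \<in> M_points \<Longrightarrow> left_unc p \<Longrightarrow> U p \<in> A"
    and L: "\<And>p z. p \<in> M_points \<Longrightarrow> \<not> left_unc p \<Longrightarrow> z < p \<Longrightarrow> \<exists>E\<in>A. z \<in> E \<and> p \<notin> E"
    and V: "\<And>p. p \<in> M_points \<Longrightarrow> right_unc p \<Longrightarrow> V p \<in> A"
    and R: "\<And>p z. p \<in> M_points \<Longrightarrow> \<not> right_unc p \<Longrightarrow> p < z \<Longrightarrow> \<exists>E\<in>A. p \<in> E \<and> z \<notin> E"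
    and ref: "\<And>E F. E \<in> A \<Longrightarrow> F \<in> A \<Longrightarrow> \<exists>\<Phi>\<subseteq>A. refinement r E F \<Phi>"
  shows "good U V A"
proof (rule good.intro[OF A U L V R])
  fix D :: "'a set" assume D: "D \<in> cutsets" "D \<notin> A"
  have AD: "G \<subseteq> low A D \<or> upp A D \<subseteq> G" if "G \<in> A" for G
    using cutsets_linear[OF D(1), of G] A(1) that low_greatest[OF that] upp_least[OF that] by blast
  obtain a b where ab: "a \<in> D" "a \<notin> low A D" "b \<in> upp A D" "b \<notin> D"
    using gap_nontrivial[OF A D] by blast
  have ab': "a \<in> upp A D" "b \<notin> low A D"
    using subsetD[OF subset_upp ab(1)] contra_subsetD[OF low_subset ab(4)] .
  show "low A D \<notin> A" if p: "p \<in> M_points" "p \<in> gap A D" "p \<notin> D" for p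
  proof
    assume low: "low A D \<in> A"
    have "a < p" by (rule cutsets_less[OF D(1) ab(1) p(3)])
    have lu: "left_unc p"
    proof (rule ccontr)
      assume "\<not> left_unc p"
      then obtain E where "E \<in> A" "a \<in> E" "p \<notin> E" using L[OF p(1)] \<open>a < p\<close> by blast
      then show False using AD[of E] ab p by blast
    qed
    obtain \<Phi> where \<Phi>: "\<Phi> \<subseteq> A" "refinement r (low A D) UNIV \<Phi>" using ref[OF low A(3)] by blast
    obtain G where "G \<in> \<Phi>" "low A D \<subset> G" "p \<notin> G"
      using refinementD(4)[OF \<Phi>(2) p(1) _ lu] p(2) by blast
    then show False using AD[of G] \<Phi>(1) p(2) by blast
  qed
  show "upp A D \<notin> A" if p: "p \<in> M_points" "p \<in> gap A D" "p \<in> D" for p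
  proof
    assume upp: "upp A D \<in> A"
    have "p < b" by (rule cutsets_less[OF D(1) p(3) ab(4)])
    have ru: "right_unc p"
    proof (rule ccontr)
      assume "\<not> right_unc p"
      then obtain E where "E \<in> A" "p \<in> E" "b \<notin> E" using R[OF p(1)] \<open>p < b\<close> by blast
      then show False using AD[of E] ab p by blast
    qed
    obtain \<Phi> where \<Phi>: "\<Phi> \<subseteq> A" "refinement r {} (upp A D) \<Phi>" using ref[OF A(2) upp] by blast
    obtain G where "G \<in> \<Phi>" "G \<subset> upp A D" "p \<in> G"
      using refinementD(5)[OF \<Phi>(2) p(1) _ ru] p(2) by blast
    then show False using AD[of G] \<Phi>(1) p(2) by blast
  qed
  show "low A D \<in> A \<longleftrightarrow> upp A D \<notin> A" if noM: "M_points \<inter> gap A D = {}"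
  proof (rule ccontr)
    assume "\<not> ?thesis"
    then consider "low A D \<in> A" "upp A D \<in> A" | "low A D \<notin> A" "upp A D \<notin> A" by blast
    then show False
    proof cases
      case 1
      \<comment> \<open>Both borders in \<open>A\<close>: refining exactly this region would put a
        member of \<open>A\<close> strictly between them.\<close>
      have xy': "\<exists>x\<in>gap A D. \<exists>y\<in>gap A D. x < y"
        using ab ab' cutsets_less[OF D(1) ab(1,4)] by blast
      obtain \<Phi> where \<Phi>: "\<Phi> \<subseteq> A" "refinement r (low A D) (upp A D) \<Phi>" using ref[OF 1] by blast
      obtain G where "G \<in> \<Phi>" "low A D \<subset> G" "G \<subset> upp A D"
        using refinementD(3)[OF \<Phi>(2) xy'] by blast
      then show False using AD[of G] \<Phi>(1) by blast
    next
      case 2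
      \<comment> \<open>Neither border in \<open>A\<close>: \<open>Q\<close> collects the largest
        points, in the well-ordering, of all regions around \<open>D\<close> bounded by members of
        \<open>A\<close>, and well-foundedness picks the lowest of them.\<close>
      define Q where "Q = {rtop r (F - E) | E F. E \<in> A \<and> F \<in> A \<and> E \<subseteq> D \<and> D \<subseteq> F}"
      have QI: "rtop r (F - E) \<in> Q" if "E \<in> A" "F \<in> A" "E \<subseteq> D" "D \<subseteq> F" for E F
        using that unfolding Q_def by blast
      have top1: "rtop r (F - E) \<in> F - E"
        and top2: "\<And>y. y \<in> F - E \<Longrightarrow> y = rtop r (F - E) \<or> (y, rtop r (F - E)) \<in> r"
        if EF: "E \<in> A" "F \<in> A" "E \<subseteq> D" "D \<subseteq> F" for E F
      proof -
        have "open E" "closed F" using EF A(1) by (auto simp: cutsets_def)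
        then have "compact (F - E)" by (intro compact_closed) auto
        moreover have "E \<noteq> D" using EF D(2) by metis
        then have "F - E \<noteq> {}" using EF by blast
        ultimately show "rtop r (F - E) \<in> F - E"
          "\<And>y. y \<in> F - E \<Longrightarrow> y = rtop r (F - E) \<or> (y, rtop r (F - E)) \<in> r"
          using rtop[OF r(2-4)] by blast+
      qed
      have "rtop r (UNIV - {}) \<in> Q" using A(2,3) by (rule QI) auto
      then obtain z where z: "z \<in> Q" "\<And>y. (y, z) \<in> r \<Longrightarrow> y \<notin> Q"
        using wfE_min[OF r(1)] by metis
      then obtain E0 F0 where EF0: "E0 \<in> A" "F0 \<in> A" "E0 \<subseteq> D" "D \<subseteq> F0" "z = rtop r (F0 - E0)"
        unfolding Q_def by blast
      \<comment> \<open>The largest point of a smaller region is at most \<open>z\<close> and, by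
        minimality, equal to it. So \<open>z\<close> survives all shrinking and lies in the
        gap.\<close>
      have zEF: "z \<in> F - E" if EF: "E \<in> A" "F \<in> A" "E \<subseteq> D" "D \<subseteq> F" and sub: "F - E \<subseteq> F0 - E0" for E F
      proof -
        have y: "rtop r (F - E) \<in> F - E" "rtop r (F - E) \<in> Q"
          using top1[OF EF] QI[OF EF] by simp_all
        have "rtop r (F - E) = z \<or> (rtop r (F - E), z) \<in> r"
          unfolding EF0(5) by (rule top2[OF EF0(1-4) subsetD[OF sub y(1)]])
        then have "rtop r (F - E) = z" using z(2) y(2) by blast
        then show ?thesis using y(1) by simp
      qed
      have zE: "z \<notin> E" if E: "E \<in> A" "E \<subseteq> D" for E
      proof (cases "E \<subseteq> E0")
        case True
        then show ?thesis using zEF[OF EF0(1-4)] by blast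
      next
        case False
        then have "E0 \<subseteq> E" using cutsets_linear[of E0 E] A(1) E EF0(1) by blast
        then show ?thesis using zEF[OF E(1) EF0(2) E(2) EF0(4)] by blast
      qed
      have zF: "z \<in> F" if F: "F \<in> A" "D \<subseteq> F" for F
      proof (cases "F0 \<subseteq> F")
        case True
        then show ?thesis using zEF[OF EF0(1-4)] by blast
      next
        case False
        then have "F \<subseteq> F0" using cutsets_linear[of F0 F] A(1) F EF0(2) by blast
        then show ?thesis using zEF[OF EF0(1) F(1) EF0(3) F(2)] by blast
      qed
      have zI: "z \<in> upp A D" "z \<notin> low A D" using zE zF by (auto simp: upp_def low_def)
      then have zM: "z \<notin> M_points" using noM by blast
      obtain \<Phi> where \<Phi>: "\<Phi> \<subseteq> A" "refinement r E0 F0 \<Phi>" using ref[OF EF0(1,2)] by blast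
      have uppc: "y \<in> upp A D" if "x \<in> upp A D" "y \<le> x" for x y
        using that A(1) cutsets_downward unfolding upp_def by blast
      have lowc: "y \<in> low A D" if "x \<in> low A D" "y \<le> x" for x y
        using that A(1) cutsets_downward unfolding low_def by blast
      \<comment> \<open>An external \<open>z\<close> gives a cutset in \<open>A\<close> that is a
        border of the gap; an internal one of countable character is separated by \<open>A\<close>
        from any other point \<open>w\<close> of the gap. Both are impossible.\<close>
      consider "open {..z}" | "open {z..}" | "internal_point z" by (auto simp: external_point_iff)
      then show False
      proof cases
        case a: 1
        then have zA: "{..z} \<in> A" using refinementD(6)[OF \<Phi>(2) EF0(5)] \<Phi>(1) by blast
        then have "upp A D \<subseteq> {..z}" using AD[OF zA] zI by blast
        moreover have "{..z} \<subseteq> upp A D" using uppc[OF zI(1)] by blast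
        ultimately show False using zA 2(2) by simp
      next
        case b: 2
        then have zA: "{..<z} \<in> A" using refinementD(7)[OF \<Phi>(2) EF0(5)] \<Phi>(1) by blast
        then have "{..<z} \<subseteq> low A D" using AD[OF zA] zI by blast
        moreover have "low A D \<subseteq> {..<z}" using lowc zI(2) by (metis lessThan_iff not_less subsetI)
        ultimately show False using zA 2(1) by simp
      next
        case 3
        have "a \<noteq> z \<or> b \<noteq> z" using ab by metis
        then obtain w where w: "w \<in> gap A D" "w \<noteq> z" using ab ab' by blast
        consider "w < z" | "z < w" using w(2) by (meson neqE)
        then show False
        proof cases
          case lt: 1
          obtain G where "G \<in> \<Phi>" "w \<in> G" "z \<notin> G"
            using refinementD(8)[OF \<Phi>(2) EF0(5) 3 zM lt] by blast
          then show False using AD[of G] \<Phi>(1) w(1) zI by blast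
        next
          case gt: 2
          obtain G where "G \<in> \<Phi>" "z \<in> G" "w \<notin> G"
            using refinementD(9)[OF \<Phi>(2) EF0(5) 3 zM gt] by blast
          then show False using AD[of G] \<Phi>(1) w(1) zI by blast
        qed
      qed
    qed
  qed
qed

text \<open>The witnesses \<open>\<Phi> E F\<close> are chosen once, so that being closed under them
  is a condition on pairs of members and passes to unions of increasing sequences.\<close>

lemma ex_good_family:
  assumes M: "countable (M_points :: 'a set)" and UV: "separators U V"
  obtains \<Sigma> :: "'a set set set" where "sigma_cofinal \<Sigma>" "\<And>A. A \<in> \<Sigma> \<Longrightarrow> good U V A"
proof -
  obtain r :: "('a \<times> 'a) set" where r: "wf r" "trans r" "total r" "\<And>x. open {y. y = x \<or> (y, x) \<in> r}"
    using scattered_well_ordering[OF scattered_K] by metis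
  have "\<forall>E F. \<exists>\<Phi> :: 'a set set. E \<in> cutsets \<longrightarrow> F \<in> cutsets \<longrightarrow> refinement r E F \<Phi>"
    using ex_refinement[OF M] by blast
  then obtain \<Phi> where \<Phi>: "\<And>E F :: 'a set. E \<in> cutsets \<Longrightarrow> F \<in> cutsets \<Longrightarrow> refinement r E F (\<Phi> E F)"
    by metis
  obtain L R where below: "\<And>p :: 'a. \<not> left_unc p \<Longrightarrow>
      countable (L p) \<and> L p \<subseteq> cutsets \<and> (\<forall>z<p. \<exists>E\<in>L p. z \<in> E \<and> p \<notin> E)"
    and above: "\<And>p :: 'a. \<not> right_unc p \<Longrightarrow>
      countable (R p) \<and> R p \<subseteq> cutsets \<and> (\<forall>z>p. \<exists>E\<in>R p. p \<in> E \<and> z \<notin> E)"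
    using cutsets_below cutsets_above by metis
  define N where "N p = (if left_unc p then {U p} else L p) \<union> (if right_unc p then {V p} else R p)" for p
  have N: "countable (N p) \<and> N p \<subseteq> cutsets" if p: "p \<in> M_points" for p
    using below[of p] above[of p] separatorsD(1,4)[OF UV p] unfolding N_def by auto
  define B where "B = {{}, UNIV} \<union> (\<Union>p\<in>M_points. N p)"
  have B: "countable B" "B \<subseteq> cutsets"
    unfolding B_def using N M by (simp_all add: UN_subset_iff)
  define \<Sigma> where "\<Sigma> = {A. B \<subseteq> A \<and> countable A \<and> A \<subseteq> cutsets \<and> (\<forall>E\<in>A. \<forall>F\<in>A. \<Phi> E F \<subseteq> A)}"
  have in_B: "{} \<in> B" "UNIV \<in> B" "\<And>p. p \<in> M_points \<Longrightarrow> N p \<subseteq> B"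
    unfolding B_def by auto
  show ?thesis
  proof (rule that)
    show "good U V A" if "A \<in> \<Sigma>" for A
    proof -
      have A: "B \<subseteq> A" "A \<subseteq> cutsets" "\<And>E F. E \<in> A \<Longrightarrow> F \<in> A \<Longrightarrow> \<Phi> E F \<subseteq> A"
        using that unfolding \<Sigma>_def by simp_all
      have NA: "N p \<subseteq> A" if "p \<in> M_points" for p
        using in_B(3)[OF that] A(1) by (rule order_trans)
      show ?thesis
      proof (rule good_of_closed[OF r A(2)])
        show "{} \<in> A" "UNIV \<in> A" using A(1) in_B by auto
        fix p :: 'a assume p: "p \<in> M_points"
        show "left_unc p \<Longrightarrow> U p \<in> A" "right_unc p \<Longrightarrow> V p \<in> A"
          using NA[OF p] unfolding N_def by (auto split: if_splits)
        fix z
        show "\<exists>E\<in>A. z \<in> E \<and> p \<notin> E" if lu: "\<not> left_unc p" "z < p"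
        proof -
          have "L p \<subseteq> A" using NA[OF p] lu(1) unfolding N_def by simp
          then show ?thesis using below[OF lu(1)] lu(2) by (meson subsetD)
        qed
        show "\<exists>E\<in>A. p \<in> E \<and> z \<notin> E" if ru: "\<not> right_unc p" "p < z"
        proof -
          have "R p \<subseteq> A" using NA[OF p] ru(1) unfolding N_def by simp
          then show ?thesis using above[OF ru(1)] ru(2) by (meson subsetD)
        qed
      next
        fix E F assume "E \<in> A" "F \<in> A"
        then show "\<exists>\<Phi>'\<subseteq>A. refinement r E F \<Phi>'" using A(2,3) \<Phi> by (meson subsetD)
      qed
    qed
    show "sigma_cofinal \<Sigma>"
      unfolding sigma_cofinal_def
    proof (intro conjI ballI allI impI)
      fix A assume "A \<in> \<Sigma>"
      then show "countable A" "A \<subseteq> cutsets" "{} \<in> A" "UNIV \<in> A"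
        using in_B by (auto simp: \<Sigma>_def)
    next
      fix A :: "'a set set" assume A: "countable A \<and> A \<subseteq> cutsets"
      have "\<exists>C. A \<union> B \<subseteq> C \<and> countable C \<and> C \<subseteq> cutsets \<and> (\<forall>E\<in>C. \<forall>F\<in>C. \<Phi> E F \<subseteq> C)"
      proof (rule countable_closure)
        show "countable (A \<union> B)" "A \<union> B \<subseteq> cutsets" using A B by auto
        show "countable (\<Phi> E F) \<and> \<Phi> E F \<subseteq> cutsets" if "E \<in> cutsets" "F \<in> cutsets" for E F
          using refinementD(1,2)[OF \<Phi>[OF that]] by blast
      qed
      then obtain C where C: "A \<union> B \<subseteq> C" "countable C" "C \<subseteq> cutsets" "\<forall>E\<in>C. \<forall>F\<in>C. \<Phi> E F \<subseteq> C"
        by (elim exE conjE)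
      then have "C \<in> \<Sigma>" "A \<subseteq> C" by (simp_all add: \<Sigma>_def)
      then show "\<exists>C\<in>\<Sigma>. A \<subseteq> C" by (rule bexI[rotated])
    next
      fix X :: "nat \<Rightarrow> 'a set set" assume X: "incseq X \<and> range X \<subseteq> \<Sigma>"
      have "X n \<in> \<Sigma>" for n using X by blast
      then have Xn: "B \<subseteq> X n" "countable (X n)" "X n \<subseteq> cutsets"
        "E \<in> X n \<Longrightarrow> F \<in> X n \<Longrightarrow> \<Phi> E F \<subseteq> X n" for n E F
        unfolding \<Sigma>_def by simp_all
      have "\<Phi> E F \<subseteq> (\<Union>n. X n)" if EF: "E \<in> (\<Union>n. X n)" "F \<in> (\<Union>n. X n)" for E F
      proof -
        obtain i j where "E \<in> X i" "F \<in> X j" using EF by blast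
        then have "E \<in> X (max i j)" "F \<in> X (max i j)"
          using X by (meson incseqD max.cobounded1 max.cobounded2 subsetD)+
        then have "\<Phi> E F \<subseteq> X (max i j)" by (rule Xn(4))
        then show ?thesis by blast
      qed
      moreover have "B \<subseteq> (\<Union>n. X n)" "countable (\<Union>n. X n)" "(\<Union>n. X n) \<subseteq> cutsets"
        using Xn(1)[of 0] Xn(2,3) by (blast, simp, blast)
      ultimately show "(\<Union>n. X n) \<in> \<Sigma>" unfolding \<Sigma>_def by simp
    qed
  qed
qed

end

section \<open>Evaluation functionals and projections\<close>

text \<open>The cutset whose indicator is the image of \<open>chi D\<close> under the projection of
  \<open>A\<close>. At a point \<open>p\<close> of M(K) it is \<open>V p\<close> or
  \<open>U p\<close>, because the border of the gap that evaluation at \<open>p\<close> produces is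
  not in \<open>A\<close>.\<close>

definition tau :: "('a::linorder_topology \<Rightarrow> 'a set) \<Rightarrow> ('a \<Rightarrow> 'a set) \<Rightarrow> 'a set set \<Rightarrow> 'a set \<Rightarrow> 'a set" where
  "tau U V A D =
     (if D \<in> A then D
      else if M_points \<inter> gap A D \<noteq> {} then
        (let p = SOME p. p \<in> M_points \<inter> gap A D in if p \<in> D then V p else U p)
      else if low A D \<in> A then low A D else upp A D)"

definition cut_class :: "'a set set \<Rightarrow> 'a \<Rightarrow> 'a set" where
  "cut_class A x = {z. \<forall>E\<in>A. z \<in> E \<longleftrightarrow> x \<in> E}"

definition min_of :: "'a::linorder set \<Rightarrow> 'a" where
  "min_of C = (SOME m. m \<in> C \<and> (\<forall>x\<in>C. m \<le> x))"

definition max_of :: "'a::linorder set \<Rightarrow> 'a" where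
  "max_of C = (SOME m. m \<in> C \<and> (\<forall>x\<in>C. x \<le> m))"

text \<open>For \<open>x\<close> in the gap of \<open>D\<close> the union in the test is
  \<open>low A D\<close>, written without \<open>D\<close>. If it belongs to \<open>A\<close>, the
  class is approached from the right only and its right end is taken. For good families the first
  branch has a single candidate.\<close>

definition rep :: "'a::linorder_topology set set \<Rightarrow> 'a \<Rightarrow> 'a" where
  "rep A x =
     (if M_points \<inter> cut_class A x \<noteq> {} then SOME p. p \<in> M_points \<inter> cut_class A x
      else if \<Union>{E\<in>A. x \<notin> E} \<in> A then max_of (cut_class A x) else min_of (cut_class A x))"

text \<open>This does not depend on \<open>A\<close>. Points in the class of \<open>p\<close> are
  taken out only in \<open>corr\<close>, since there \<open>rep\<close> already yields
  \<open>p\<close>.\<close>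

definition zone :: "('a::linorder_topology \<Rightarrow> 'a set) \<Rightarrow> ('a \<Rightarrow> 'a set) \<Rightarrow> 'a \<Rightarrow> 'a set" where
  "zone U V p = {x. (left_unc p \<and> x \<notin> U p \<and> x < p) \<or> (right_unc p \<and> p < x \<and> x \<in> V p)}"

definition corr :: "('a::linorder_topology \<Rightarrow> 'a set) \<Rightarrow> ('a \<Rightarrow> 'a set) \<Rightarrow> 'a set set \<Rightarrow> 'a \<Rightarrow> 'a \<Rightarrow> bool" where
  "corr U V A x p \<longleftrightarrow> p \<in> M_points \<and> x \<in> zone U V p \<and> x \<notin> cut_class A p"

text \<open>Without a correcting point both \<open>corr_pos\<close> and \<open>corr_neg\<close> are
  \<open>x\<close> and the two evaluations cancel, so one formula with three evaluations serves all
  points.\<close>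

definition corr_pos :: "('a::linorder_topology \<Rightarrow> 'a set) \<Rightarrow> ('a \<Rightarrow> 'a set) \<Rightarrow> 'a set set \<Rightarrow> 'a \<Rightarrow> 'a" where
  "corr_pos U V A x = (if Ex (corr U V A x) then SOME p. corr U V A x p else x)"

definition corr_neg :: "('a::linorder_topology \<Rightarrow> 'a set) \<Rightarrow> ('a \<Rightarrow> 'a set) \<Rightarrow> 'a set set \<Rightarrow> 'a \<Rightarrow> 'a" where
  "corr_neg U V A x =
     (let p = corr_pos U V A x in
      if x < p then min_of (cut_class A p) else if p < x then max_of (cut_class A p) else x)"

lemma in_cut_class: "x \<in> cut_class A x"
  by (simp add: cut_class_def)

lemma cut_classD: "y \<in> cut_class A x \<Longrightarrow> E \<in> A \<Longrightarrow> y \<in> E \<longleftrightarrow> x \<in> E"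
  by (simp add: cut_class_def)

lemma cut_class_eq: "y \<in> cut_class A x \<Longrightarrow> cut_class A y = cut_class A x"
  by (auto simp: cut_class_def)

lemma cut_class_gap:
  assumes "A \<subseteq> cutsets" "D \<in> cutsets" "x \<in> gap A D"
  shows "cut_class A x = gap A D" "\<Union>{E\<in>A. x \<notin> E} = low A D"
proof -
  have side: "(x \<notin> E) = (E \<subseteq> D)" "(x \<in> E) = (D \<subseteq> E)" if "E \<in> A" for E
  proof -
    have 1: "E \<subseteq> D \<or> D \<subseteq> E" using cutsets_linear assms(1,2) that by blast
    have 2: "E \<subseteq> D \<Longrightarrow> x \<notin> E" using assms(3) that unfolding low_def by blast
    have 3: "D \<subseteq> E \<Longrightarrow> x \<in> E" using assms(3) that unfolding upp_def by blast
    show "(x \<notin> E) = (E \<subseteq> D)" "(x \<in> E) = (D \<subseteq> E)" using 1 2 3 by metis+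
  qed
  show "\<Union>{E\<in>A. x \<notin> E} = low A D"
    unfolding low_def using side(1) by (metis (mono_tags, lifting) Collect_cong)
  show "cut_class A x = gap A D"
  proof (intro equalityI subsetI)
    fix y assume y: "y \<in> cut_class A x"
    have "y \<in> E" if "E \<in> A" "D \<subseteq> E" for E using cut_classD[OF y that(1)] side(2)[OF that(1)] that(2) by metis
    moreover have "y \<notin> E" if "E \<in> A" "E \<subseteq> D" for E using cut_classD[OF y that(1)] side(1)[OF that(1)] that(2) by metis
    ultimately show "y \<in> gap A D" unfolding upp_def low_def by blast
  next
    fix y assume y: "y \<in> gap A D"
    show "y \<in> cut_class A x"
      unfolding cut_class_def using same_gap[OF assms(1,2) _ y assms(3)] by simp
  qed
qed

text \<open>A point outside the gap lies in a member of \<open>A\<close> inside \<open>D\<close> or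
  is missed by one around \<open>D\<close>. Its whole class follows that member, so \<open>D\<close>
  does not cut it.\<close>

lemma class_outside_gap:
  assumes "x \<notin> gap A D" "y \<in> cut_class A x"
  shows "y \<in> D \<longleftrightarrow> x \<in> low A D" "x \<in> D \<longleftrightarrow> x \<in> low A D" "x \<in> upp A D \<longleftrightarrow> x \<in> low A D"
proof -
  have "low A D \<subseteq> upp A D" using low_subset[of A D] subset_upp[of D A] by (rule order_trans)
  then show 3: "x \<in> upp A D \<longleftrightarrow> x \<in> low A D" using assms(1) by blast
  have "y \<in> D" "x \<in> D" if "x \<in> low A D"
    using that cut_classD[OF assms(2)] unfolding low_def by blast+
  moreover have "y \<notin> D" "x \<notin> D" if nl: "x \<notin> low A D"
  proof -
    obtain E where "E \<in> A" "D \<subseteq> E" "x \<notin> E" using nl 3 unfolding upp_def by blast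
    then show "y \<notin> D" "x \<notin> D" using cut_classD[OF assms(2)] by blast+
  qed
  ultimately show "y \<in> D \<longleftrightarrow> x \<in> low A D" "x \<in> D \<longleftrightarrow> x \<in> low A D" by metis+
qed

section \<open>Evaluation at representatives and its correction for one good family\<close>

locale good_cuts = scattered_compact_line K for K :: "'a::linorder_topology itself" +
  fixes U V :: "'a \<Rightarrow> 'a set" and A :: "'a set set"
  assumes sep: "separators U V" and good: "good U V A"
begin

lemmas A_cutsets = goodD(1)[OF good]

lemma closed_cut_class: "closed (cut_class A x)"
proof -
  have "closed {z. z \<in> E \<longleftrightarrow> x \<in> E}" if "E \<in> A" for E
  proof -
    have "E \<in> cutsets" using that A_cutsets by (rule subsetD[rotated])
    then have "closed E" "closed (- E)" by (simp_all add: cutsets_def closed_Compl)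
    moreover have "{z. z \<in> E \<longleftrightarrow> x \<in> E} = (if x \<in> E then E else - E)" by auto
    ultimately show ?thesis by simp
  qed
  moreover have "cut_class A x = (\<Inter>E\<in>A. {z. z \<in> E \<longleftrightarrow> x \<in> E})" by (auto simp: cut_class_def)
  ultimately show ?thesis by (simp add: closed_INT)
qed

lemma min_of_class: "min_of (cut_class A x) \<in> cut_class A x" "y \<in> cut_class A x \<Longrightarrow> min_of (cut_class A x) \<le> y"
proof -
  have "cut_class A x \<noteq> {}" using in_cut_class[of x A] by blast
  then have "\<exists>m. m \<in> cut_class A x \<and> (\<forall>y\<in>cut_class A x. m \<le> y)"
    using compact_attains_inf[OF compact_closed[OF closed_cut_class[of x]]] unfolding Bex_def by simp
  then have "min_of (cut_class A x) \<in> cut_class A x \<and> (\<forall>y\<in>cut_class A x. min_of (cut_class A x) \<le> y)"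
    unfolding min_of_def by (rule someI_ex)
  then show "min_of (cut_class A x) \<in> cut_class A x" "y \<in> cut_class A x \<Longrightarrow> min_of (cut_class A x) \<le> y"
    by simp_all
qed

lemma max_of_class: "max_of (cut_class A x) \<in> cut_class A x" "y \<in> cut_class A x \<Longrightarrow> y \<le> max_of (cut_class A x)"
proof -
  have "cut_class A x \<noteq> {}" using in_cut_class[of x A] by blast
  then have "\<exists>m. m \<in> cut_class A x \<and> (\<forall>y\<in>cut_class A x. y \<le> m)"
    using compact_attains_sup[OF compact_closed[OF closed_cut_class[of x]]] unfolding Bex_def by simp
  then have "max_of (cut_class A x) \<in> cut_class A x \<and> (\<forall>y\<in>cut_class A x. y \<le> max_of (cut_class A x))"
    unfolding max_of_def by (rule someI_ex)
  then show "max_of (cut_class A x) \<in> cut_class A x" "y \<in> cut_class A x \<Longrightarrow> y \<le> max_of (cut_class A x)"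
    by simp_all
qed

text \<open>For \<open>p < q\<close> the set \<open>U q\<close> separates the points if
  \<open>q\<close> has uncountable left cofinality; otherwise members of \<open>A\<close> approach
  \<open>q\<close> from the left, and one that misses \<open>q\<close> contains
  \<open>p\<close>.\<close>

lemma M_class_unique:
  assumes "p \<in> M_points" "q \<in> M_points" "q \<in> cut_class A p"
  shows "p = q"
proof -
  have sepa: "\<exists>E\<in>A. p \<in> E \<and> q \<notin> E" if p: "p \<in> M_points" and q: "q \<in> M_points" and pq: "p < q" for p q
  proof (cases "left_unc q")
    case True
    then show ?thesis
      using separatorsD(2)[OF sep q True] separatorsD(3)[OF sep q True p pq] goodD(4)[OF good q True] by blast
  next
    case False
    show ?thesis by (rule goodD(5)[OF good q False pq])
  qed
  show ?thesis
  proof (rule ccontr)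
    assume "p \<noteq> q"
    then consider "p < q" | "q < p" by (meson neqE)
    then show False
      using sepa[OF assms(1,2)] sepa[OF assms(2,1)] cut_classD[OF assms(3)] by cases blast+
  qed
qed

lemma rep_in_class: "rep A x \<in> cut_class A x"
proof (cases "M_points \<inter> cut_class A x = {}")
  case False
  then have "(SOME p. p \<in> M_points \<inter> cut_class A x) \<in> M_points \<inter> cut_class A x"
    by (meson ex_in_conv someI_ex)
  then show ?thesis using False unfolding rep_def by auto
next
  case True
  then show ?thesis using min_of_class(1) max_of_class(1) unfolding rep_def by auto
qed

text \<open>Each position of \<open>x\<close> relative to \<open>p < q\<close> contradicts one of
  the conditions on \<open>U\<close> and \<open>V\<close> that involve two points.\<close>

lemma zone_unique:
  assumes "p \<in> M_points" "q \<in> M_points" "x \<in> zone U V p" "x \<in> zone U V q"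
  shows "p = q"
proof (rule ccontr)
  have False if p: "p \<in> M_points" and q: "q \<in> M_points" and x: "x \<in> zone U V p" "x \<in> zone U V q"
    and pq: "p < q" for p q
  proof -
    have xp: "x \<noteq> p" "x \<noteq> q" using x by (auto simp: zone_def)
    consider "x < p" | "p < x" "x < q" | "q < x" using xp by (meson neqE)
    then show False
    proof cases
      case 1
      then have "x < q" using pq by simp
      then have "left_unc q" "x \<notin> U q" using x(2) by (auto simp: zone_def)
      moreover from this have "p \<in> U q" "U q \<in> cutsets" using separatorsD(1,3)[OF sep q] p pq by blast+
      ultimately show False using cutsets_downward[of "U q" p x] 1 by simp
    next
      case 2
      then have "left_unc q" "x \<notin> U q" "right_unc p" "x \<in> V p" using x by (auto simp: zone_def)
      then show False using separatorsD(7)[OF sep p _ q pq] by blast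
    next
      case 3
      then have "p < x" using pq by simp
      then have "right_unc p" "x \<in> V p" using x(1) by (auto simp: zone_def)
      moreover from this have "q \<notin> V p" "V p \<in> cutsets" using separatorsD(4,6)[OF sep p] q pq by blast+
      ultimately show False using cutsets_downward[of "V p" x q] 3 by simp
    qed
  qed
  moreover assume "p \<noteq> q"
  ultimately show False using assms by (metis neqE)
qed

lemma corr_pos_eq: "corr U V A x p \<Longrightarrow> corr_pos U V A x = p"
  unfolding corr_pos_def
  by (metis (full_types) corr_def someI_ex zone_unique)

lemma corr_neg_in_class: "corr_neg U V A x \<in> cut_class A (corr_pos U V A x)"
  unfolding corr_neg_def Let_def
  using min_of_class(1) max_of_class(1) in_cut_class by (metis neqE)

lemma corr_neg_no: "\<not> Ex (corr U V A x) \<Longrightarrow> corr_neg U V A x = corr_pos U V A x"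
proof -
  assume "\<not> Ex (corr U V A x)"
  then have "corr_pos U V A x = x" unfolding corr_pos_def by (rule if_not_P)
  then show ?thesis unfolding corr_neg_def Let_def by simp
qed

text \<open>Both points of the correction lie in the class of the correcting point, and
  \<open>D\<close> cuts no class but its gap.\<close>

lemma corr_cancel:
  assumes "D \<in> cutsets" "D \<notin> A" "\<And>p. p \<in> M_points \<Longrightarrow> p \<in> gap A D \<Longrightarrow> \<not> corr U V A x p"
  shows "corr_pos U V A x \<in> D \<longleftrightarrow> corr_neg U V A x \<in> D"
proof (cases "Ex (corr U V A x)")
  case True
  then obtain p where p: "corr U V A x p" by blast
  then have "p \<notin> gap A D" using assms(3)[of p] by (auto simp: corr_def)
  moreover have "corr_neg U V A x \<in> cut_class A p" using corr_neg_in_class[of x] corr_pos_eq[OF p] by simp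
  ultimately show ?thesis
    unfolding corr_pos_eq[OF p] using class_outside_gap(1,2) by metis
next
  case False
  then show ?thesis using corr_neg_no by simp
qed

lemma min_gap:
  assumes "D \<in> cutsets" "D \<notin> A" "x \<in> gap A D"
  shows "min_of (cut_class A x) \<in> D" "max_of (cut_class A x) \<notin> D"
proof -
  have cl: "cut_class A x = gap A D" by (rule cut_class_gap[OF A_cutsets assms(1,3)])
  obtain a b where ab: "a \<in> D" "a \<notin> low A D" "b \<in> upp A D" "b \<notin> D"
    using gap_nontrivial[OF goodD(1-3)[OF good] assms(1,2)] by blast
  have "a \<in> upp A D" using ab(1) subset_upp[of D A] by (rule subsetD[rotated])
  then have "min_of (cut_class A x) \<le> a" using ab(2) cl by (intro min_of_class(2)) simp
  then show "min_of (cut_class A x) \<in> D" using cutsets_downward[OF assms(1) ab(1)] by simp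
  have "b \<notin> low A D" using ab(4) low_subset[of A D] by (rule contra_subsetD[rotated])
  then have "b \<le> max_of (cut_class A x)" using ab(3) cl by (intro max_of_class(2)) simp
  then show "max_of (cut_class A x) \<notin> D" using cutsets_downward[OF assms(1)] ab(4) by metis
qed

text \<open>\<open>D\<close> leaves points of the gap on both of its sides. If \<open>p\<close> lies
  on one side and had countable cofinality towards the other, a member of \<open>A\<close> would
  separate \<open>p\<close> from a point of its own class.\<close>

lemma gap_side_unc:
  assumes "D \<in> cutsets" "D \<notin> A" "p \<in> M_points" "p \<in> gap A D"
  shows "p \<in> D \<Longrightarrow> right_unc p" "p \<notin> D \<Longrightarrow> left_unc p"
proof -
  obtain a b where ab: "a \<in> D" "a \<notin> low A D" "b \<in> upp A D" "b \<notin> D"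
    using gap_nontrivial[OF goodD(1-3)[OF good] assms(1,2)] by blast
  have a: "a \<in> gap A D" using ab(1,2) subset_upp[of D A] by blast
  have b: "b \<in> gap A D" using ab(3,4) low_subset[of A D] by blast
  show "right_unc p" if "p \<in> D"
  proof (rule ccontr)
    assume nr: "\<not> right_unc p"
    have "p < b" by (rule cutsets_less[OF assms(1) that ab(4)])
    then obtain E where "E \<in> A" "p \<in> E" "b \<notin> E" using goodD(7)[OF good assms(3) nr] by blast
    then show False using same_gap[OF A_cutsets assms(1) _ assms(4) b] by blast
  qed
  show "left_unc p" if "p \<notin> D"
  proof (rule ccontr)
    assume nr: "\<not> left_unc p"
    have "a < p" by (rule cutsets_less[OF assms(1) ab(1) that])
    then obtain E where "E \<in> A" "a \<in> E" "p \<notin> E" using goodD(5)[OF good assms(3) nr] by blast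
    then show False using same_gap[OF A_cutsets assms(1) _ assms(4) a] by blast
  qed
qed

lemma gap_point:
  assumes "D \<in> cutsets" "p \<in> M_points" "p \<in> gap A D" "q \<in> M_points" "q \<in> gap A D"
  shows "q = p"
  using M_class_unique[OF assms(2,4)] cut_class_gap(1)[OF A_cutsets assms(1,3)] assms(5) by simp

lemma tau_in: "D \<in> A \<Longrightarrow> tau U V A D = D"
  by (simp add: tau_def)

lemma tau_point:
  assumes "D \<in> cutsets" "D \<notin> A" "p \<in> M_points" "p \<in> gap A D"
  shows "tau U V A D = (if p \<in> D then V p else U p)"
proof -
  have "(SOME p. p \<in> M_points \<inter> gap A D) = p"
    using assms gap_point by (intro some_equality) blast+
  moreover have "M_points \<inter> gap A D \<noteq> {}" using assms by blast
  ultimately show ?thesis using assms(2) unfolding tau_def Let_def by simp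
qed

lemma tau_no_point:
  assumes "D \<notin> A" "M_points \<inter> gap A D = {}"
  shows "tau U V A D = (if low A D \<in> A then low A D else upp A D)"
  using assms by (simp add: tau_def)

lemma tau_mem: "D \<in> cutsets \<Longrightarrow> tau U V A D \<in> A"
proof (cases "D \<in> A")
  case True
  then show ?thesis by (simp add: tau_in)
next
  case False
  assume D: "D \<in> cutsets"
  show ?thesis
  proof (cases "M_points \<inter> gap A D = {}")
    case True
    then show ?thesis using tau_no_point[OF False True] goodD(8)[OF good D False True] by simp
  next
    case ne: False
    then obtain p where p: "p \<in> M_points" "p \<in> gap A D" by blast
    then show ?thesis
      using tau_point[OF D False p] gap_side_unc[OF D False p] goodD(4,6)[OF good p(1)] by simp
  qed
qed

lemma rep_no_point:
  assumes "D \<in> cutsets" "D \<notin> A" "M_points \<inter> gap A D = {}"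
  shows "rep A x \<in> D \<longleftrightarrow> x \<in> tau U V A D"
proof (cases "x \<in> gap A D")
  case True
  have "rep A x = (if low A D \<in> A then max_of (cut_class A x) else min_of (cut_class A x))"
    using assms(3) cut_class_gap[OF A_cutsets assms(1) True] unfolding rep_def by simp
  then show ?thesis
    using tau_no_point[OF assms(2,3)] min_gap[OF assms(1,2) True] True by simp
next
  case False
  show ?thesis
    using class_outside_gap[OF False rep_in_class] tau_no_point[OF assms(2,3)] by simp
qed

text \<open>Let \<open>p\<close> be a point of M(K) in the gap. If it lies in \<open>D\<close>, the
  first term is the indicator of \<open>upp A D\<close>, and the correction adds 1 on the part of
  \<open>V p\<close> outside \<open>upp A D\<close>. If not, the first term is the indicator of
  \<open>low A D\<close>, and the correction subtracts 1 on its part outside \<open>U p\<close>. In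
  the zone on the other side of \<open>p\<close> both points of the correction lie on the same side
  of \<open>D\<close> and cancel.\<close>

lemma evaluation_identity:
  assumes D: "D \<in> cutsets"
  shows "indicator D (rep A x) + indicator D (corr_pos U V A x) - indicator D (corr_neg U V A x)
    = (indicator (tau U V A D) x :: real)"
proof (cases "D \<in> A")
  case True
  have "rep A x \<in> D \<longleftrightarrow> x \<in> D" by (rule cut_classD[OF rep_in_class True])
  moreover have "corr_neg U V A x \<in> D \<longleftrightarrow> corr_pos U V A x \<in> D" by (rule cut_classD[OF corr_neg_in_class True])
  ultimately show ?thesis using tau_in[OF True] by (simp add: indicator_def)
next
  case nA: False
  show ?thesis
  proof (cases "M_points \<inter> gap A D = {}")
    case True
    then have "corr_pos U V A x \<in> D \<longleftrightarrow> corr_neg U V A x \<in> D"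
      by (intro corr_cancel[OF D nA]) blast
    then show ?thesis using rep_no_point[OF D nA True, of x] by (simp add: indicator_def)
  next
    case False
    then obtain p where p: "p \<in> M_points" "p \<in> gap A D" by blast
    note cl = cut_class_gap(1)[OF A_cutsets D p(2)]
    note tau = tau_point[OF D nA p]
    have cancel: "corr_pos U V A x \<in> D \<longleftrightarrow> corr_neg U V A x \<in> D" if "\<not> corr U V A x p"
    proof (rule corr_cancel[OF D nA])
      fix q assume "q \<in> M_points" "q \<in> gap A D"
      then have "q = p" by (rule gap_point[OF D p])
      then show "\<not> corr U V A x q" using that by simp
    qed
    note ext = min_gap[OF D nA p(2)]
    show ?thesis
    proof (cases "x \<in> gap A D")
      case True
      have "M_points \<inter> cut_class A x \<noteq> {}"
        using cut_class_gap(1)[OF A_cutsets D True] p by blast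
      then have "(SOME p. p \<in> M_points \<inter> cut_class A x) \<in> M_points \<inter> cut_class A x"
        by (meson ex_in_conv someI_ex)
      moreover have "rep A x = (SOME p. p \<in> M_points \<inter> cut_class A x)"
        using \<open>M_points \<inter> cut_class A x \<noteq> {}\<close> unfolding rep_def by simp
      ultimately have "rep A x \<in> M_points" "rep A x \<in> cut_class A x" by simp_all
      then have rep: "rep A x = p"
        using gap_point[OF D p, of "rep A x"] cut_class_gap(1)[OF A_cutsets D True] by simp
      have nc: "\<not> corr U V A x p" using True cl unfolding corr_def by simp
      have xE: "x \<in> E \<longleftrightarrow> p \<in> E" if "E \<in> A" for E by (rule same_gap[OF A_cutsets D that True p(2)])
      have "x \<in> tau U V A D \<longleftrightarrow> p \<in> D"
        unfolding xE[OF tau_mem[OF D]]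
        using tau gap_side_unc[OF D nA p] separatorsD(2,5)[OF sep p(1)] by simp
      then show ?thesis using rep cancel[OF nc] by (simp add: indicator_def)
    next
      case x: False
      note out = class_outside_gap[OF x rep_in_class]
      have nc: "x \<notin> cut_class A p" using x cl by simp
      show ?thesis
      proof (cases "p \<in> D")
        case True
        have ru: "right_unc p" using gap_side_unc[OF D nA p] True by blast
        have Vp: "V p \<in> A" "p \<in> V p" using goodD(6)[OF good p(1) ru] separatorsD(5)[OF sep p(1) ru] .
        have "V p \<subseteq> D \<or> D \<subseteq> V p" using cutsets_linear[OF _ D] Vp(1) A_cutsets by blast
        then have "D \<subseteq> V p" using low_greatest[OF Vp(1), of D] Vp(2) p(2) by blast
        then have uV: "upp A D \<subseteq> V p" by (rule upp_least[OF Vp(1)])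
        have tauV: "tau U V A D = V p" using tau True by simp
        show ?thesis
        proof (cases "x \<in> low A D")
          case low: True
          then have xD: "x \<in> D" "x \<in> V p" using out uV by auto
          obtain E where E: "E \<in> A" "E \<subseteq> D" "x \<in> E" using low unfolding low_def by blast
          have "p \<notin> E" using E p(2) unfolding low_def by blast
          then have "x < p" using cutsets_less[of E x p] E A_cutsets by blast
          have "corr_pos U V A x \<in> D \<longleftrightarrow> corr_neg U V A x \<in> D"
          proof (cases "corr U V A x p")
            case True
            then show ?thesis
              using corr_pos_eq[OF True] \<open>x < p\<close> ext \<open>p \<in> D\<close> unfolding corr_neg_def Let_def by simp
          qed (rule cancel)
          then show ?thesis using out(1) low xD tauV by (simp add: indicator_def)
        next
          case nlow: False
          then have "x \<notin> upp A D" using out by simp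
          then obtain E where E: "E \<in> A" "D \<subseteq> E" "x \<notin> E" unfolding upp_def by blast
          then have "p < x" using cutsets_less[of E p x] True A_cutsets by blast
          have iff: "corr U V A x p \<longleftrightarrow> x \<in> V p"
            using p(1) nc ru \<open>p < x\<close> unfolding corr_def zone_def by auto
          show ?thesis
          proof (cases "x \<in> V p")
            case xV: True
            then have "corr_pos U V A x = p" using corr_pos_eq iff by blast
            moreover from this have "corr_neg U V A x = max_of (cut_class A p)"
              using \<open>p < x\<close> less_imp_not_less[OF \<open>p < x\<close>] unfolding corr_neg_def Let_def by simp
            ultimately show ?thesis
              using out(1) nlow ext True tauV xV by (simp add: indicator_def)
          next
            case xV: False
            then show ?thesis using cancel iff out(1) nlow tauV by (simp add: indicator_def)
          qed
        qed
      next
        case False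
        have lu: "left_unc p" using gap_side_unc[OF D nA p] False by blast
        have Up: "U p \<in> A" "p \<notin> U p" using goodD(4)[OF good p(1) lu] separatorsD(2)[OF sep p(1) lu] .
        have "U p \<subseteq> D \<or> D \<subseteq> U p" using cutsets_linear[OF _ D] Up(1) A_cutsets by blast
        then have "U p \<subseteq> D" using upp_least[OF Up(1), of D] Up(2) p(2) by blast
        then have uU: "U p \<subseteq> low A D" by (rule low_greatest[OF Up(1)])
        have tauU: "tau U V A D = U p" using tau False by simp
        show ?thesis
        proof (cases "x \<in> low A D")
          case low: True
          then have xD: "x \<in> D" using out by auto
          obtain E where E: "E \<in> A" "E \<subseteq> D" "x \<in> E" using low unfolding low_def by blast
          have "p \<notin> E" using E p(2) unfolding low_def by blast
          then have "x < p" using cutsets_less[of E x p] E A_cutsets by blast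
          have iff: "corr U V A x p \<longleftrightarrow> x \<notin> U p"
            using p(1) nc lu \<open>x < p\<close> unfolding corr_def zone_def by auto
          show ?thesis
          proof (cases "x \<in> U p")
            case xU: False
            then have "corr_pos U V A x = p" using corr_pos_eq iff by blast
            moreover from this have "corr_neg U V A x = min_of (cut_class A p)"
              using \<open>x < p\<close> unfolding corr_neg_def Let_def by simp
            ultimately show ?thesis
              using out(1) low ext False tauU xU by (simp add: indicator_def)
          next
            case xU: True
            then show ?thesis using cancel iff out(1) low tauU by (simp add: indicator_def)
          qed
        next
          case nlow: False
          then have xD: "x \<notin> D" "x \<notin> U p" using out uU by auto
          then have "x \<notin> upp A D" using out nlow by simp
          then obtain E where E: "E \<in> A" "D \<subseteq> E" "x \<notin> E" unfolding upp_def by blast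
          then have "p \<in> E" using p(2) unfolding upp_def by blast
          then have "p < x" using cutsets_less[of E p x] E A_cutsets by blast
          have "corr_pos U V A x \<in> D \<longleftrightarrow> corr_neg U V A x \<in> D"
          proof (cases "corr U V A x p")
            case True
            then show ?thesis
              using corr_pos_eq[OF True] \<open>p < x\<close> less_imp_not_less[OF \<open>p < x\<close>] ext \<open>p \<notin> D\<close> unfolding corr_neg_def Let_def by simp
          qed (rule cancel)
          then show ?thesis using out(1) nlow xD tauU by (simp add: indicator_def)
        qed
      qed
    qed
  qed
qed

end

lemma (in scattered_compact_line) good_cutsI:
  "separators U V \<Longrightarrow> good U V (A :: 'a set set) \<Longrightarrow> good_cuts U V A"
  by (intro good_cuts.intro scattered_compact_line_axioms good_cuts_axioms.intro)

text \<open>The gap in \<open>B\<close> lies inside the gap in \<open>A\<close>. A point of M(K) in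
  the smaller gap decides both values alike, by a set \<open>U p\<close> or \<open>V p\<close> that
  also belongs to \<open>A\<close>. Otherwise \<open>D\<close> moves to a border of the gap in
  \<open>B\<close> without passing a point of M(K), and \<open>A\<close> does not notice
  this.\<close>

lemma (in scattered_compact_line) tau_tau:
  fixes A B :: "'a set set"
  assumes UV: "separators U V" and gA: "good U V A" and gB: "good U V B"
    and AB: "A \<subseteq> B" and D: "D \<in> cutsets"
  shows "tau U V A (tau U V B D) = tau U V A D"
proof (cases "D \<in> B")
  case True
  then show ?thesis by (simp add: tau_def)
next
  case DB: False
  interpret A: good_cuts "TYPE('a)" U V A
    by (rule good_cutsI[OF UV gA])
  interpret B: good_cuts "TYPE('a)" U V B
    by (rule good_cutsI[OF UV gB])
  have DA: "D \<notin> A" using DB AB by blast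
  have lu: "low A D \<subseteq> low B D" "upp B D \<subseteq> upp A D"
    using AB unfolding low_def upp_def by blast+
  show ?thesis
  proof (cases "M_points \<inter> gap B D = {}")
    case False
    then obtain p where pB: "p \<in> M_points" "p \<in> gap B D" by blast
    then have pA: "p \<in> gap A D" using lu by blast
    show ?thesis
    proof (cases "p \<in> D")
      case True
      have "V p \<in> A" using goodD(6)[OF gA pB(1)] A.gap_side_unc(1)[OF D DA pB(1) pA True] by blast
      then show ?thesis
        using True A.tau_point[OF D DA pB(1) pA] B.tau_point[OF D DB pB] A.tau_in[of "V p"] by simp
    next
      case False
      have "U p \<in> A" using goodD(4)[OF gA pB(1)] A.gap_side_unc(2)[OF D DA pB(1) pA False] by blast
      then show ?thesis
        using False A.tau_point[OF D DA pB(1) pA] B.tau_point[OF D DB pB] A.tau_in[of "U p"] by simp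
    qed
  next
    case noB: True
    define D' where "D' = tau U V B D"
    have D'cases: "D' = low B D \<or> D' = upp B D" unfolding D'_def using B.tau_no_point[OF DB noB] by simp
    have D'cut: "D' \<in> cutsets" using B.tau_mem[OF D] B.A_cutsets unfolding D'_def by (rule subsetD[rotated])
    have luB: "low B D \<subseteq> D" "D \<subseteq> upp B D" by (rule low_subset, rule subset_upp)
    have D'sub: "low A D \<subseteq> D'" "D' \<subseteq> upp A D" using D'cases lu luB by blast+
    have mem: "p \<in> D' \<longleftrightarrow> p \<in> D" if "p \<in> M_points" for p
    proof -
      have "p \<notin> gap B D" using noB that by blast
      then show ?thesis using D'cases luB by blast
    qed
    have "tau U V A D' = tau U V A D"
    proof (cases "D' \<in> A")
      case True
      have "D' \<subseteq> D \<or> D \<subseteq> D'" by (rule cutsets_linear[OF D'cut D])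
      then have eq: "D' = low A D \<or> D' = upp A D"
        using low_greatest[OF True, of D] upp_least[OF True, of D] D'sub by blast
      \<comment> \<open>\<open>D'\<close> is a border of the gap that belongs to \<open>A\<close>,
        and points of M(K) lie on the same side of it as of \<open>D\<close>; \<open>good\<close>
        excludes this if the gap contains such a point.\<close>
      have "M_points \<inter> gap A D = {}"
      proof (rule ccontr)
        assume "\<not> ?thesis"
        then obtain p where p: "p \<in> M_points" "p \<in> gap A D" by blast
        show False
        proof (cases "D' = low A D")
          case l: True
          then have "p \<in> D" using goodD(9)[OF gA D DA p] True by auto
          then show False using mem[OF p(1)] l p(2) by simp
        next
          case False
          then have u: "D' = upp A D" using eq by simp
          then have "p \<notin> D" using goodD(10)[OF gA D DA p] True by auto
          then show False using mem[OF p(1)] u p(2) by simp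
        qed
      qed
      then have "tau U V A D = D'"
        using A.tau_no_point[OF DA] goodD(8)[OF gA D DA] eq True by auto
      then show ?thesis using A.tau_in[OF True] by simp
    next
      case False
      \<comment> \<open>\<open>D'\<close> lies between the borders of the gap of \<open>D\<close> in
        \<open>A\<close> and is not in \<open>A\<close>, so it has the same gap.\<close>
      have iff: "E \<subseteq> D' \<longleftrightarrow> E \<subseteq> D" "D' \<subseteq> E \<longleftrightarrow> D \<subseteq> E" if E: "E \<in> A" for E
      proof -
        have Ec: "E \<in> cutsets" using E A.A_cutsets by (rule subsetD[rotated])
        have lin: "E \<subseteq> D \<or> D \<subseteq> E" by (rule cutsets_linear[OF Ec D])
        have 1: "E \<subseteq> D'" if "E \<subseteq> D" using low_greatest[OF E that] D'sub(1) by (rule order_trans)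
        have 2: "D' \<subseteq> E" if "D \<subseteq> E" using D'sub(2) upp_least[OF E that] by (rule order_trans)
        have "E \<noteq> D'" "E \<noteq> D" using E False DA by auto
        then show "E \<subseteq> D' \<longleftrightarrow> E \<subseteq> D" "D' \<subseteq> E \<longleftrightarrow> D \<subseteq> E"
          using lin 1 2 by (metis subset_antisym)+
      qed
      then have lu': "low A D' = low A D" "upp A D' = upp A D"
        unfolding low_def upp_def by (metis (mono_tags, lifting) Collect_cong)+
      show ?thesis
      proof (cases "M_points \<inter> gap A D = {}")
        case True
        then show ?thesis using A.tau_no_point[OF DA True] A.tau_no_point[OF False] lu' by simp
      next
        case ne: False
        then obtain p where p: "p \<in> M_points" "p \<in> gap A D" by blast
        then show ?thesis
          using A.tau_point[OF D DA p] A.tau_point[OF D'cut False p(1)] lu' mem[OF p(1)] by simp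
      qed
    qed
    then show ?thesis unfolding D'_def .
  qed
qed

section \<open>Operators determined by their values on indicators\<close>

lemma bounded_linear_eq_on_gen:
  assumes "bounded_linear S" "bounded_linear T" "\<And>D. D \<in> A \<Longrightarrow> S (chi D) = T (chi D)" "f \<in> gen A"
  shows "S f = T f"
proof -
  have "gen A \<subseteq> {f. S f = T f}"
  proof (rule gen_minimal)
    show "closed {f. S f = T f}"
      by (intro closed_Collect_eq bounded_linear.continuous_on[OF assms(1)]
          bounded_linear.continuous_on[OF assms(2)] continuous_on_id)
    interpret S: bounded_linear S by fact
    interpret T: bounded_linear T by fact
    show "subspace {f. S f = T f}"
      by (auto simp: subspace_def S.zero T.zero S.add T.add S.scaleR T.scaleR)
    show "chi ` A \<subseteq> {f. S f = T f}" using assms(3) by auto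
  qed
  then show ?thesis using assms(4) by blast
qed

lemma bounded_linear_in_gen:
  assumes "bounded_linear T" "\<And>D. D \<in> A \<Longrightarrow> T (chi D) \<in> gen B" "f \<in> gen A"
  shows "T f \<in> gen B"
proof -
  have "gen A \<subseteq> T -` gen B"
  proof (rule gen_minimal)
    show "closed (T -` gen B)"
      using bounded_linear.continuous_on[OF assms(1) continuous_on_id, of UNIV] closed_gen[of B]
      by (simp add: continuous_on_closed_vimage)
    interpret T: bounded_linear T by fact
    show "subspace (T -` gen B)"
      using subspace_gen[of B] by (auto simp: subspace_def T.zero T.add T.scaleR)
    show "chi ` A \<subseteq> T -` gen B" using assms(2) by auto
  qed
  then show ?thesis using assms(3) by blast
qed

context scattered_compact_line
begin

text \<open>The single evaluations need not depend continuously on \<open>x\<close>, but their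
  combination does for each \<open>chi D\<close> and hence, by linearity and uniform limits, for
  every function. Three evaluations bound the norm by 3; only one is left if
  \<open>b = c\<close>.\<close>

lemma evaluation_operator:
  fixes a b c :: "'a \<Rightarrow> 'a" and t :: "'a set \<Rightarrow> 'a set"
  assumes ev: "\<And>D x. D \<in> cutsets \<Longrightarrow>
      indicator D (a x) + indicator D (b x) - indicator D (c x) = (indicator (t D) x :: real)"
    and t: "\<And>D. D \<in> cutsets \<Longrightarrow> t D \<in> cutsets"
  shows "\<exists>P :: ('a \<Rightarrow>\<^sub>C real) \<Rightarrow> ('a \<Rightarrow>\<^sub>C real). bounded_linear P \<and> onorm P \<le> 3 \<and>
    (b = c \<longrightarrow> onorm P \<le> 1) \<and> (\<forall>D\<in>cutsets. P (chi D) = chi (t D))"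
proof -
  define T where "T f x = apply_bcontfun f (a x) + apply_bcontfun f (b x) - apply_bcontfun f (c x)"
    for f :: "'a \<Rightarrow>\<^sub>C real" and x
  have T_bound: "\<bar>T f x\<bar> \<le> 3 * norm f" for f x
    using norm_bounded[of f "a x"] norm_bounded[of f "b x"] norm_bounded[of f "c x"]
    unfolding T_def by (simp add: abs_le_iff)
  have T_bound1: "\<bar>T f x\<bar> \<le> norm f" if "b = c" for f x
    using norm_bounded[of f "a x"] that unfolding T_def by simp
  have T_diff: "T f x - T g x = T (f - g) x" for f g x
    unfolding T_def by simp
  have T_chi: "T (chi D) x = apply_bcontfun (chi (t D)) x" if "D \<in> cutsets" for D x
    unfolding T_def using ev[OF that] t[OF that] that by (simp add: chi_cutset_apply)
  have cont: "continuous_on UNIV (T f)" for f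
  proof -
    have "gen cutsets \<subseteq> {f. continuous_on UNIV (T f)}"
    proof (rule gen_minimal)
      show "closed {f. continuous_on UNIV (T f)}"
        unfolding closed_sequential_limits
      proof (intro allI impI)
        fix F :: "nat \<Rightarrow> 'a \<Rightarrow>\<^sub>C real" and f
        assume F: "(\<forall>n. F n \<in> {f. continuous_on UNIV (T f)}) \<and> F \<longlonglongrightarrow> f"
        have "uniform_limit UNIV (\<lambda>n. T (F n)) (T f) sequentially"
          unfolding uniform_limit_iff
        proof (intro allI impI)
          fix e :: real assume "e > 0"
          then have "eventually (\<lambda>n. dist (F n) f < e / 3) sequentially"
            using F tendstoD[of F f sequentially "e / 3"] by simp
          then show "eventually (\<lambda>n. \<forall>x\<in>UNIV. dist (T (F n) x) (T f x) < e) sequentially"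
          proof eventually_elim
            case (elim n)
            show ?case
            proof
              fix x
              show "dist (T (F n) x) (T f x) < e"
                using T_bound[of "F n - f" x] elim unfolding dist_norm T_diff real_norm_def by simp
            qed
          qed
        qed
        then have "continuous_on UNIV (T f)"
          using F by (intro uniform_limit_theorem[where F = sequentially and f = "\<lambda>n. T (F n)"]) auto
        then show "f \<in> {f. continuous_on UNIV (T f)}" by simp
      qed
      show "subspace {f. continuous_on UNIV (T f)}"
      proof -
        have "T 0 = (\<lambda>x. 0)" "T (f + g) = (\<lambda>x. T f x + T g x)" "T (k *\<^sub>R f) = (\<lambda>x. k * T f x)" for f g k
          unfolding T_def by (auto simp: algebra_simps fun_eq_iff)
        then show ?thesis
          unfolding subspace_def by (auto intro: continuous_on_add continuous_on_mult_left)
      qed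
      show "chi ` cutsets \<subseteq> {f. continuous_on UNIV (T f)}"
      proof clarify
        fix D :: "'a set" assume "D \<in> cutsets"
        then have "T (chi D) = apply_bcontfun (chi (t D))" using T_chi by auto
        then show "continuous_on UNIV (T (chi D))" by simp
      qed
    qed
    then show ?thesis using gen_cutsets by blast
  qed
  define P where "P f = Bcontfun (T f)" for f
  have P: "apply_bcontfun (P f) x = T f x" for f x
  proof -
    have "T f \<in> bcontfun"
      using cont T_bound[of f] by (intro bcontfun_normI) auto
    then show ?thesis unfolding P_def by (simp add: Bcontfun_inverse)
  qed
  have bound: "norm (P f) \<le> norm f * 3" for f
    by (rule norm_bound) (use T_bound[of f] in \<open>simp add: P mult.commute\<close>)
  have "bounded_linear P"
  proof (rule bounded_linear_intro[OF _ _ bound])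
    show "P (f + g) = P f + P g" for f g
      by (rule bcontfun_eqI) (simp add: P T_def)
    show "P (r *\<^sub>R f) = r *\<^sub>R P f" for r f
      by (rule bcontfun_eqI) (simp add: P T_def algebra_simps)
  qed
  moreover have "onorm P \<le> 3"
    using bound by (intro onorm_bound) (auto simp: mult.commute)
  moreover have "onorm P \<le> 1" if "b = c"
  proof -
    have "norm (P f) \<le> norm f" for f
      by (rule norm_bound) (use T_bound1[OF that, of f] in \<open>simp add: P\<close>)
    then show ?thesis by (intro onorm_bound) auto
  qed
  moreover have "P (chi D) = chi (t D)" if "D \<in> cutsets" for D
    by (rule bcontfun_eqI) (simp add: P T_chi[OF that])
  ultimately show ?thesis by blast
qed

text \<open>Range and compatibility are checked on generators: \<open>tau\<close> maps into
  \<open>A\<close>, fixes the members of \<open>A\<close> and satisfies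
  \<open>tau_tau\<close>.\<close>

lemma skeleton_of_good_family:
  fixes U V :: "'a \<Rightarrow> 'a set"
  assumes UV: "separators U V" and \<Sigma>: "sigma_cofinal \<Sigma>" "\<And>A. A \<in> \<Sigma> \<Longrightarrow> good U V A"
  shows "has_projectional_skeleton TYPE('a \<Rightarrow>\<^sub>C real) 3"
    and "(M_points :: 'a set) = {} \<Longrightarrow> has_projectional_skeleton TYPE('a \<Rightarrow>\<^sub>C real) 1"
proof -
  have ex: "\<exists>P :: ('a \<Rightarrow>\<^sub>C real) \<Rightarrow> ('a \<Rightarrow>\<^sub>C real). bounded_linear P \<and> onorm P \<le> 3 \<and>
    ((M_points :: 'a set) = {} \<longrightarrow> onorm P \<le> 1) \<and> (\<forall>D\<in>cutsets. P (chi D) = chi (tau U V A D))"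
    if "A \<in> \<Sigma>" for A
  proof -
    interpret A: good_cuts "TYPE('a)" U V A
      by (rule good_cutsI[OF UV \<Sigma>(2)[OF that]])
    have tau_cut: "tau U V A D \<in> cutsets" if "D \<in> cutsets" for D
      using A.A_cutsets A.tau_mem[OF that] by (rule subsetD)
    have "corr_pos U V A = corr_neg U V A" if "(M_points :: 'a set) = {}"
    proof
      fix x
      have "\<not> Ex (corr U V A x)" using that by (auto simp: corr_def)
      then show "corr_pos U V A x = corr_neg U V A x" by (rule A.corr_neg_no[symmetric])
    qed
    then show ?thesis
      using evaluation_operator[OF A.evaluation_identity tau_cut] by blast
  qed
  obtain P :: "'a set set \<Rightarrow> ('a \<Rightarrow>\<^sub>C real) \<Rightarrow> ('a \<Rightarrow>\<^sub>C real)" where P: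
    "\<And>A. A \<in> \<Sigma> \<Longrightarrow> bounded_linear (P A) \<and> onorm (P A) \<le> 3 \<and>
      ((M_points :: 'a set) = {} \<longrightarrow> onorm (P A) \<le> 1) \<and> (\<forall>D\<in>cutsets. P A (chi D) = chi (tau U V A D))"
    using ex by metis
  have mem: "P A f \<in> gen A" if "A \<in> \<Sigma>" for A f
  proof -
    interpret A: good_cuts "TYPE('a)" U V A
      by (rule good_cutsI[OF UV \<Sigma>(2)[OF that]])
    have lin: "bounded_linear (P A)" and chi: "\<And>D. D \<in> cutsets \<Longrightarrow> P A (chi D) = chi (tau U V A D)"
      using P[OF \<open>A \<in> \<Sigma>\<close>] by simp_all
    show ?thesis
    proof (rule bounded_linear_in_gen[OF lin])
      show "f \<in> gen cutsets" using gen_cutsets by simp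
      show "P A (chi D) \<in> gen A" if "D \<in> cutsets" for D
        unfolding chi[OF that] by (rule chi_in_gen[OF A.tau_mem[OF that]])
    qed
  qed
  have fix_gen: "P A f = f" if "A \<in> \<Sigma>" "f \<in> gen A" for A f
  proof (rule bounded_linear_eq_on_gen[OF _ bounded_linear_ident _ that(2)])
    show "bounded_linear (P A)" using P that by blast
    fix D assume D: "D \<in> A"
    then have "D \<in> cutsets" using sigma_cofinalD(2)[OF \<Sigma>(1) that(1)] by blast
    then show "P A (chi D) = chi D" using P[OF that(1)] D by (simp add: tau_def)
  qed
  have comp: "P A (P B f) = P A f" if "A \<in> \<Sigma>" "B \<in> \<Sigma>" "A \<subseteq> B" for A B f
  proof (rule bounded_linear_eq_on_gen[of "\<lambda>f. P A (P B f)" "P A" cutsets])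
    show "bounded_linear (\<lambda>f. P A (P B f))"
      using P[OF that(1)] P[OF that(2)] by (intro bounded_linear_compose[of "P A" "P B"]) auto
    show "bounded_linear (P A)" using P[OF that(1)] by blast
    show "f \<in> gen cutsets" using gen_cutsets by simp
    fix D :: "'a set" assume D: "D \<in> cutsets"
    interpret B: good_cuts "TYPE('a)" U V B
      by (rule good_cutsI[OF UV \<Sigma>(2)[OF that(2)]])
    have "tau U V B D \<in> cutsets" using B.A_cutsets B.tau_mem[OF D] by (rule subsetD)
    then show "P A (P B (chi D)) = P A (chi D)"
      using P[OF that(1)] P[OF that(2)] D tau_tau[OF UV \<Sigma>(2)[OF that(1)] \<Sigma>(2)[OF that(2)] that(3) D]
      by simp
  qed
  have sub_iff: "gen A \<subseteq> gen B \<longleftrightarrow> A \<subseteq> B" if "A \<in> \<Sigma>" "B \<in> \<Sigma>" for A B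
    by (rule gen_subset_iff) (use sigma_cofinalD(2-4)[OF \<Sigma>(1)] that in auto)
  have inj: "inj_on gen \<Sigma>"
    by (rule inj_onI) (metis sub_iff order_refl subset_antisym)
  \<comment> \<open>The projections were obtained for families; injectivity of \<open>gen\<close>
    allows them to be indexed by subspaces.\<close>
  define Q where "Q S = P (inv_into \<Sigma> gen S)" for S
  have Q: "Q (gen A) = P A" if "A \<in> \<Sigma>" for A
    unfolding Q_def using inv_into_f_f[OF inj that] by simp
  have skel: "projectional_skeleton (gen ` \<Sigma>) Q"
    unfolding projectional_skeleton_def
  proof (intro conjI ballI impI)
    show "closed_cofinal (gen ` \<Sigma>)" by (rule closed_cofinal_gen[OF \<Sigma>(1)])
  next
    fix S assume "S \<in> gen ` \<Sigma>"
    then obtain A where A: "A \<in> \<Sigma>" "S = gen A" by blast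
    have "range (P A) = gen A"
      using mem[OF A(1)] fix_gen[OF A(1)] by (metis image_subset_iff rangeI subsetI subset_antisym)
    moreover have "P A \<circ> P A = P A" using mem[OF A(1)] fix_gen[OF A(1)] by auto
    ultimately show "bounded_projection_onto S (Q S)"
      unfolding bounded_projection_onto_def A(2) Q[OF A(1)] using P[OF A(1)] by blast
  next
    fix S T assume "S \<in> gen ` \<Sigma>" "T \<in> gen ` \<Sigma>" "S \<subseteq> T"
    then obtain A B where AB: "A \<in> \<Sigma>" "S = gen A" "B \<in> \<Sigma>" "T = gen B" by blast
    then have "A \<subseteq> B" using \<open>S \<subseteq> T\<close> sub_iff by blast
    then show "Q S \<circ> Q T = Q S"
      unfolding AB(2,4) Q[OF AB(1)] Q[OF AB(3)] using comp[OF AB(1,3)] by auto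
  qed
  have "onorm (Q S) \<le> 3" "(M_points :: 'a set) = {} \<Longrightarrow> onorm (Q S) \<le> 1" if "S \<in> gen ` \<Sigma>" for S
    using that P Q by auto
  then show "has_projectional_skeleton TYPE('a \<Rightarrow>\<^sub>C real) 3"
    "(M_points :: 'a set) = {} \<Longrightarrow> has_projectional_skeleton TYPE('a \<Rightarrow>\<^sub>C real) 1"
    unfolding has_projectional_skeleton_def using skel by blast+
qed

lemma countable_M_projectional_skeleton:
  assumes "countable (M_points :: 'a set)"
  shows "has_projectional_skeleton TYPE('a \<Rightarrow>\<^sub>C real) 3"
    and "(M_points :: 'a set) = {} \<Longrightarrow> has_projectional_skeleton TYPE('a \<Rightarrow>\<^sub>C real) 1"
proof -
  obtain U V :: "'a \<Rightarrow> 'a set" where UV: "separators U V" by (rule ex_separators[OF assms])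
  obtain \<Sigma> :: "'a set set set" where \<Sigma>: "sigma_cofinal \<Sigma>" "\<And>A. A \<in> \<Sigma> \<Longrightarrow> good U V A"
    using ex_good_family[OF assms UV] by metis
  show "has_projectional_skeleton TYPE('a \<Rightarrow>\<^sub>C real) 3"
    "(M_points :: 'a set) = {} \<Longrightarrow> has_projectional_skeleton TYPE('a \<Rightarrow>\<^sub>C real) 1"
    using skeleton_of_good_family[OF UV \<Sigma>] by blast+
qed

end

section \<open>Retractional skeletons\<close>

lemma homeomorphism_imp_homeomorphic_space:
  assumes "homeomorphism S T f g"
  shows "top_of_set S homeomorphic_space top_of_set T"
proof -
  have "homeomorphic_maps (top_of_set S) (top_of_set T) f g"
    using assms unfolding homeomorphic_maps_def homeomorphism_def
    by (auto simp: continuous_map_iff_continuous2)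
  then show ?thesis unfolding homeomorphic_space_def by blast
qed

text \<open>A continuous injection of a compact space into a Hausdorff space is an
  embedding.\<close>

lemma compact_metrizableI:
  fixes g :: "'a::topological_space \<Rightarrow> 'b::metric_space"
  assumes "compact S" "continuous_on S g" "inj_on g S"
  shows "metrizable_space (top_of_set S)"
proof -
  obtain h where "homeomorphism S (g ` S) g h"
    using homeomorphism_compact[OF assms(1,2) refl assms(3)] by blast
  then have "top_of_set S homeomorphic_space top_of_set (g ` S)"
    by (rule homeomorphism_imp_homeomorphic_space)
  moreover have "metrizable_space (top_of_set (g ` S))"
    by (intro metrizable_space_subtopology metrizable_space_euclidean)
  ultimately show ?thesis using homeomorphic_metrizable_space by blast
qed

context good_cuts
begin

text \<open>Nothing is corrected here, so \<open>rep A\<close> pulls \<open>D\<close> back to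
  \<open>tau U V A D\<close>; continuity and the identities between retractions are read off from
  this.\<close>

lemma rep_iff:
  assumes "(M_points :: 'a set) = {}" "D \<in> cutsets"
  shows "rep A x \<in> D \<longleftrightarrow> x \<in> tau U V A D"
proof (cases "D \<in> A")
  case True
  then show ?thesis using cut_classD[OF rep_in_class True] tau_in[OF True] by simp
next
  case False
  then show ?thesis using rep_no_point[OF assms(2) False] assms(1) by simp
qed

lemma continuous_rep:
  assumes "(M_points :: 'a set) = {}"
  shows "continuous_on UNIV (rep A)"
proof (rule continuous_cutsetsI)
  fix D :: "'a set" assume D: "D \<in> cutsets"
  have "rep A -` D = tau U V A D" using rep_iff[OF assms D] by blast
  then show "rep A -` D \<in> cutsets" using subsetD[OF A_cutsets tau_mem[OF D]] by simp
qed

text \<open>The indicators of the countably many members of \<open>A\<close> map the line into a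
  countable product of reals. On the range of \<open>rep A\<close> this map is injective, as each
  class has one representative.\<close>

lemma metrizable_range_rep:
  assumes M: "(M_points :: 'a set) = {}" and count: "countable A"
  shows "metrizable_space (top_of_set (range (rep A)))"
proof -
  have ne: "A \<noteq> {}" using goodD(2)[OF good] by blast
  define g :: "'a \<Rightarrow> nat \<Rightarrow> real" where "g x n = indicator (from_nat_into A n) x" for x n
  have cont: "continuous_on UNIV g"
  proof (rule continuous_on_coordinatewise_then_product)
    fix n
    have "from_nat_into A n \<in> cutsets" using subsetD[OF A_cutsets from_nat_into[OF ne]] .
    then have "(\<lambda>x. g x n) = apply_bcontfun (chi (from_nat_into A n))"
      by (auto simp: g_def chi_cutset_apply)
    then show "continuous_on UNIV (\<lambda>x. g x n)" by (metis continuous_on_apply_bcontfun)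
  qed
  have inj: "inj_on g (range (rep A))"
  proof (rule inj_onI)
    fix x y assume x: "x \<in> range (rep A)" and y: "y \<in> range (rep A)" and xy: "g x = g y"
    obtain x' y' where x': "x = rep A x'" "y = rep A y'" using x y by blast
    have same: "x \<in> E \<longleftrightarrow> y \<in> E" if E: "E \<in> A" for E
    proof -
      obtain n where n: "from_nat_into A n = E" using from_nat_into_surj[OF count E] by blast
      have "g x n = g y n" using xy by simp
      then show ?thesis unfolding g_def n by (auto simp: indicator_def split: if_splits)
    qed
    have "cut_class A x = cut_class A y"
      using same unfolding cut_class_def by simp
    moreover have "cut_class A x = cut_class A x'" "cut_class A y = cut_class A y'"
      unfolding x' using cut_class_eq[OF rep_in_class] by simp_all
    ultimately have cl: "cut_class A x' = cut_class A y'" by simp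
    have "(x' \<notin> E) = (y' \<notin> E)" if "E \<in> A" for E
      using cut_classD[OF _ that, of x' y'] in_cut_class[of x' A] cl by simp
    then have "{E\<in>A. x' \<notin> E} = {E\<in>A. y' \<notin> E}" by blast
    then show "x = y" unfolding x' rep_def cl by simp
  qed
  have "compact (range (rep A))"
    by (rule compact_continuous_image[OF continuous_rep[OF M] compact_K])
  then show ?thesis
    by (rule compact_metrizableI[OF _ continuous_on_subset[OF cont] inj]) simp
qed

end

context scattered_compact_line
begin

lemma cutsets_separate:
  fixes x y :: 'a
  assumes "\<And>D. D \<in> cutsets \<Longrightarrow> x \<in> D \<longleftrightarrow> y \<in> D"
  shows "x = y"
proof (rule ccontr)
  assume "x \<noteq> y"
  then consider "x < y" | "y < x" by (meson neqE)
  then show False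
  proof cases
    case 1
    then obtain D where "D \<in> cutsets" "x \<in> D" "y \<notin> D" by (rule cut_between)
    then show False using assms by blast
  next
    case 2
    then obtain D where "D \<in> cutsets" "y \<in> D" "x \<notin> D" by (rule cut_between)
    then show False using assms by blast
  qed
qed

lemma retractional_skeleton_of_good_family:
  fixes U V :: "'a \<Rightarrow> 'a set"
  assumes M: "(M_points :: 'a set) = {}" and UV: "separators U V"
    and \<Sigma>: "sigma_cofinal \<Sigma>" "\<And>A. A \<in> \<Sigma> \<Longrightarrow> good U V A"
  shows "has_retractional_skeleton TYPE('a set) TYPE('a)"
proof -
  \<comment> \<open>Families are recorded by the last points of their nonempty members, so that the
    indices are sets of points, as the index type demands; \<open>fam\<close> puts back
    \<open>{}\<close>, which every family contains.\<close>
  define pts :: "'a set set \<Rightarrow> 'a set" where "pts A = {x. {..x} \<in> A}" for A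
  define fam :: "'a set \<Rightarrow> 'a set set" where "fam s = insert {} (atMost ` s)" for s
  have fam_pts: "fam (pts A) = A" if "A \<in> \<Sigma>" for A
  proof (intro set_eqI iffI)
    fix D assume "D \<in> fam (pts A)"
    then show "D \<in> A" using sigma_cofinalD(3)[OF \<Sigma>(1) that] unfolding fam_def pts_def by auto
  next
    fix D assume D: "D \<in> A"
    have cut: "D \<in> cutsets" using sigma_cofinalD(2)[OF \<Sigma>(1) that] D by (rule subsetD)
    show "D \<in> fam (pts A)"
    proof (cases "D = {}")
      case True
      then show ?thesis by (simp add: fam_def)
    next
      case False
      obtain m where "D = {..m}" using cutset_eq_atMost[OF cut False] by blast
      then show ?thesis using D unfolding fam_def pts_def by blast
    qed
  qed
  have fam_mono: "fam s \<subseteq> fam t" if "s \<subseteq> t" for s t using that unfolding fam_def by blast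
  define I where "I = pts ` \<Sigma>"
  have famI: "fam s \<in> \<Sigma>" "pts (fam s) = s" if "s \<in> I" for s
    using that fam_pts unfolding I_def by auto
  have ptsI: "pts A \<in> I" if "A \<in> \<Sigma>" for A using that unfolding I_def by (rule imageI)
  define R where "R = {(s, t). s \<in> I \<and> t \<in> I \<and> s \<subseteq> t}"
  have R: "(s, t) \<in> R \<longleftrightarrow> s \<in> I \<and> t \<in> I \<and> s \<subseteq> t" for s t by (simp add: R_def)
  define r where "r s = rep (fam s)" for s
  have gc: "good_cuts U V (fam s)" if "s \<in> I" for s
    by (rule good_cutsI[OF UV \<Sigma>(2)[OF famI(1)[OF that]]])
  have r_iff: "r s x \<in> D \<longleftrightarrow> x \<in> tau U V (fam s) D" if "s \<in> I" "D \<in> cutsets" for s x D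
    unfolding r_def by (rule good_cuts.rep_iff[OF gc[OF that(1)] M that(2)])
  have tau_mem: "tau U V (fam s) D \<in> fam s" "tau U V (fam s) D \<in> cutsets" if "s \<in> I" "D \<in> cutsets" for s D
  proof -
    show "tau U V (fam s) D \<in> fam s" by (rule good_cuts.tau_mem[OF gc[OF that(1)] that(2)])
    then show "tau U V (fam s) D \<in> cutsets"
      using sigma_cofinalD(2)[OF \<Sigma>(1) famI(1)[OF that(1)]] by (rule subsetD[rotated])
  qed
  have tau_id: "tau U V (fam s) D = D" if "D \<in> fam s" for s D using that by (simp add: tau_def)
  have comp: "r s (r t x) = r s x" "r t (r s x) = r s x" if "s \<in> I" "t \<in> I" "s \<subseteq> t" for s t x
  proof -
    show "r s (r t x) = r s x"
    proof (rule cutsets_separate)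
      fix D :: "'a set" assume D: "D \<in> cutsets"
      have "tau U V (fam t) (tau U V (fam s) D) = tau U V (fam s) D"
        using fam_mono[OF that(3)] tau_mem(1)[OF that(1) D] by (intro tau_id) blast
      then show "r s (r t x) \<in> D \<longleftrightarrow> r s x \<in> D"
        using r_iff[OF that(1) D] r_iff[OF that(2) tau_mem(2)[OF that(1) D]] by simp
    qed
    show "r t (r s x) = r s x"
    proof (rule cutsets_separate)
      fix D :: "'a set" assume D: "D \<in> cutsets"
      have "tau U V (fam s) (tau U V (fam t) D) = tau U V (fam s) D"
        by (rule tau_tau[OF UV \<Sigma>(2)[OF famI(1)[OF that(1)]] \<Sigma>(2)[OF famI(1)[OF that(2)]]
              fam_mono[OF that(3)] D])
      then show "r t (r s x) \<in> D \<longleftrightarrow> r s x \<in> D"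
        using r_iff[OF that(2) D] r_iff[OF that(1) tau_mem(2)[OF that(2) D]] r_iff[OF that(1) D] by simp
    qed
  qed
  have upper: "\<exists>u\<in>I. C \<subseteq> fam u" if C: "countable C" "C \<subseteq> cutsets" for C
  proof -
    obtain A where A: "A \<in> \<Sigma>" "C \<subseteq> A" using sigma_cofinalD(5)[OF \<Sigma>(1) C] by blast
    show ?thesis using ptsI[OF A(1)] A(2) fam_pts[OF A(1)] by (intro bexI[of _ "pts A"]) simp_all
  qed
  have sub_iff: "s \<subseteq> t \<longleftrightarrow> fam s \<subseteq> fam t" if "s \<in> I" "t \<in> I" for s t
  proof
    assume "fam s \<subseteq> fam t"
    then have "pts (fam s) \<subseteq> pts (fam t)" unfolding pts_def by blast
    then show "s \<subseteq> t" using famI(2) that by simp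
  qed (rule fam_mono)
  have "retractional_skeleton I R r"
    unfolding retractional_skeleton_def
  proof (intro conjI ballI allI impI)
    show "partial_order_on I R"
      unfolding partial_order_on_def preorder_on_def refl_on_def trans_def antisym_def R_def by auto
    show "up_directed_on I R"
      unfolding up_directed_on_def
    proof (intro conjI ballI)
      show "I \<noteq> {}" using upper[of "{}"] by auto
      fix s t assume st: "s \<in> I" "t \<in> I"
      have "countable (fam s \<union> fam t)" "fam s \<union> fam t \<subseteq> cutsets"
        using sigma_cofinalD(1,2)[OF \<Sigma>(1)] famI(1) st by auto
      then obtain u where "u \<in> I" "fam s \<union> fam t \<subseteq> fam u" using upper by blast
      then show "\<exists>u\<in>I. (s, u) \<in> R \<and> (t, u) \<in> R"
        using st sub_iff by (intro bexI[of _ u]) (auto simp: R)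
    qed
  next
    fix s assume s: "s \<in> I"
    show "retraction UNIV (range (r s)) (r s)"
      unfolding retraction_def r_def[symmetric]
      using good_cuts.continuous_rep[OF gc[OF s] M] comp(1)[OF s s order_refl] by (auto simp: r_def)
    show "metrizable_space (top_of_set (range (r s)))"
      unfolding r_def
      by (rule good_cuts.metrizable_range_rep[OF gc[OF s] M sigma_cofinalD(1)[OF \<Sigma>(1) famI(1)[OF s]]])
  next
    fix s t assume st: "s \<in> I" "t \<in> I" "(s, t) \<in> R"
    then show "r s \<circ> r t = r s" "r t \<circ> r s = r s" using comp by (auto simp: R)
  next
    fix \<sigma> :: "nat \<Rightarrow> 'a set" assume \<sigma>: "range \<sigma> \<subseteq> I \<and> (\<forall>n. (\<sigma> n, \<sigma> (Suc n)) \<in> R)"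
    then have \<sigma>I: "\<sigma> n \<in> I" for n by blast
    have inc: "incseq \<sigma>" using \<sigma> by (intro incseq_SucI) (auto simp: R)
    have "incseq (\<lambda>n. fam (\<sigma> n))" using inc fam_mono unfolding incseq_def by blast
    moreover have "range (\<lambda>n. fam (\<sigma> n)) \<subseteq> \<Sigma>" using famI(1)[OF \<sigma>I] by blast
    ultimately have U: "(\<Union>n. fam (\<sigma> n)) \<in> \<Sigma>" by (rule sigma_cofinalD(6)[OF \<Sigma>(1)])
    define t where "t = pts (\<Union>n. fam (\<sigma> n))"
    have tI: "t \<in> I" unfolding t_def by (rule ptsI[OF U])
    have famt: "fam t = (\<Union>n. fam (\<sigma> n))" unfolding t_def by (rule fam_pts[OF U])
    have upt: "\<sigma> n \<subseteq> t" for n using sub_iff[OF \<sigma>I tI] famt by blast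
    have "is_supremum_in I R (range \<sigma>) t"
      unfolding is_supremum_in_def
    proof (intro conjI ballI impI)
      show "t \<in> I" by (rule tI)
      show "(s, t) \<in> R" if "s \<in> range \<sigma>" for s using that upt tI \<sigma>I by (auto simp: R)
      fix u assume u: "u \<in> I" "\<forall>s\<in>range \<sigma>. (s, u) \<in> R"
      then have "fam (\<sigma> n) \<subseteq> fam u" for n using fam_mono by (auto simp: R)
      then have "fam t \<subseteq> fam u" unfolding famt by blast
      then show "(t, u) \<in> R" using sub_iff[OF tI u(1)] tI u(1) by (simp add: R)
    qed
    moreover have "(\<lambda>n. r (\<sigma> n) x) \<longlonglongrightarrow> r t x" for x
    proof (rule tendsto_cutsetsI)
      fix D :: "'a set" assume D: "D \<in> cutsets"
      \<comment> \<open>The cutset that \<open>r t\<close> pulls \<open>D\<close> back to already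
        belongs to some \<open>fam (\<sigma> N)\<close>. From \<open>N\<close> on every retraction
        respects it, so membership in \<open>D\<close> is eventually constant.\<close>
      obtain N where N: "tau U V (fam t) D \<in> fam (\<sigma> N)"
        using tau_mem(1)[OF tI D] unfolding famt by blast
      have "r (\<sigma> n) x \<in> D \<longleftrightarrow> r t x \<in> D" if "N \<le> n" for n
      proof -
        have "fam (\<sigma> N) \<subseteq> fam (\<sigma> n)" using incseqD[OF inc that] by (rule fam_mono)
        then have "tau U V (fam (\<sigma> n)) (tau U V (fam t) D) = tau U V (fam t) D"
          using N by (intro tau_id) blast
        then have "r (\<sigma> n) x \<in> tau U V (fam t) D \<longleftrightarrow> x \<in> tau U V (fam t) D"
          using r_iff[OF \<sigma>I tau_mem(2)[OF tI D]] by simp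
        moreover have "r t (r (\<sigma> n) x) = r (\<sigma> n) x" using comp(2)[OF \<sigma>I tI upt] .
        ultimately show ?thesis using r_iff[OF tI D, of "r (\<sigma> n) x"] r_iff[OF tI D, of x] by simp
      qed
      then show "eventually (\<lambda>n. r (\<sigma> n) x \<in> D \<longleftrightarrow> r t x \<in> D) sequentially"
        by (rule eventually_sequentiallyI)
    qed
    ultimately show "\<exists>t. is_supremum_in I R (range \<sigma>) t \<and> (\<forall>x. (\<lambda>n. r (\<sigma> n) x) \<longlonglongrightarrow> r t x)"
      by blast
  next
    fix x
    show "((\<lambda>s. r s x) \<longlongrightarrow> x) (tails_filter I R)"
    proof (rule tendsto_cutsetsI)
      fix D :: "'a set" assume D: "D \<in> cutsets"
      obtain u where u: "u \<in> I" "D \<in> fam u" using upper[of "{D}"] D by auto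
      have "r s x \<in> D \<longleftrightarrow> x \<in> D" if "(u, s) \<in> R" for s
      proof -
        have "D \<in> fam s" "s \<in> I" using that u(2) fam_mono by (auto simp: R)
        then show ?thesis using r_iff[OF _ D, of s x] tau_id by simp
      qed
      then show "eventually (\<lambda>s. r s x \<in> D \<longleftrightarrow> x \<in> D) (tails_filter I R)"
        unfolding tails_filter_def
        by (intro eventually_INF1[OF u(1)]) (simp add: eventually_principal)
    qed
  qed
  then show ?thesis unfolding has_retractional_skeleton_def by blast
qed

lemma no_M_retractional_skeleton:
  assumes "(M_points :: 'a set) = {}"
  shows "has_retractional_skeleton TYPE('a set) TYPE('a)"
proof -
  have count: "countable (M_points :: 'a set)" using assms by simp
  obtain U V :: "'a \<Rightarrow> 'a set" where UV: "separators U V" by (rule ex_separators[OF count])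
  obtain \<Sigma> :: "'a set set set" where \<Sigma>: "sigma_cofinal \<Sigma>" "\<And>A. A \<in> \<Sigma> \<Longrightarrow> good U V A"
    using ex_good_family[OF count UV] by metis
  show ?thesis by (rule retractional_skeleton_of_good_family[OF assms UV \<Sigma>])
qed

end

section \<open>A retractional skeleton excludes points of M(K)\<close>

lemma retractional_skeletonD:
  assumes "retractional_skeleton \<Sigma> R r"
  shows "trans R" "s \<in> \<Sigma> \<Longrightarrow> (s, s) \<in> R" "\<Sigma> \<noteq> {}"
    "s \<in> \<Sigma> \<Longrightarrow> t \<in> \<Sigma> \<Longrightarrow> \<exists>u\<in>\<Sigma>. (s, u) \<in> R \<and> (t, u) \<in> R"
    "s \<in> \<Sigma> \<Longrightarrow> continuous_on UNIV (r s)"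
    "s \<in> \<Sigma> \<Longrightarrow> metrizable_space (top_of_set (range (r s)))"
    "s \<in> \<Sigma> \<Longrightarrow> t \<in> \<Sigma> \<Longrightarrow> (s, t) \<in> R \<Longrightarrow> r t (r s x) = r s x"
    "range \<sigma> \<subseteq> \<Sigma> \<Longrightarrow> (\<And>n. (\<sigma> n, \<sigma> (Suc n)) \<in> R) \<Longrightarrow>
       \<exists>t\<in>\<Sigma>. (\<forall>n. (\<sigma> n, t) \<in> R) \<and> (\<forall>x. (\<lambda>n. r (\<sigma> n) x) \<longlonglongrightarrow> r t x)"
    "((\<lambda>s. r s x) \<longlongrightarrow> x) (tails_filter \<Sigma> R)"
proof -
  note sk = assms[unfolded retractional_skeleton_def]
  show "trans R" "s \<in> \<Sigma> \<Longrightarrow> (s, s) \<in> R"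
    using sk unfolding partial_order_on_def preorder_on_def refl_on_def by blast+
  show "\<Sigma> \<noteq> {}" "s \<in> \<Sigma> \<Longrightarrow> t \<in> \<Sigma> \<Longrightarrow> \<exists>u\<in>\<Sigma>. (s, u) \<in> R \<and> (t, u) \<in> R"
    using sk unfolding up_directed_on_def by blast+
  show "s \<in> \<Sigma> \<Longrightarrow> continuous_on UNIV (r s)"
    using sk unfolding retraction_def by blast
  show "s \<in> \<Sigma> \<Longrightarrow> metrizable_space (top_of_set (range (r s)))"
    using sk by blast
  show "s \<in> \<Sigma> \<Longrightarrow> t \<in> \<Sigma> \<Longrightarrow> (s, t) \<in> R \<Longrightarrow> r t (r s x) = r s x"
    using sk by (metis comp_apply)
  show "range \<sigma> \<subseteq> \<Sigma> \<Longrightarrow> (\<And>n. (\<sigma> n, \<sigma> (Suc n)) \<in> R) \<Longrightarrow>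
       \<exists>t\<in>\<Sigma>. (\<forall>n. (\<sigma> n, t) \<in> R) \<and> (\<forall>x. (\<lambda>n. r (\<sigma> n) x) \<longlonglongrightarrow> r t x)"
  proof -
    assume "range \<sigma> \<subseteq> \<Sigma>" "\<And>n. (\<sigma> n, \<sigma> (Suc n)) \<in> R"
    then obtain t where "is_supremum_in \<Sigma> R (range \<sigma>) t" "\<forall>x. (\<lambda>n. r (\<sigma> n) x) \<longlonglongrightarrow> r t x"
      using sk by meson
    then show ?thesis unfolding is_supremum_in_def by (intro bexI[of _ t]) auto
  qed
  show "((\<lambda>s. r s x) \<longlongrightarrow> x) (tails_filter \<Sigma> R)" using sk by blast
qed

lemma eventually_tails_filter:
  assumes "retractional_skeleton \<Sigma> R r"
  shows "eventually P (tails_filter \<Sigma> R) \<longleftrightarrow> (\<exists>s\<in>\<Sigma>. \<forall>t\<in>\<Sigma>. (s, t) \<in> R \<longrightarrow> P t)"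
proof -
  note sk = retractional_skeletonD[OF assms]
  have "eventually P (tails_filter \<Sigma> R) \<longleftrightarrow>
      (\<exists>s\<in>\<Sigma>. eventually P (principal {t\<in>\<Sigma>. (s, t) \<in> R}))"
    unfolding tails_filter_def
  proof (rule eventually_INF_base[OF sk(3)])
    fix s t assume "s \<in> \<Sigma>" "t \<in> \<Sigma>"
    then obtain u where u: "u \<in> \<Sigma>" "(s, u) \<in> R" "(t, u) \<in> R" using sk(4) by blast
    have "{v\<in>\<Sigma>. (u, v) \<in> R} \<subseteq> {v\<in>\<Sigma>. (s, v) \<in> R} \<inter> {v\<in>\<Sigma>. (t, v) \<in> R}"
      using transD[OF sk(1) u(2)] transD[OF sk(1) u(3)] by blast
    then show "\<exists>u\<in>\<Sigma>. principal {v\<in>\<Sigma>. (u, v) \<in> R}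
        \<le> inf (principal {v\<in>\<Sigma>. (s, v) \<in> R}) (principal {v\<in>\<Sigma>. (t, v) \<in> R})"
      using u(1) by (intro bexI[of _ u]) simp_all
  qed
  then show ?thesis unfolding eventually_principal by blast
qed

text \<open>Convergence to an isolated point means being eventually equal to it.\<close>

lemma isolated_eventually_fixed:
  assumes "retractional_skeleton \<Sigma> R r" "open {x}"
  shows "\<exists>s\<in>\<Sigma>. \<forall>t\<in>\<Sigma>. (s, t) \<in> R \<longrightarrow> r t x = x"
proof -
  have "eventually (\<lambda>s. r s x \<in> {x}) (tails_filter \<Sigma> R)"
    by (rule topological_tendstoD[OF retractional_skeletonD(9)[OF assms(1)] assms(2)]) simp
  then show ?thesis unfolding eventually_tails_filter[OF assms(1)] by simp
qed

lemma metrizable_countable_base: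
  assumes "metrizable_space (top_of_set X)" "p \<in> X"
  obtains \<W> where "countable \<W>" "\<And>W. W \<in> \<W> \<Longrightarrow> open W \<and> p \<in> W"
    "\<And>U. open U \<Longrightarrow> p \<in> U \<Longrightarrow> \<exists>W\<in>\<W>. X \<inter> W \<subseteq> U"
proof -
  obtain \<B> where B: "countable \<B>" "\<forall>V\<in>\<B>. openin (top_of_set X) V"
    "\<forall>U. openin (top_of_set X) U \<and> p \<in> U \<longrightarrow> (\<exists>V\<in>\<B>. p \<in> V \<and> V \<subseteq> U)"
    using metrizable_imp_first_countable[OF assms(1)] assms(2) unfolding first_countable_def by auto
  have "\<forall>V\<in>\<B>. \<exists>W. open W \<and> V = X \<inter> W" using B(2) by (auto simp: openin_open)
  then obtain w where w: "\<And>V. V \<in> \<B> \<Longrightarrow> open (w V) \<and> V = X \<inter> w V" by metis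
  show ?thesis
  proof (rule that[of "w ` {V\<in>\<B>. p \<in> V}"])
    show "countable (w ` {V\<in>\<B>. p \<in> V})" using B(1) by (intro countable_image) (rule countable_subset[rotated], auto)
    show "open W \<and> p \<in> W" if "W \<in> w ` {V\<in>\<B>. p \<in> V}" for W using that w by blast
    fix U assume U: "open U" "p \<in> U"
    then have "openin (top_of_set X) (X \<inter> U) \<and> p \<in> X \<inter> U" using assms(2) by (auto simp: openin_open)
    then obtain V where "V \<in> \<B>" "p \<in> V" "V \<subseteq> X \<inter> U" using B(3) by blast
    then show "\<exists>W\<in>w ` {V\<in>\<B>. p \<in> V}. X \<inter> W \<subseteq> U" using w[of V] by (intro bexI[of _ "w V"]) auto
  qed
qed

text \<open>The relation is a parameter, so that reversing the order turns right cofinality into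
  left cofinality.\<close>

definition unc :: "('a \<Rightarrow> 'a \<Rightarrow> bool) \<Rightarrow> 'a \<Rightarrow> bool" where
  "unc lt p \<longleftrightarrow> (\<forall>C. countable C \<and> C \<subseteq> {x. lt x p} \<longrightarrow> (\<exists>z. lt z p \<and> (\<forall>c\<in>C. lt c z)))"

lemma left_unc_unc: "left_unc p \<longleftrightarrow> unc (<) p"
  and right_unc_unc: "right_unc p \<longleftrightarrow> unc (>) p"
  by (auto simp: left_unc_def right_unc_def unc_def lessThan_def greaterThan_def)

text \<open>The order or its reverse, so that each argument below is carried out on one side only.\<close>

locale oriented_line = scattered_compact_line K for K :: "'a::linorder_topology itself" +
  fixes lt :: "'a \<Rightarrow> 'a \<Rightarrow> bool" (infix \<open>\<sqsubset>\<close> 50)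
  assumes orientation: "lt = (<) \<or> lt = (>)"
begin

abbreviation "open_ival c p \<equiv> {y. c \<sqsubset> y \<and> y \<sqsubset> p}"
abbreviation "ival c p \<equiv> {y. c \<sqsubset> y \<and> (y \<sqsubset> p \<or> y = p)}"

lemma lt_irrefl: "\<not> x \<sqsubset> x"
  and lt_asym: "x \<sqsubset> y \<Longrightarrow> \<not> y \<sqsubset> x"
  and lt_trans: "x \<sqsubset> y \<Longrightarrow> y \<sqsubset> z \<Longrightarrow> x \<sqsubset> z"
  and not_lt_trans: "\<not> y \<sqsubset> x \<Longrightarrow> y \<sqsubset> z \<Longrightarrow> x \<sqsubset> z"
  and lt_total: "x \<sqsubset> y \<or> x = y \<or> y \<sqsubset> x"
  using orientation by auto

lemma open_gt: "open {y. c \<sqsubset> y}" and open_lt: "open {y. y \<sqsubset> c}"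
  using orientation by (auto simp flip: lessThan_def greaterThan_def)

lemma open_ival_open: "open (open_ival c p)"
  using open_Int[OF open_gt open_lt, of c p] by (simp add: Collect_conj_eq)

lemma open_near:
  assumes "open S" "p \<in> S" "b \<sqsubset> p"
  shows "\<exists>c. c \<sqsubset> p \<and> ival c p \<subseteq> S"
  using orientation
proof
  assume lt: "lt = (<)"
  then obtain c where "c < p" "{c<..p} \<subseteq> S" using open_left[OF assms(1,2)] assms(3) by blast
  then show ?thesis unfolding lt by (intro exI[of _ c]) auto
next
  assume lt: "lt = (>)"
  then obtain c where "p < c" "{p..<c} \<subseteq> S" using open_right[OF assms(1,2)] assms(3) by blast
  then show ?thesis unfolding lt by (intro exI[of _ c]) auto
qed

lemma closed_has_top:
  assumes "closed C" "C \<noteq> {}"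
  shows "\<exists>m\<in>C. \<forall>x\<in>C. \<not> m \<sqsubset> x"
  using orientation
proof
  assume lt: "lt = (<)"
  obtain m where "m \<in> C" "\<And>x. x \<in> C \<Longrightarrow> x \<le> m" using closed_has_max[OF assms] by metis
  then show ?thesis unfolding lt by (metis not_le)
next
  assume lt: "lt = (>)"
  obtain m where "m \<in> C" "\<And>x. x \<in> C \<Longrightarrow> m \<le> x" using closed_has_min[OF assms] by metis
  then show ?thesis unfolding lt by (metis not_le)
qed

lemma uncD:
  "unc (\<sqsubset>) p \<Longrightarrow> countable C \<Longrightarrow> C \<subseteq> {x. x \<sqsubset> p} \<Longrightarrow> \<exists>z. z \<sqsubset> p \<and> (\<forall>c\<in>C. c \<sqsubset> z)"
  unfolding unc_def by simp

text \<open>If \<open>p\<close> had an immediate neighbour on this side, the points from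
  \<open>p\<close> onwards would form an open set. So the open interval is nonempty and
  scatteredness supplies the point.\<close>

lemma isolated_near:
  assumes "\<not> open {x. \<not> x \<sqsubset> p}" "c \<sqsubset> p"
  obtains e where "c \<sqsubset> e" "e \<sqsubset> p" "open {e}"
proof -
  have "open_ival c p \<noteq> {}"
  proof
    assume emp: "open_ival c p = {}"
    have "c \<sqsubset> x \<longleftrightarrow> \<not> x \<sqsubset> p" for x
      using emp assms(2) not_lt_trans by blast
    then show False using assms(1) open_gt[of c] by simp
  qed
  then obtain e where "e \<in> open_ival c p" "open {e}" by (rule ex_isolated[OF open_ival_open])
  then show ?thesis by (intro that) auto
qed
text \<open>The limit is the last point of the closure of the sequence, which exists by
  compactness.\<close>

lemma monotone_limit:
  fixes a :: "nat \<Rightarrow> 'a"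
  assumes "\<And>n. a n \<sqsubset> a (Suc n)"
  obtains m where "a \<longlonglongrightarrow> m" "\<And>n. a n \<sqsubset> m" "\<And>u. (\<And>n. a n \<sqsubset> u) \<Longrightarrow> \<not> u \<sqsubset> m"
proof -
  have mono: "\<not> a n \<sqsubset> a k" if "k \<le> n" for k n
    using that
  proof (induction n rule: dec_induct)
    case (step n)
    then show ?case using assms[of n] by (meson lt_trans)
  qed (rule lt_irrefl)
  let ?C = "closure (range a)"
  have "range a \<subseteq> ?C" by (rule closure_subset)
  obtain m where m: "m \<in> ?C" "\<forall>x\<in>?C. \<not> m \<sqsubset> x"
    using closed_has_top[of ?C] by auto
  have le: "\<not> m \<sqsubset> a n" for n
    using m(2) \<open>range a \<subseteq> ?C\<close> by auto
  have lt: "a n \<sqsubset> m" for n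
    using le[of "Suc n"] assms[of n] by (metis lt_trans lt_total)
  have ex: "\<exists>n. b \<sqsubset> a n" if "b \<sqsubset> m" for b
  proof (rule ccontr)
    assume neg: "\<not> ?thesis"
    then have "range a \<subseteq> - {y. b \<sqsubset> y}" by auto
    then have "?C \<subseteq> - {y. b \<sqsubset> y}" by (rule closure_minimal) (simp add: closed_Compl open_gt)
    then show False using m(1) that by auto
  qed
  have "a \<longlonglongrightarrow> m"
  proof (rule topological_tendstoI)
    fix S assume S: "open S" "m \<in> S"
    then obtain b where b: "b \<sqsubset> m" "ival b m \<subseteq> S" using open_near[OF S lt[of 0]] by blast
    obtain N where N: "b \<sqsubset> a N" using ex[OF b(1)] by blast
    show "eventually (\<lambda>n. a n \<in> S) sequentially"
    proof (rule eventually_sequentiallyI)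
      fix n assume "N \<le> n"
      then have "b \<sqsubset> a n" using mono N by (metis lt_trans lt_total)
      then have "a n \<in> ival b m" using lt[of n] by simp
      then show "a n \<in> S" using b(2) by blast
    qed
  qed
  moreover have "\<not> u \<sqsubset> m" if "\<And>n. a n \<sqsubset> u" for u
  proof
    assume "u \<sqsubset> m"
    then obtain n where "u \<sqsubset> a n" using ex by blast
    then show False using that[of n] by (meson lt_asym)
  qed
  ultimately show ?thesis using lt that by blast
qed

text \<open>If \<open>r t p\<close> lies beyond \<open>p\<close>, continuity suffices. If
  \<open>r t p = p\<close>, then \<open>p\<close> has a countable base in the metrizable range of
  \<open>r t\<close>, and uncountable cofinality yields a \<open>z\<close> such that no point of the
  range lies between \<open>z\<close> and \<open>p\<close>. Points near \<open>p\<close> are sent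
  beyond \<open>z\<close>, hence not before \<open>p\<close>.\<close>

lemma unc_bound:
  fixes p :: 'a
  assumes sk: "retractional_skeleton \<Sigma> R r" and t: "t \<in> \<Sigma>" and p: "unc (\<sqsubset>) p" "\<not> r t p \<sqsubset> p"
  shows "\<exists>c. c \<sqsubset> p \<and> (\<forall>y. c \<sqsubset> y \<longrightarrow> y \<sqsubset> p \<longrightarrow> \<not> r t y \<sqsubset> p)"
proof -
  note skD = retractional_skeletonD[OF sk]
  obtain b where b: "b \<sqsubset> p" using uncD[OF p(1), of "{}"] by auto
  have pre: "\<exists>c. c \<sqsubset> p \<and> (\<forall>y. c \<sqsubset> y \<longrightarrow> y \<sqsubset> p \<longrightarrow> r t y \<in> S)" if S: "open S" "r t p \<in> S" for S
  proof -
    have "open (r t -` S)" using skD(5)[OF t] S(1) by (simp add: continuous_on_open_vimage)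
    then obtain c where "c \<sqsubset> p" "ival c p \<subseteq> r t -` S" using open_near[OF _ _ b, of "r t -` S"] S(2) by auto
    moreover have "y \<in> ival c p" if "c \<sqsubset> y" "y \<sqsubset> p" for y using that by simp
    ultimately have "c \<sqsubset> p \<and> (\<forall>y. c \<sqsubset> y \<longrightarrow> y \<sqsubset> p \<longrightarrow> r t y \<in> S)" by blast
    then show ?thesis ..
  qed
  show ?thesis
  proof (cases "p \<sqsubset> r t p")
    case True
    then have "r t p \<in> {y. p \<sqsubset> y}" by simp
    then obtain c where c: "c \<sqsubset> p" "\<And>y. c \<sqsubset> y \<Longrightarrow> y \<sqsubset> p \<Longrightarrow> r t y \<in> {y. p \<sqsubset> y}" using pre[OF open_gt] by metis
    have "\<not> r t y \<sqsubset> p" if "c \<sqsubset> y" "y \<sqsubset> p" for y using c(2)[OF that] lt_asym by blast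
    then show ?thesis using c(1) by blast
  next
    case False
    then have rp: "r t p = p" using p(2) lt_total by blast
    then have pX: "p \<in> range (r t)" by (metis rangeI)
    obtain \<W> where W: "countable \<W>" "\<And>W. W \<in> \<W> \<Longrightarrow> open W \<and> p \<in> W"
      "\<And>U. open U \<Longrightarrow> p \<in> U \<Longrightarrow> \<exists>W\<in>\<W>. range (r t) \<inter> W \<subseteq> U"
      by (rule metrizable_countable_base[OF skD(6)[OF t] pX]) blast
    have "\<exists>d. d \<sqsubset> p \<and> ival d p \<subseteq> W" if "W \<in> \<W>" for W
      using open_near[OF _ _ b, of W] W(2)[OF that] by blast
    then obtain d where d: "\<And>W. W \<in> \<W> \<Longrightarrow> d W \<sqsubset> p \<and> ival (d W) p \<subseteq> W" by metis
    have "countable (d ` \<W>)" "d ` \<W> \<subseteq> {x. x \<sqsubset> p}" using W(1) d by auto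
    then have "\<exists>z. z \<sqsubset> p \<and> (\<forall>c\<in>d ` \<W>. c \<sqsubset> z)" by (rule uncD[OF p(1)])
    then obtain z where z: "z \<sqsubset> p" "\<And>W. W \<in> \<W> \<Longrightarrow> d W \<sqsubset> z" by auto
    have no_range: "\<not> x \<sqsubset> p" if "x \<in> range (r t)" "z \<sqsubset> x" for x
    proof
      assume xp: "x \<sqsubset> p"
      then obtain W where WW: "W \<in> \<W>" "range (r t) \<inter> W \<subseteq> {y. x \<sqsubset> y}" using W(3)[OF open_gt, of x] by auto
      have "d W \<sqsubset> x" using z(2)[OF WW(1)] that(2) by (meson lt_trans)
      then have "x \<in> ival (d W) p" using xp by simp
      then have "x \<in> {y. x \<sqsubset> y}" using d[OF WW(1)] WW(2) that(1) by blast
      then show False using lt_irrefl by simp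
    qed
    have "r t p \<in> {y. z \<sqsubset> y}" using rp z(1) by simp
    then obtain c where c: "c \<sqsubset> p" "\<And>y. c \<sqsubset> y \<Longrightarrow> y \<sqsubset> p \<Longrightarrow> r t y \<in> {y. z \<sqsubset> y}"
      using pre[OF open_gt] by metis
    have "\<not> r t y \<sqsubset> p" if "c \<sqsubset> y" "y \<sqsubset> p" for y
      using no_range[of "r t y"] c(2)[OF that] by simp
    then show ?thesis using c(1) by blast
  qed
qed

text \<open>Otherwise the indices that do not move \<open>p\<close> backwards are cofinal, and
  \<open>unc_bound\<close> gives a threshold \<open>c t\<close> for each of them. The limit
  retraction then has to fix a point \<open>m\<close> before \<open>p\<close> and at the same time
  to be a limit of values at \<open>m\<close> that are never before \<open>p\<close>.\<close>

lemma unc_retraction: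
  fixes p :: 'a
  assumes sk: "retractional_skeleton \<Sigma> R r" and p: "unc (\<sqsubset>) p"
  shows "\<exists>s\<in>\<Sigma>. \<forall>t\<in>\<Sigma>. (s, t) \<in> R \<longrightarrow> r t p \<sqsubset> p"
proof (rule ccontr)
  note skD = retractional_skeletonD[OF sk]
  assume "\<not> ?thesis"
  then have bad: "\<exists>t\<in>\<Sigma>. (s, t) \<in> R \<and> \<not> r t p \<sqsubset> p" if "s \<in> \<Sigma>" for s using that by blast
  obtain c where c: "\<And>t. t \<in> \<Sigma> \<Longrightarrow> \<not> r t p \<sqsubset> p \<Longrightarrow> c t \<sqsubset> p"
    "\<And>t y. t \<in> \<Sigma> \<Longrightarrow> \<not> r t p \<sqsubset> p \<Longrightarrow> c t \<sqsubset> y \<Longrightarrow> y \<sqsubset> p \<Longrightarrow> \<not> r t y \<sqsubset> p"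
    using unc_bound[OF sk _ p] by metis
  define P where "P x \<longleftrightarrow> fst x \<in> \<Sigma> \<and> \<not> r (fst x) p \<sqsubset> p \<and> snd x \<sqsubset> p" for x
  \<comment> \<open>The new point lies beyond the threshold of the old index and is fixed from the
    new index on.\<close>
  define Q where "Q x y \<longleftrightarrow> (fst x, fst y) \<in> R \<and> c (fst x) \<sqsubset> snd y \<and> snd x \<sqsubset> snd y \<and>
      (\<forall>t\<in>\<Sigma>. (fst y, t) \<in> R \<longrightarrow> r t (snd y) = snd y)" for x y
  have step: "\<exists>y. P y \<and> Q x y" if "P x" for x
  proof -
    have x: "fst x \<in> \<Sigma>" "c (fst x) \<sqsubset> p" "snd x \<sqsubset> p" using that c(1) unfolding P_def by auto
    have "\<exists>z. z \<sqsubset> p \<and> (\<forall>d\<in>{c (fst x), snd x}. d \<sqsubset> z)" by (rule uncD[OF p]) (use x in auto)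
    then obtain z where z: "z \<sqsubset> p" "c (fst x) \<sqsubset> z" "snd x \<sqsubset> z" by auto
    have "open_ival (c (fst x)) p \<inter> open_ival (snd x) p \<noteq> {}" using z by auto
    then obtain a where a: "a \<in> open_ival (c (fst x)) p \<inter> open_ival (snd x) p" "open {a}"
      by (rule ex_isolated[rotated]) (auto intro: open_ival_open)
    obtain u where u: "u \<in> \<Sigma>" "\<And>t. t \<in> \<Sigma> \<Longrightarrow> (u, t) \<in> R \<Longrightarrow> r t a = a"
      using isolated_eventually_fixed[OF sk a(2)] by blast
    obtain v where v: "v \<in> \<Sigma>" "(u, v) \<in> R" "(fst x, v) \<in> R" using skD(4)[OF u(1) x(1)] by blast
    obtain w where w: "w \<in> \<Sigma>" "(v, w) \<in> R" "\<not> r w p \<sqsubset> p" using bad[OF v(1)] by blast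
    have "P (w, a)" using w a(1) by (simp add: P_def)
    moreover have "Q x (w, a)"
    proof -
      have uw: "(u, w) \<in> R" "(fst x, w) \<in> R" using transD[OF skD(1) _ w(2)] v by blast+
      have "r t a = a" if "t \<in> \<Sigma>" "(w, t) \<in> R" for t
        using u(2)[OF that(1) transD[OF skD(1) uw(1) that(2)]] .
      then show ?thesis using uw a(1) by (simp add: Q_def)
    qed
    ultimately show ?thesis by blast
  qed
  have "\<exists>x. P x"
  proof -
    obtain s where "s \<in> \<Sigma>" using skD(3) by blast
    then obtain t where "t \<in> \<Sigma>" "\<not> r t p \<sqsubset> p" using bad by blast
    then have "P (t, c t)" using c(1) by (simp add: P_def)
    then show ?thesis ..
  qed
  then obtain f where f: "\<And>n. P (f n)" "\<And>n. Q (f n) (f (Suc n))"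
    using dependent_nat_choice[of "\<lambda>_. P" "\<lambda>_. Q"] step by metis
  define s a where "s n = fst (f n)" and "a n = snd (f n)" for n
  have s: "s n \<in> \<Sigma>" "\<not> r (s n) p \<sqsubset> p" "a n \<sqsubset> p" "(s n, s (Suc n)) \<in> R" "c (s n) \<sqsubset> a (Suc n)" "a n \<sqsubset> a (Suc n)"
    "\<And>t. t \<in> \<Sigma> \<Longrightarrow> (s (Suc n), t) \<in> R \<Longrightarrow> r t (a (Suc n)) = a (Suc n)" for n
    using f(1)[of n] f(2)[of n] unfolding P_def Q_def s_def a_def by blast+
  obtain m where m: "a \<longlonglongrightarrow> m" "\<And>n. a n \<sqsubset> m" "\<And>u. (\<And>n. a n \<sqsubset> u) \<Longrightarrow> \<not> u \<sqsubset> m"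
    using monotone_limit[of a, OF s(6)] by blast
  \<comment> \<open>Uncountable cofinality keeps the limit \<open>m\<close> strictly before
    \<open>p\<close>.\<close>
  have "countable (range a)" "range a \<subseteq> {x. x \<sqsubset> p}" using s(3) by auto
  then have "\<exists>z. z \<sqsubset> p \<and> (\<forall>c\<in>range a. c \<sqsubset> z)" by (rule uncD[OF p])
  then obtain z where z: "z \<sqsubset> p" "\<And>n. a n \<sqsubset> z" by auto
  have mp: "m \<sqsubset> p" using m(3)[of z, OF z(2)] z(1) by (metis lt_trans lt_total)
  have "range s \<subseteq> \<Sigma>" using s(1) by blast
  then obtain t where t: "t \<in> \<Sigma>" "\<And>n. (s n, t) \<in> R" "\<And>x. (\<lambda>n. r (s n) x) \<longlonglongrightarrow> r t x"
    using skD(8)[of s, OF _ s(4)] by blast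
  \<comment> \<open>\<open>a 0\<close> is only a starting value that no retraction need fix, hence
    the shift by one.\<close>
  have fixed: "r t (a (Suc n)) = a (Suc n)" for n by (rule s(7)[OF t(1,2)])
  have a': "(\<lambda>n. a (Suc n)) \<longlonglongrightarrow> m" using m(1) by (rule LIMSEQ_Suc)
  have "isCont (r t) m" using skD(5)[OF t(1)] by (simp add: continuous_on_eq_continuous_at)
  then have "(\<lambda>n. r t (a (Suc n))) \<longlonglongrightarrow> r t m" using a' by (rule isCont_tendsto_compose)
  then have rm: "r t m = m" unfolding fixed using a' by (rule LIMSEQ_unique)
  have nl: "\<not> r (s n) m \<sqsubset> p" for n
  proof (rule c(2)[OF s(1,2)])
    show "c (s n) \<sqsubset> m" using s(5)[of n] m(2)[of "Suc n"] by (rule lt_trans)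
    show "m \<sqsubset> p" by (rule mp)
  qed
  have "r (s n) m \<in> - {x. x \<sqsubset> p}" for n using nl[of n] by simp
  moreover have "closed (- {x. x \<sqsubset> p})" using open_lt[of p] by (rule closed_Compl)
  ultimately have "r t m \<in> - {x. x \<sqsubset> p}"
    using closed_sequentially[of "- {x. x \<sqsubset> p}" "\<lambda>n. r (s n) m" "r t m"] t(3)[of m] by blast
  then show False using rm mp by simp
qed

text \<open>Countably many isolated points accumulate at \<open>p\<close> from this side. An
  increasing sequence of indices takes care of one after the other, so its supremum fixes them all
  and, the set of fixed points being closed, also \<open>p\<close>.\<close>

lemma not_unc_fixed:
  fixes p :: 'a
  assumes sk: "retractional_skeleton \<Sigma> R r" and p: "\<not> unc (\<sqsubset>) p" "\<not> open {x. \<not> x \<sqsubset> p}" and b: "b \<sqsubset> p"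
  shows "\<exists>s\<in>\<Sigma>. r s p = p"
proof -
  note skD = retractional_skeletonD[OF sk]
  obtain C where C: "countable C" "C \<subseteq> {x. x \<sqsubset> p}" "\<And>z. z \<sqsubset> p \<Longrightarrow> \<exists>c\<in>C. \<not> c \<sqsubset> z"
    using p(1) unfolding unc_def by metis
  have "\<exists>e. e \<in> open_ival c p \<and> open {e}" if c: "c \<sqsubset> p" for c
    using isolated_near[OF p(2) c] by (metis (mono_tags, lifting) mem_Collect_eq)
  then obtain e where e: "\<And>c. c \<sqsubset> p \<Longrightarrow> e c \<in> open_ival c p \<and> open {e c}" by metis
  have "C \<noteq> {}" using C(3)[OF b] by blast
  define d where "d n = e (from_nat_into C n)" for n :: nat
  have dC: "from_nat_into C n \<sqsubset> p" for n using from_nat_into[OF \<open>C \<noteq> {}\<close>, of n] C(2) by auto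
  have "\<exists>s\<in>\<Sigma>. \<forall>t\<in>\<Sigma>. (s, t) \<in> R \<longrightarrow> r t (d n) = d n" for n
    unfolding d_def using isolated_eventually_fixed[OF sk] e[OF dC] by blast
  then obtain u where u: "\<And>n. u n \<in> \<Sigma>" "\<And>n t. t \<in> \<Sigma> \<Longrightarrow> (u n, t) \<in> R \<Longrightarrow> r t (d n) = d n" by metis
  have "\<exists>w. w \<in> \<Sigma> \<and> (v, w) \<in> R \<and> (u n, w) \<in> R" if "v \<in> \<Sigma>" for v n
    using skD(4)[OF that u(1)] by blast
  then have "\<exists>s. \<forall>n. s n \<in> \<Sigma> \<and> ((s n, s (Suc n)) \<in> R \<and> (u n, s (Suc n)) \<in> R)"
    using dependent_nat_choice[of "\<lambda>_ v. v \<in> \<Sigma>" "\<lambda>n v w. (v, w) \<in> R \<and> (u n, w) \<in> R"] skD(3) by blast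
  then obtain s where s: "\<And>n. s n \<in> \<Sigma>" "\<And>n. (s n, s (Suc n)) \<in> R" "\<And>n. (u n, s (Suc n)) \<in> R" by blast
  have "range s \<subseteq> \<Sigma>" using s(1) by blast
  then obtain t where t: "t \<in> \<Sigma>" "\<And>n. (s n, t) \<in> R" using skD(8)[of s, OF _ s(2)] by blast
  have fixed: "d n \<in> {x. r t x = x}" for n
    using u(2)[OF t(1) transD[OF skD(1) s(3) t(2)]] by simp
  have cl: "closed {x. r t x = x}"
    by (intro closed_Collect_eq skD(5)[OF t(1)] continuous_on_id)
  have "p \<in> {x. r t x = x}"
  proof (rule ccontr)
    assume "p \<notin> {x. r t x = x}"
    then have "open (- {x. r t x = x})" "p \<in> - {x. r t x = x}" using cl by (auto simp: open_Compl)
    then obtain a where a: "a \<sqsubset> p" "ival a p \<subseteq> - {x. r t x = x}" using open_near[OF _ _ b] by blast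
    obtain k where k: "k \<in> C" "\<not> k \<sqsubset> a" using C(3)[OF a(1)] by blast
    obtain n where n: "from_nat_into C n = k" using from_nat_into_surj[OF C(1) k(1)] by blast
    have "d n \<in> open_ival k p" using e[OF dC[of n]] unfolding d_def n by blast
    then have "d n \<in> ival a p" using k(2) by (auto dest: lt_trans not_lt_trans)
    then show False using a(2) fixed by blast
  qed
  then show ?thesis using t(1) by blast
qed

end

context scattered_compact_line
begin

text \<open>Late retractions move \<open>p\<close> towards a side of uncountable cofinality. If the
  other side is of countable cofinality, some retraction and all later ones fix \<open>p\<close>; if
  not, late ones also move \<open>p\<close> the other way. Either combination is contradictory at a
  common later index.\<close>

lemma retractional_skeleton_no_M:
  assumes "has_retractional_skeleton TYPE('i) TYPE('a)"
  shows "(M_points :: 'a set) = {}"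
proof (rule ccontr)
  interpret L: oriented_line K "(<)" by unfold_locales simp
  interpret R: oriented_line K "(>)" by unfold_locales simp
  obtain \<Sigma> R and r :: "'i \<Rightarrow> 'a \<Rightarrow> 'a" where sk: "retractional_skeleton \<Sigma> R r"
    using assms unfolding has_retractional_skeleton_def by blast
  note skD = retractional_skeletonD[OF sk]
  assume "(M_points :: 'a set) \<noteq> {}"
  then obtain p :: 'a where p: "p \<in> M_points" by blast
  note pD = M_pointsD[OF p, unfolded left_unc_unc right_unc_unc]
  have not_open: "\<not> open {x. \<not> x < p}" "\<not> open {x. \<not> p < x}"
    using pD(1,2) by (simp_all add: not_less atLeast_def atMost_def)
  obtain a b where ab: "a < p" "p < b" using internal_pointD[of p] p by (auto simp: M_points_def)
  have fixed_up: "r t p = p" if s: "s \<in> \<Sigma>" "r s p = p" "t \<in> \<Sigma>" "(s, t) \<in> R" for s t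
    using skD(7)[OF s(1,3,4), of p] s(2) by simp
  show False
  proof (cases "unc (<) p")
    case True
    then obtain s where s: "s \<in> \<Sigma>" "\<And>t. t \<in> \<Sigma> \<Longrightarrow> (s, t) \<in> R \<Longrightarrow> r t p < p"
      using L.unc_retraction[OF sk] by blast
    show False
    proof (cases "unc (>) p")
      case True
      then obtain s' where s': "s' \<in> \<Sigma>" "\<And>t. t \<in> \<Sigma> \<Longrightarrow> (s', t) \<in> R \<Longrightarrow> p < r t p"
        using R.unc_retraction[OF sk] by blast
      obtain u where u: "u \<in> \<Sigma>" "(s, u) \<in> R" "(s', u) \<in> R" using skD(4)[OF s(1) s'(1)] by blast
      show False using s(2)[OF u(1,2)] s'(2)[OF u(1,3)] by (meson less_asym)
    next
      case False
      then obtain s' where s': "s' \<in> \<Sigma>" "r s' p = p"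
        using R.not_unc_fixed[OF sk _ not_open(2) ab(2)] by blast
      obtain u where u: "u \<in> \<Sigma>" "(s, u) \<in> R" "(s', u) \<in> R" using skD(4)[OF s(1) s'(1)] by blast
      show False using s(2)[OF u(1,2)] fixed_up[OF s' u(1,3)] by simp
    qed
  next
    case False
    then have "unc (>) p" using pD(3) by blast
    then obtain s where s: "s \<in> \<Sigma>" "\<And>t. t \<in> \<Sigma> \<Longrightarrow> (s, t) \<in> R \<Longrightarrow> p < r t p"
      using R.unc_retraction[OF sk] by blast
    obtain s' where s': "s' \<in> \<Sigma>" "r s' p = p"
      using L.not_unc_fixed[OF sk False not_open(1) ab(1)] by blast
    obtain u where u: "u \<in> \<Sigma>" "(s, u) \<in> R" "(s', u) \<in> R" using skD(4)[OF s(1) s'(1)] by blast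
    show False using s(2)[OF u(1,2)] fixed_up[OF s' u(1,3)] by simp
  qed
qed

end

section \<open>Norms of projections\<close>

text \<open>The test function \<open>f\<close> takes the values 1, -1, 1, -1, 1, -1 on the six
  successive pieces cut out by the chain. Its part \<open>s\<close> in \<open>T\<close> has the
  values -3 at \<open>y1\<close> and 1 at \<open>y2\<close>, to which \<open>P f\<close> adds twice
  the values of h = \<open>P (chi D)\<close>. So -k \<le> -3 + 2 h(y1) and 1 + 2 h(y2) \<le> k;
  adding these gives the claim.\<close>

lemma projection_norm_bound:
  fixes P :: "('a::linorder_topology \<Rightarrow>\<^sub>C real) \<Rightarrow> ('a \<Rightarrow>\<^sub>C real)"
  assumes P: "bounded_linear P" "onorm P \<le> k" "\<And>f. f \<in> T \<Longrightarrow> P f = f" and T: "subspace T"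
    and cuts: "D1 \<in> cutsets" "D2 \<in> cutsets" "D \<in> cutsets" "D3 \<in> cutsets" "D4 \<in> cutsets"
    and chain: "D1 \<subseteq> D2" "D2 \<subseteq> D" "D \<subseteq> D3" "D3 \<subseteq> D4"
    and inT: "chi D1 \<in> T" "chi D2 \<in> T" "chi D3 \<in> T" "chi D4 \<in> T" "chi UNIV \<in> T"
    and y: "y1 \<in> D2" "y1 \<notin> D1" "y2 \<in> D4" "y2 \<notin> D3"
  shows "2 - k \<le> apply_bcontfun (P (chi D)) y1 - apply_bcontfun (P (chi D)) y2"
proof -
  interpret bounded_linear P by (rule P(1))
  define s :: "'a \<Rightarrow>\<^sub>C real"
    where "s = 2 *\<^sub>R (chi D4 - chi D3) - 2 *\<^sub>R (chi D2 - chi D1) - chi UNIV"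
  define f where "f = s + 2 *\<^sub>R chi D"
  have "s \<in> T" unfolding s_def by (intro subspace_diff[OF T] subspace_scale[OF T] inT)
  then have Pf: "P f = s + 2 *\<^sub>R P (chi D)" unfolding f_def by (simp add: add scaleR P(3))
  have s: "apply_bcontfun s x = 2 * (indicator D4 x - indicator D3 x) - 2 * (indicator D2 x - indicator D1 x) - 1" for x
    unfolding s_def using cuts by (simp add: chi_cutset_apply)
  have "\<bar>apply_bcontfun f x\<bar> \<le> 1" for x
  proof -
    have "apply_bcontfun f x = apply_bcontfun s x + 2 * indicator D x"
      unfolding f_def using cuts by (simp add: chi_cutset_apply)
    then show ?thesis unfolding s using chain by (auto simp: indicator_def)
  qed
  then have "norm f \<le> 1" by (intro norm_bound) simp
  have "norm (P f) \<le> k"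
  proof -
    have "norm (P f) \<le> onorm P * norm f" by (rule onorm[OF P(1)])
    also have "\<dots> \<le> onorm P * 1"
      using \<open>norm f \<le> 1\<close> onorm_pos_le[OF P(1)] by (rule mult_left_mono)
    finally show ?thesis using P(2) by simp
  qed
  then have k: "\<bar>apply_bcontfun (P f) x\<bar> \<le> k" for x
    using norm_bounded[of "P f" x] by simp
  have val: "apply_bcontfun (P f) x = apply_bcontfun s x + 2 * apply_bcontfun (P (chi D)) x" for x
    unfolding Pf by simp
  have s1: "apply_bcontfun s y1 = - 3" unfolding s using chain y by (auto simp: indicator_def)
  have s2: "apply_bcontfun s y2 = 1" unfolding s using chain y by (auto simp: indicator_def)
  show ?thesis using k[of y1] k[of y2] unfolding val s1 s2 by (simp add: abs_le_iff)
qed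

lemma subspace_limit_at:
  "subspace {h :: 'a::topological_space \<Rightarrow>\<^sub>C real. (\<lambda>n. apply_bcontfun h (a n)) \<longlonglongrightarrow> apply_bcontfun h p}"
  unfolding subspace_def by (auto intro: tendsto_add tendsto_mult_left)

lemma closed_limit_at:
  "closed {h :: 'a::topological_space \<Rightarrow>\<^sub>C real. (\<lambda>n. apply_bcontfun h (a n)) \<longlonglongrightarrow> apply_bcontfun h p}"
  unfolding closed_sequential_limits
proof (intro allI impI)
  fix F :: "nat \<Rightarrow> 'a \<Rightarrow>\<^sub>C real" and h
  assume F: "(\<forall>n. F n \<in> {h. (\<lambda>n. apply_bcontfun h (a n)) \<longlonglongrightarrow> apply_bcontfun h p}) \<and> F \<longlonglongrightarrow> h"
  have "(\<lambda>n. apply_bcontfun h (a n)) \<longlonglongrightarrow> apply_bcontfun h p"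
  proof (rule tendstoI)
    fix e :: real assume "e > 0"
    then have "eventually (\<lambda>m. dist (F m) h < e / 3) sequentially"
      using F tendstoD[of F h sequentially "e / 3"] by simp
    then obtain m where m: "dist (F m) h < e / 3" by (auto simp: eventually_sequentially)
    have close: "\<bar>apply_bcontfun (F m) x - apply_bcontfun h x\<bar> < e / 3" for x
      using m dist_bounded[of "F m" x h] by (simp add: dist_real_def)
    have "(\<lambda>n. apply_bcontfun (F m) (a n)) \<longlonglongrightarrow> apply_bcontfun (F m) p" using F by blast
    then have "eventually (\<lambda>n. dist (apply_bcontfun (F m) (a n)) (apply_bcontfun (F m) p) < e / 3) sequentially"
      using \<open>e > 0\<close> by (intro tendstoD) auto
    then show "eventually (\<lambda>n. dist (apply_bcontfun h (a n)) (apply_bcontfun h p) < e) sequentially"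
    proof eventually_elim
      case (elim n)
      then show ?case using close[of "a n"] close[of p] unfolding dist_real_def by linarith
    qed
  qed
  then show "h \<in> {h. (\<lambda>n. apply_bcontfun h (a n)) \<longlonglongrightarrow> apply_bcontfun h p}" by simp
qed

context oriented_line
begin

text \<open>Each function of a countable dense set differs from its value at \<open>p\<close> by at
  most 1/(n+1) beyond some threshold; uncountable cofinality gives one point beyond all these
  thresholds.\<close>

lemma unc_constant:
  fixes p :: 'a and S :: "('a \<Rightarrow>\<^sub>C real) set"
  assumes p: "unc (\<sqsubset>) p" and S: "S \<in> Sep"
  shows "\<exists>c. c \<sqsubset> p \<and> (\<forall>f\<in>S. \<forall>y. c \<sqsubset> y \<longrightarrow> y \<sqsubset> p \<longrightarrow> apply_bcontfun f y = apply_bcontfun f p)"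
proof -
  obtain b where b: "b \<sqsubset> p" using uncD[OF p, of "{}"] by auto
  obtain C where C: "countable C" "S = closure C" using Sep_dense[OF S] by metis
  define near where "near f n c \<longleftrightarrow> c \<sqsubset> p \<and>
      (\<forall>y\<in>ival c p. dist (apply_bcontfun f y) (apply_bcontfun f p) \<le> inverse (real (Suc n)))"
    for f :: "'a \<Rightarrow>\<^sub>C real" and n c
  have "\<exists>c. near f n c" for f n
  proof -
    let ?O = "apply_bcontfun f -` ball (apply_bcontfun f p) (inverse (Suc n))"
    have "open ?O" by (intro open_vimage open_ball continuous_on_apply_bcontfun)
    moreover have "p \<in> ?O" by simp
    ultimately obtain c where c: "c \<sqsubset> p" "ival c p \<subseteq> ?O" using open_near[OF _ _ b] by blast
    have "dist (apply_bcontfun f y) (apply_bcontfun f p) \<le> inverse (Suc n)" if "y \<in> ival c p" for y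
      using subsetD[OF c(2) that] by (simp add: dist_commute)
    then show ?thesis using c(1) unfolding near_def by blast
  qed
  then obtain c where "\<And>f n. near f n (c f n)" by metis
  then have c: "\<And>f n. c f n \<sqsubset> p"
    "\<And>f n y. y \<in> ival (c f n) p \<Longrightarrow> dist (apply_bcontfun f y) (apply_bcontfun f p) \<le> inverse (real (Suc n))"
    unfolding near_def by blast+
  let ?A = "(\<lambda>(f, n). c f n) ` (C \<times> (UNIV :: nat set))"
  have "countable ?A" using C(1) by (intro countable_image countable_SIGMA) auto
  moreover have "?A \<subseteq> {x. x \<sqsubset> p}" using c(1) by auto
  ultimately obtain z where z: "z \<sqsubset> p" "\<forall>a\<in>?A. a \<sqsubset> z" using uncD[OF p] by metis
  have z': "c f n \<sqsubset> z" if "f \<in> C" for f n using z(2) that by auto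
  have "apply_bcontfun f y = apply_bcontfun f p" if y: "z \<sqsubset> y" "y \<sqsubset> p" and f: "f \<in> S" for f y
  proof -
    have "apply_bcontfun g y = apply_bcontfun g p" if g: "g \<in> C" for g
    proof -
      have "dist (apply_bcontfun g y) (apply_bcontfun g p) \<le> inverse (Suc n)" for n
      proof (rule c(2))
        have "c g n \<sqsubset> y" using z'[OF g, of n] y(1) by (meson lt_trans)
        then show "y \<in> ival (c g n) p" using y(2) by simp
      qed
      then have "dist (apply_bcontfun g y) (apply_bcontfun g p) \<le> 0"
        by (intro LIMSEQ_le_const[OF LIMSEQ_inverse_real_of_nat]) auto
      then show ?thesis by simp
    qed
    then have "C \<subseteq> {f. apply_bcontfun f y = apply_bcontfun f p}" by blast
    then have "S \<subseteq> {f. apply_bcontfun f y = apply_bcontfun f p}"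
      unfolding C(2) by (rule closure_minimal[OF _ closed_eq_at])
    then show ?thesis using f by blast
  qed
  then show ?thesis using z(1) by blast
qed

text \<open>A common description of both kinds of sides by thresholds \<open>g S n\<close>. With
  uncountable cofinality the threshold depends on \<open>S\<close> only and comes from
  \<open>unc_constant\<close>, so the sequence may stay away from \<open>p\<close>. With countable
  cofinality it depends on \<open>n\<close> only, runs through a cofinal set and forces convergence
  to \<open>p\<close>.\<close>

lemma approach:
  fixes p :: 'a
  assumes b: "b \<sqsubset> p"
  obtains g :: "('a \<Rightarrow>\<^sub>C real) set \<Rightarrow> nat \<Rightarrow> 'a"
  where "\<And>S n. S \<in> Sep \<Longrightarrow> g S n \<sqsubset> p"
    and "\<And>S a m h. (\<And>n. S n \<in> Sep) \<Longrightarrow> incseq S \<Longrightarrow> (\<And>n. a n \<sqsubset> a (Suc n)) \<Longrightarrow> (\<And>n. a n \<sqsubset> p) \<Longrightarrow>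
      (\<And>n. g (S n) n \<sqsubset> a (Suc n)) \<Longrightarrow> h \<in> S m \<Longrightarrow> (\<lambda>n. apply_bcontfun h (a n)) \<longlonglongrightarrow> apply_bcontfun h p"
proof (cases "unc (\<sqsubset>) p")
  case True
  obtain c where c: "\<And>S :: ('a \<Rightarrow>\<^sub>C real) set. S \<in> Sep \<Longrightarrow> c S \<sqsubset> p"
    "\<And>(S :: ('a \<Rightarrow>\<^sub>C real) set) f y. S \<in> Sep \<Longrightarrow> f \<in> S \<Longrightarrow> c S \<sqsubset> y \<Longrightarrow> y \<sqsubset> p \<Longrightarrow> apply_bcontfun f y = apply_bcontfun f p"
    using unc_constant[OF True] by metis
  show ?thesis
  proof (rule that[of "\<lambda>S n. c S"])
    show "c S \<sqsubset> p" if "S \<in> Sep" for S using c(1)[OF that] .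
    fix S :: "nat \<Rightarrow> ('a \<Rightarrow>\<^sub>C real) set" and a m h
    assume S: "\<And>n. S n \<in> Sep" "incseq S" and a: "\<And>n. a n \<sqsubset> p" "\<And>n. c (S n) \<sqsubset> a (Suc n)" and h: "h \<in> S m"
    have "apply_bcontfun h (a n) = apply_bcontfun h p" if n: "Suc m \<le> n" for n
    proof -
      obtain k where k: "n = Suc k" "m \<le> k" using n by (cases n) auto
      have "h \<in> S k" using incseqD[OF S(2) k(2)] h by blast
      then show ?thesis unfolding k(1) using c(2)[OF S(1) _ a(2) a(1)] by blast
    qed
    then have "eventually (\<lambda>n. apply_bcontfun h (a n) = apply_bcontfun h p) sequentially"
      by (rule eventually_sequentiallyI)
    then show "(\<lambda>n. apply_bcontfun h (a n)) \<longlonglongrightarrow> apply_bcontfun h p"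
      by (rule tendsto_eventually)
  qed
next
  case False
  obtain C where C: "countable C" "C \<subseteq> {x. x \<sqsubset> p}" "\<And>z. z \<sqsubset> p \<Longrightarrow> \<exists>c\<in>C. \<not> c \<sqsubset> z"
    using False unfolding unc_def by metis
  have ne: "C \<noteq> {}" using C(3)[OF b] by blast
  show ?thesis
  proof (rule that[of "\<lambda>S. from_nat_into C"])
    show "from_nat_into C n \<sqsubset> p" for n using from_nat_into[OF ne, of n] C(2) by auto
    fix S :: "nat \<Rightarrow> ('a \<Rightarrow>\<^sub>C real) set" and a :: "nat \<Rightarrow> 'a" and m and h :: "'a \<Rightarrow>\<^sub>C real"
    assume a: "\<And>n. a n \<sqsubset> a (Suc n)" "\<And>n. a n \<sqsubset> p" "\<And>n. from_nat_into C n \<sqsubset> a (Suc n)"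
    obtain q where q: "a \<longlonglongrightarrow> q" "\<And>n. a n \<sqsubset> q" "\<And>u. (\<And>n. a n \<sqsubset> u) \<Longrightarrow> \<not> u \<sqsubset> q"
      using monotone_limit[of a, OF a(1)] by blast
    have "\<not> p \<sqsubset> q" using q(3)[of p, OF a(2)] .
    moreover have "\<not> q \<sqsubset> p"
    proof
      assume "q \<sqsubset> p"
      then obtain c where c: "c \<in> C" "\<not> c \<sqsubset> q" using C(3) by blast
      obtain n where "from_nat_into C n = c" using from_nat_into_surj[OF C(1) c(1)] by blast
      then have "c \<sqsubset> a (Suc n)" using a(3)[of n] by simp
      then show False using q(2)[of "Suc n"] c(2) by (meson lt_trans)
    qed
    ultimately have "q = p" using lt_total by blast
    have "continuous_on UNIV (apply_bcontfun h)" by simp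
    then have "isCont (apply_bcontfun h) p" by (simp add: continuous_on_eq_continuous_at del: continuous_on_apply_bcontfun)
    then show "(\<lambda>n. apply_bcontfun h (a n)) \<longlonglongrightarrow> apply_bcontfun h p"
      using q(1) unfolding \<open>q = p\<close> by (rule isCont_tendsto_compose)
  qed
qed

end

section \<open>Projections of norm below 2 exclude points of M(K)\<close>

context scattered_compact_line
begin

lemma isolated_cutset:
  fixes x :: 'a
  assumes "open {x}"
  shows "{..x} \<in> cutsets"
proof -
  have "{..x} = {..<x} \<union> {x}" by auto
  then have "open {..x}" using assms by (metis open_Un open_lessThan)
  then show ?thesis by (rule cutsets_atMost)
qed

lemma Sep_enlarge:
  fixes S :: "'e::real_normed_vector set"
  assumes F: "closed_cofinal F" and S: "S \<in> Sep" and X: "countable X"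
  obtains S' where "S' \<in> F" "S \<subseteq> S'" "X \<subseteq> S'"
proof -
  obtain C where C: "countable C" "S = closure C" using Sep_dense[OF S] by metis
  have "closure (span (C \<union> X)) \<in> Sep" using C(1) X by (intro Sep_closure_span) simp
  then obtain S' where S': "S' \<in> F" "closure (span (C \<union> X)) \<subseteq> S'"
    using F unfolding closed_cofinal_def by blast
  have sup: "C \<union> X \<subseteq> span (C \<union> X)" by (rule span_superset)
  have "S \<subseteq> closure (span (C \<union> X))" unfolding C(2) using sup by (intro closure_mono) simp
  moreover have "X \<subseteq> closure (span (C \<union> X))" using sup closure_subset[of "span (C \<union> X)"] by auto
  ultimately show ?thesis using S' that by (meson order_trans)
qed

lemma SCP_no_M:
  assumes k: "k < 2" and scp: "continuous_SCP TYPE('a \<Rightarrow>\<^sub>C real) k"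
  shows "(M_points :: 'a set) = {}"
proof (rule ccontr)
  interpret L: oriented_line K "(<)" by unfold_locales simp
  interpret R: oriented_line K "(>)" by unfold_locales simp
  assume "(M_points :: 'a set) \<noteq> {}"
  then obtain p :: 'a where pM: "p \<in> M_points" by blast
  note pD = M_pointsD[OF pM]
  have not_open: "\<not> open {x. \<not> x < p}" "\<not> open {x. \<not> p < x}"
    using pD(1,2) by (simp_all add: not_less atLeast_def atMost_def)
  obtain a0 b0 where ab0: "a0 < p" "p < b0" using internal_pointD[of p] pM by (auto simp: M_points_def)
  obtain F :: "('a \<Rightarrow>\<^sub>C real) set set" where F: "closed_cofinal F"
    "\<And>S. S \<in> F \<Longrightarrow> \<exists>P. bounded_projection_onto S P \<and> onorm P \<le> k"
    using scp unfolding continuous_SCP_def by blast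
  have FSep: "S \<in> Sep" if "S \<in> F" for S using F(1) that unfolding closed_cofinal_def by blast
  obtain g :: "('a \<Rightarrow>\<^sub>C real) set \<Rightarrow> nat \<Rightarrow> 'a" where g: "\<And>S n. S \<in> Sep \<Longrightarrow> g S n < p"
    "\<And>S a m h. (\<And>n. S n \<in> Sep) \<Longrightarrow> incseq S \<Longrightarrow> (\<And>n. a n < a (Suc n)) \<Longrightarrow> (\<And>n. a n < p) \<Longrightarrow>
      (\<And>n. g (S n) n < a (Suc n)) \<Longrightarrow> h \<in> S m \<Longrightarrow> (\<lambda>n. apply_bcontfun h (a n)) \<longlonglongrightarrow> apply_bcontfun h p"
    by (rule L.approach[OF ab0(1)]) blast
  obtain g' :: "('a \<Rightarrow>\<^sub>C real) set \<Rightarrow> nat \<Rightarrow> 'a" where g': "\<And>S n. S \<in> Sep \<Longrightarrow> p < g' S n"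
    "\<And>S a m h. (\<And>n. S n \<in> Sep) \<Longrightarrow> incseq S \<Longrightarrow> (\<And>n. a (Suc n) < a n) \<Longrightarrow> (\<And>n. p < a n) \<Longrightarrow>
      (\<And>n. a (Suc n) < g' (S n) n) \<Longrightarrow> h \<in> S m \<Longrightarrow> (\<lambda>n. apply_bcontfun h (a n)) \<longlonglongrightarrow> apply_bcontfun h p"
    by (rule R.approach[OF ab0(2)]) blast
  define Pr where "Pr = (\<lambda>(S, a, b). S \<in> F \<and> a < p \<and> p < b)"
  \<comment> \<open>Passing the thresholds controls limits at \<open>p\<close>; the indicators at
    the new points go into the next subspace so that the fixed part of the test function will lie in
    the supremum \<open>T\<close>.\<close>
  define Q where "Q = (\<lambda>n (S, a, b) (S', a', b'). S \<subseteq> S' \<and> a < a' \<and> g S n < a' \<and> b' < b \<and> b' < g' S n \<and>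
    {..a'} \<in> cutsets \<and> {..b'} \<in> cutsets \<and> chi {..a'} \<in> S' \<and> chi {..b'} \<in> S' \<and> chi UNIV \<in> S')"
  have step: "\<exists>y. Pr y \<and> Q n x y" if "Pr x" for x n
  proof -
    obtain S a b where x: "x = (S, a, b)" by (cases x)
    have S: "S \<in> F" "a < p" "p < b" using that unfolding x Pr_def by auto
    note Ssep = FSep[OF S(1)]
    have "max a (g S n) < p" using S(2) g(1)[OF Ssep] by simp
    then obtain a' where a': "max a (g S n) < a'" "a' < p" "open {a'}" by (rule L.isolated_near[OF not_open(1)])
    have "p < min b (g' S n)" using S(3) g'(1)[OF Ssep] by simp
    then obtain b' where b': "b' < min b (g' S n)" "p < b'" "open {b'}" by (rule R.isolated_near[OF not_open(2)])
    obtain S' where S': "S' \<in> F" "S \<subseteq> S'" "{chi {..a'}, chi {..b'}, chi UNIV} \<subseteq> S'"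
      by (rule Sep_enlarge[OF F(1) Ssep, of "{chi {..a'}, chi {..b'}, chi UNIV}"]) auto
    have "Pr (S', a', b')" using S' a' b' by (simp add: Pr_def)
    moreover have "Q n x (S', a', b')"
      unfolding x Q_def using S' a' b' isolated_cutset by simp
    ultimately show ?thesis by blast
  qed
  have "closure (span {}) \<in> (Sep :: ('a \<Rightarrow>\<^sub>C real) set set)" by (rule Sep_closure_span) simp
  then obtain S0 where "S0 \<in> F" using F(1) unfolding closed_cofinal_def by blast
  then have start: "\<exists>x. Pr x" using ab0 by (intro exI[of _ "(S0, a0, b0)"]) (simp add: Pr_def)
  have "\<exists>f. \<forall>n. Pr (f n) \<and> Q n (f n) (f (Suc n))"
    by (rule dependent_nat_choice[of "\<lambda>_. Pr" Q, OF start step])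
  then obtain f where f: "\<And>n. Pr (f n)" "\<And>n. Q n (f n) (f (Suc n))" by blast
  define S a b where "S n = fst (f n)" and "a n = fst (snd (f n))" and "b n = snd (snd (f n))" for n
  have fn: "f n = (S n, a n, b n)" for n by (simp add: S_def a_def b_def)
  have seq: "S n \<in> F" "a n < p" "p < b n" for n
    using f(1)[of n] unfolding fn Pr_def by auto
  have nxt: "S n \<subseteq> S (Suc n)" "a n < a (Suc n)" "g (S n) n < a (Suc n)" "b (Suc n) < b n" "b (Suc n) < g' (S n) n"
    "{..a (Suc n)} \<in> cutsets" "{..b (Suc n)} \<in> cutsets" "chi {..a (Suc n)} \<in> S (Suc n)"
    "chi {..b (Suc n)} \<in> S (Suc n)" "chi UNIV \<in> S (Suc n)" for n
    using f(2)[of n] unfolding fn Q_def by auto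
  have inc: "incseq S" by (rule incseq_SucI, rule nxt(1))
  define T where "T = closure (span (\<Union>n. S n))"
  have TF: "T \<in> F"
    using F(1) inc seq(1) unfolding closed_cofinal_def T_def by blast
  obtain P where P: "bounded_projection_onto T P" "onorm P \<le> k" using F(2)[OF TF] by blast
  have T: "subspace T" unfolding T_def by (intro subspace_closure subspace_span)
  have ST: "S n \<subseteq> T" for n
    unfolding T_def using span_superset[of "\<Union>n. S n"] closure_subset[of "span (\<Union>n. S n)"] by blast
  have Pid: "P h = h" if h: "h \<in> T" for h
  proof -
    obtain u where "h = P u" using P(1) h unfolding bounded_projection_onto_def by blast
    then show ?thesis using P(1) unfolding bounded_projection_onto_def by (metis comp_apply)
  qed
  \<comment> \<open>On a side of uncountable cofinality the sequence stops short of
    \<open>p\<close>, which leaves room for an isolated point, and so for a cut, between the two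
    sequences.\<close>
  have "\<exists>x. {..x} \<in> cutsets \<and> (\<forall>n. a n < x \<and> x < b n)"
    using pD(3)
  proof
    assume lu: "left_unc p"
    have "\<exists>z<p. \<forall>c\<in>range a. c < z" by (rule left_uncD[OF lu]) (use seq(2) in auto)
    then obtain z where z: "z < p" "\<And>n. a n < z" by auto
    obtain x where x: "z < x" "x < p" "open {x}" by (rule L.isolated_near[OF not_open(1) z(1)])
    have "a n < x \<and> x < b n" for n using z(2)[of n] x(1,2) seq(3)[of n] by (meson less_trans)
    then show ?thesis using isolated_cutset[OF x(3)] by blast
  next
    assume ru: "right_unc p"
    have "\<exists>z>p. \<forall>c\<in>range b. z < c" by (rule right_uncD[OF ru]) (use seq(3) in auto)
    then obtain z where z: "p < z" "\<And>n. z < b n" by auto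
    obtain x where x: "x < z" "p < x" "open {x}" by (rule R.isolated_near[OF not_open(2) z(1)])
    have "a n < x \<and> x < b n" for n using z(2)[of n] x(1,2) seq(2)[of n] by (meson less_trans)
    then show ?thesis using isolated_cutset[OF x(3)] by blast
  qed
  then obtain x where x: "{..x} \<in> cutsets" "\<And>n. a n < x" "\<And>n. x < b n" by blast
  define h where "h = P (chi {..x})"
  have hT: "h \<in> T" unfolding h_def using P(1) unfolding bounded_projection_onto_def by blast
  \<comment> \<open>Convergence along a sequence to the value at \<open>p\<close> is a closed linear
    condition, so it passes from the subspaces to their supremum.\<close>
  have lim: "T \<subseteq> {h. (\<lambda>n. apply_bcontfun h (c n)) \<longlonglongrightarrow> apply_bcontfun h p}"
    if "\<And>m h. h \<in> S m \<Longrightarrow> (\<lambda>n. apply_bcontfun h (c n)) \<longlonglongrightarrow> apply_bcontfun h p" for c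
    unfolding T_def by (rule closure_minimal[OF span_minimal[OF _ subspace_limit_at] closed_limit_at]) (use that in blast)
  have Ssep: "S n \<in> Sep" for n by (rule FSep[OF seq(1)])
  have la: "(\<lambda>n. apply_bcontfun h (a n)) \<longlonglongrightarrow> apply_bcontfun h p"
  proof -
    have "T \<subseteq> {h. (\<lambda>n. apply_bcontfun h (a n)) \<longlonglongrightarrow> apply_bcontfun h p}"
      by (rule lim, erule g(2)[OF Ssep inc nxt(2) seq(2) nxt(3)])
    then show ?thesis using hT by blast
  qed
  have lb: "(\<lambda>n. apply_bcontfun h (b n)) \<longlonglongrightarrow> apply_bcontfun h p"
  proof -
    have "T \<subseteq> {h. (\<lambda>n. apply_bcontfun h (b n)) \<longlonglongrightarrow> apply_bcontfun h p}"
      by (rule lim, erule g'(2)[OF Ssep inc nxt(4) seq(3) nxt(5)])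
    then show ?thesis using hT by blast
  qed
  \<comment> \<open>Index 0 is left out because the indicators at \<open>a 0\<close> and
    \<open>b 0\<close> need not lie in \<open>T\<close>. The right-hand side tends to 0, which gives
    k at least 2.\<close>
  have "2 - k \<le> apply_bcontfun h (a (Suc (Suc n))) - apply_bcontfun h (b (Suc n))" for n
    unfolding h_def
  proof (rule projection_norm_bound[OF _ P(2) Pid T nxt(6)[of n] nxt(6)[of "Suc n"] x(1) nxt(7)[of "Suc n"] nxt(7)[of n]])
    show "bounded_linear P" using P(1) unfolding bounded_projection_onto_def by blast
    show "{..a (Suc n)} \<subseteq> {..a (Suc (Suc n))}" "{..a (Suc (Suc n))} \<subseteq> {..x}" "{..x} \<subseteq> {..b (Suc (Suc n))}"
      "{..b (Suc (Suc n))} \<subseteq> {..b (Suc n)}"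
      using nxt(2)[of "Suc n"] x(2)[of "Suc (Suc n)"] x(3)[of "Suc (Suc n)"] nxt(4)[of "Suc n"]
      by (simp_all add: less_imp_le)
    show "chi {..a (Suc n)} \<in> T" "chi {..a (Suc (Suc n))} \<in> T" "chi {..b (Suc (Suc n))} \<in> T"
      "chi {..b (Suc n)} \<in> T" "chi UNIV \<in> T"
      using nxt(8-10) ST by blast+
    show "a (Suc (Suc n)) \<in> {..a (Suc (Suc n))}" "a (Suc (Suc n)) \<notin> {..a (Suc n)}"
      "b (Suc n) \<in> {..b (Suc n)}" "b (Suc n) \<notin> {..b (Suc (Suc n))}"
      using nxt(2)[of "Suc n"] nxt(4)[of "Suc n"] by (simp_all add: not_le)
  qed
  moreover have "(\<lambda>n. apply_bcontfun h (a (Suc (Suc n))) - apply_bcontfun h (b (Suc n)))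
      \<longlonglongrightarrow> apply_bcontfun h p - apply_bcontfun h p"
    by (intro tendsto_diff LIMSEQ_Suc la lb)
  ultimately have "2 - k \<le> apply_bcontfun h p - apply_bcontfun h p"
    by (intro LIMSEQ_le_const) auto
  then show False using k by simp
qed

end

lemma projectional_skeleton_SCP:
  "has_projectional_skeleton TYPE('e::real_normed_vector) k \<Longrightarrow> continuous_SCP TYPE('e) k"
  unfolding has_projectional_skeleton_def projectional_skeleton_def continuous_SCP_def by meson

lemma has_projectional_skeleton_mono:
  "has_projectional_skeleton TYPE('e::real_normed_vector) k \<Longrightarrow> k \<le> l \<Longrightarrow>
    has_projectional_skeleton TYPE('e) l"
  unfolding has_projectional_skeleton_def by (meson order_trans)

text \<open>The clause with \<open>'i\<close> shows that the index type \<open>'a set\<close> loses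
  nothing: a skeleton over any index type forces M(K) to be empty, and then one over
  \<open>'a set\<close> exists.\<close>

theorem theorem4p1:
  assumes "compact (UNIV :: 'a::linorder_topology set)"
    and "scattered_space TYPE('a)"
  shows
    "((has_retractional_skeleton TYPE('a set) TYPE('a)
        \<longleftrightarrow> has_projectional_skeleton TYPE('a \<Rightarrow>\<^sub>C real) 1) \<and>
      (has_projectional_skeleton TYPE('a \<Rightarrow>\<^sub>C real) 1
        \<longleftrightarrow> (\<exists>k. 1 \<le> k \<and> k < 2 \<and> continuous_SCP TYPE('a \<Rightarrow>\<^sub>C real) k)) \<and>
      ((\<exists>k. 1 \<le> k \<and> k < 2 \<and> continuous_SCP TYPE('a \<Rightarrow>\<^sub>C real) k)
        \<longleftrightarrow> (M_points :: 'a set) = {}) \<and>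
      (has_retractional_skeleton TYPE('i) TYPE('a)
        \<longrightarrow> has_retractional_skeleton TYPE('a set) TYPE('a))) \<and>
     (finite (M_points :: 'a set) \<longrightarrow> has_projectional_skeleton TYPE('a \<Rightarrow>\<^sub>C real) 4) \<and>
     (countable (M_points :: 'a set) \<longrightarrow> continuous_SCP TYPE('a \<Rightarrow>\<^sub>C real) 3)"
proof -
  interpret scattered_compact_line "TYPE('a)"
    using assms by unfold_locales
  let ?C = "TYPE('a \<Rightarrow>\<^sub>C real)"
  have M_proj: "has_projectional_skeleton ?C 1" if "(M_points :: 'a set) = {}"
    using countable_M_projectional_skeleton(2) that by simp
  have proj_SCP: "\<exists>k. 1 \<le> k \<and> k < 2 \<and> continuous_SCP ?C k" if "has_projectional_skeleton ?C 1"
    using projectional_skeleton_SCP[OF that] by (intro exI[of _ 1]) simp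
  have SCP_M: "(M_points :: 'a set) = {}" if "\<exists>k. 1 \<le> k \<and> k < 2 \<and> continuous_SCP ?C k"
    using that SCP_no_M by blast
  have fin: "has_projectional_skeleton ?C 4" if "finite (M_points :: 'a set)"
    using countable_M_projectional_skeleton(1)[OF countable_finite[OF that]]
    by (rule has_projectional_skeleton_mono) simp
  have count: "continuous_SCP ?C 3" if "countable (M_points :: 'a set)"
    by (rule projectional_skeleton_SCP[OF countable_M_projectional_skeleton(1)[OF that]])
  show ?thesis
    using M_proj proj_SCP SCP_M fin count no_M_retractional_skeleton
      retractional_skeleton_no_M[where 'i = "'a set"] retractional_skeleton_no_M[where 'i = 'i]
    by argo
qed

end
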